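(* Fix integers $N,K\ge 1$ and real numbers $M>0$, $\alpha>0$. Let $\Phi:(S_{M,K})^N\to\mathcal{P}(S_{M,NK})$, $(X_1,\dots,X_N)\mapsto\mu_X$, be the map sending a set of diagrams to its probabilistic Fréchet mean (with perturbation parameter $\alpha$). Let $\overline M$ be the maximal $W_2$-distance between two diagrams in $S_{M,NK}$, let $$C=\sqrt{2\left(\frac1{N^2}+\frac{\overline M^2}{\alpha^2}\right)+\frac{4\overline M^2}{\alpha}+1},$$ and let $C'=\max\{C\sqrt{NK+1},\ \overline M\}$. Then $\Phi$ is Hölder continuous with exponent $1/2$ and constant $C'$; that is, $$\mathbb{W}_2(\mu_X,\mu_Y)\le C'\sqrt{\overrightarrow{d_2}(X,Y)}\qquad\text{for all }X,Y\in(S_{M,K})^N.$$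
   Context: **Diagrams.** $\|\cdot\|$ is the Euclidean norm on $\mathbb{R}^2$. $\Delta=\{(t,t):t\in\mathbb{R}\}$ is the diagonal and $\|x-\Delta\|=\min_{z\in\Delta}\|x-z\|$. A persistence diagram is a countable multiset of off-diagonal points in $\{(b,d)\in\mathbb{R}^2: d>b\}$ together with countably infinitely many copies of every point of $\Delta$. A matching $\phi:X\to Y$ of diagrams is a bijection. $W_2(X,Y)=\inf_{\phi}\big(\sum_{x\in X}\|x-\phi(x)\|^2\big)^{1/2}$ over all matchings. $S_{M,K}$ is the set of diagrams with at most $K$ off-diagonal points (counted with multiplicity), all of whose off-diagonal points $(x_1,x_2)$ satisfy $0\le x_1,x_2\le M$; it has the metric $W_2$. On $(S_{M,K})^N$ put $\overrightarrow{d_2}(X,Y)=\big(\sum_{i=1}^N W_2(X_i,Y_i)^2\big)^{1/2}$. **Wasserstein distance on measures.** $\mathcal{P}(S_{M,NK})$ is the space of probability measures with finite second moment on $S_{M,NK}$, with metric $\mathbb{W}_2(\nu,\eta)=\big(\inf_\gamma\int W_2(U,V)^2\,d\gamma(U,V)\big)^{1/2}$, the infimum over couplings $\gamma$ of $\nu$ and $\eta$. **Selections and groupings.** Let $X=(X_1,\dots,X_N)$ be diagrams with finitely many off-diagonal points, which are labeled (so repeated points are distinguished). A selection is a choice, for each $i$, of either an off-diagonal point of $X_i$ or the symbol $\Delta$. The trivial selection for an off-diagonal $x\in X_i$ chooses $x$ for $X_i$ and $\Delta$ for all other diagrams. A grouping is a collection of selections such that every off-diagonal point of every diagram is in exactly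 one selection; groupings are identified up to reordering and up to adding or removing all-$\Delta$ selections. $\mathrm{mean}(s)$ is the point of the plane minimizing the sum of squared distances to the $N$ elements of $s$ (distance to an entry $\Delta$ is distance to the diagonal). $\mathrm{mean}_X(G)$ is the diagram whose off-diagonal points are the $\mathrm{mean}(s)$ for the (not all-$\Delta$) selections $s$ of $G$. A grouping $G$ is optimal for $X$ if $\mathrm{mean}_X(G)$ minimizes the Fréchet function $Z\mapsto\sum_{i=1}^N W_2(Z,X_i)^2$ over diagrams $Z$ with $W_2(Z,D_\emptyset)<\infty$, where $D_\emptyset$ is the diagram with no off-diagonal points. **The random grouping $\mathcal{H}_X$ and the PFM.** Fix $\alpha>0$. For an off-diagonal point $x$ let $r=\min\{\alpha,\|x-\Delta\|\}$ and let $\eta_x$ be the probability distribution on $\mathbb{R}^2\cup\{\Delta\}$ given by $\eta_x=\frac1{\pi\alpha^2}\mathbf{1}_{B(x,r)}+\frac{\alpha^2-r^2}{\alpha^2}\delta_\Delta$ (first term: density with respect to Lebesgue measure; second term: an atom at $\Delta$). Given $X\in(S_{M,K})^N$, draw independently $x'\sim\eta_x$ for each labeled off-diagonal point $x$ of each $X_i$, and let $X_i'$ be the diagram whose off-diagonal points are those $x'\ne\Delta$ with $x\in X_i$. With probability one $X_1',\dots,X_N'$ have a unique optimal grouping; replacing each $x'$ in it by $x$ and adding the trivial selection for every $x$ with $x'=\Delta$ gives a grouping of $X$. This random grouping is $\mathcal{H}_X$. The probabilistic Fréchet mean (PFM) of $X$ is $\mu_X=\sum_G\mathbb{P}(\mathcal{H}_X=G)\,\delta_{\mathrm{mean}_X(G)}\in\mathcal{P}(S_{M,NK})$,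 the sum over all groupings $G$ of $X$. *)

theory Defs
  imports "HOL-Probability.Probability"
begin

subsection \<open>Persistence diagrams and the Wasserstein distance\<close>

type_synonym point = "real \<times> real"

definition diagonal :: "point set" where
  "diagonal = {(t, t) | t. True}"

text \<open>A diagram is given by its multiplicity function on the plane.\<close>

typedef diagram =
  "{m :: point \<Rightarrow> enat.
      (\<forall>p. fst p = snd p \<longrightarrow> m p = \<infinity>) \<and>
      (\<forall>p. snd p < fst p \<longrightarrow> m p = 0) \<and>
      countable {p. fst p < snd p \<and> m p \<noteq> 0}}"
  morphisms mult Abs_diagram
  by (rule exI[of _ "\<lambda>p. if fst p = snd p then \<infinity> else 0"])
     (auto intro: countable_subset[of _ "{}"])

text \<open>The elements of a diagram as a multiset: a point of multiplicity \<open>m\<close> has the copies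
  \<open>(p, k)\<close> with \<open>k < m\<close>.\<close>

definition elems :: "diagram \<Rightarrow> (point \<times> nat) set" where
  "elems X = {(p, k). enat k < mult X p}"

definition offdiag :: "diagram \<Rightarrow> (point \<times> nat) set" where
  "offdiag X = {z \<in> elems X. fst z \<notin> diagonal}"

definition matchings :: "diagram \<Rightarrow> diagram \<Rightarrow> (point \<times> nat \<Rightarrow> point \<times> nat) set" where
  "matchings X Y = {\<phi>. bij_betw \<phi> (elems X) (elems Y)}"

definition ennsqrt :: "ennreal \<Rightarrow> ennreal" where
  "ennsqrt a = (if a = \<infinity> then \<infinity> else ennreal (sqrt (enn2real a)))"

definition W2 :: "diagram \<Rightarrow> diagram \<Rightarrow> ennreal" where
  "W2 X Y = (INF \<phi>\<in>matchings X Y.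
     ennsqrt (\<Sum>\<^sub>\<infinity>z\<in>elems X. ennreal ((norm (fst z - fst (\<phi> z)))\<^sup>2)))"

definition dgm_space :: "real \<Rightarrow> nat \<Rightarrow> diagram set" where
  "dgm_space M K = {X. finite (offdiag X) \<and> card (offdiag X) \<le> K \<and>
     (\<forall>(p, k)\<in>offdiag X. 0 \<le> fst p \<and> fst p \<le> M \<and> 0 \<le> snd p \<and> snd p \<le> M)}"

text \<open>A tuple of \<open>N\<close> diagrams is a function on the naturals of which only the values at
  \<open>i < N\<close> are used.\<close>

definition tuple_dist :: "nat \<Rightarrow> (nat \<Rightarrow> diagram) \<Rightarrow> (nat \<Rightarrow> diagram) \<Rightarrow> ennreal" where
  "tuple_dist N X Y = ennsqrt (\<Sum>i<N. (W2 (X i) (Y i))\<^sup>2)"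

text \<open>The supremum is finite and, the space being compact, it is attained.\<close>

definition max_W2 :: "real \<Rightarrow> nat \<Rightarrow> real" where
  "max_W2 M K = enn2real (SUP U\<in>dgm_space M K. SUP V\<in>dgm_space M K. W2 U V)"


subsection \<open>Probability measures on diagram space\<close>

definition dgm_open :: "real \<Rightarrow> nat \<Rightarrow> diagram set \<Rightarrow> bool" where
  "dgm_open M K U \<longleftrightarrow> U \<subseteq> dgm_space M K \<and>
     (\<forall>X\<in>U. \<exists>e>0. \<forall>Y\<in>dgm_space M K. W2 X Y < ennreal e \<longrightarrow> Y \<in> U)"

definition dgm_borel :: "real \<Rightarrow> nat \<Rightarrow> diagram measure" where
  "dgm_borel M K = sigma (dgm_space M K) {U. dgm_open M K U}"

definition dgm_prob :: "real \<Rightarrow> nat \<Rightarrow> diagram measure set" where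
  "dgm_prob M K = {\<nu>. prob_space \<nu> \<and> sets \<nu> = sets (dgm_borel M K) \<and>
     (\<forall>U\<in>dgm_space M K. (\<integral>\<^sup>+ V. (W2 U V)\<^sup>2 \<partial>\<nu>) < \<infinity>)}"

definition couplings :: "'a measure \<Rightarrow> 'b measure \<Rightarrow> ('a \<times> 'b) measure set" where
  "couplings \<nu> \<eta> = {\<gamma>. sets \<gamma> = sets (\<nu> \<Otimes>\<^sub>M \<eta>) \<and> distr \<gamma> \<nu> fst = \<nu> \<and> distr \<gamma> \<eta> snd = \<eta>}"

definition WW2 :: "diagram measure \<Rightarrow> diagram measure \<Rightarrow> ennreal" where
  "WW2 \<nu> \<eta> = ennsqrt (INF \<gamma>\<in>couplings \<nu> \<eta>. \<integral>\<^sup>+ (U, V). (W2 U V)\<^sup>2 \<partial>\<gamma>)"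


subsection \<open>Selections, groupings and means\<close>

text \<open>The labeled off-diagonal points of a tuple: the label \<open>(i, p, k)\<close> is the \<open>k\<close>-th copy of
  \<open>p\<close> in the \<open>i\<close>-th diagram.  A labeled tuple of finite diagrams is represented below by a finite
  set \<open>A\<close> of labels together with the locations \<open>q :: label \<Rightarrow> point\<close> of the labeled points;
  perturbing the points changes \<open>q\<close> and keeps the labels.\<close>

type_synonym label = "nat \<times> point \<times> nat"

definition labels :: "nat \<Rightarrow> (nat \<Rightarrow> diagram) \<Rightarrow> label set" where
  "labels N X = (SIGMA i:{..<N}. offdiag (X i))"

definition loc :: "label \<Rightarrow> point" where
  "loc l = fst (snd l)"

text \<open>In a selection, \<open>None\<close> stands for the symbol \<open>\<Delta>\<close>.\<close>

type_synonym selection = "nat \<rightharpoonup> label"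

definition is_selection :: "nat \<Rightarrow> label set \<Rightarrow> selection \<Rightarrow> bool" where
  "is_selection N A s \<longleftrightarrow> (\<forall>i l. s i = Some l \<longrightarrow> i < N \<and> l \<in> A \<and> fst l = i)"

definition trivial_selection :: "label \<Rightarrow> selection" where
  "trivial_selection l = [fst l \<mapsto> l]"

text \<open>Groupings are taken up to reordering and all-\<open>\<Delta>\<close> selections, so a grouping is a set of
  selections other than the all-\<open>\<Delta>\<close> one.\<close>

definition is_grouping :: "nat \<Rightarrow> label set \<Rightarrow> selection set \<Rightarrow> bool" where
  "is_grouping N A G \<longleftrightarrow> (\<forall>s\<in>G. is_selection N A s \<and> s \<noteq> Map.empty) \<and>
     (\<forall>l\<in>A. \<exists>!s. s \<in> G \<and> l \<in> ran s)"

definition selection_cost :: "nat \<Rightarrow> (label \<Rightarrow> point) \<Rightarrow> selection \<Rightarrow> point \<Rightarrow> real" where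
  "selection_cost N q s p =
     (\<Sum>i<N. case s i of None \<Rightarrow> (infdist p diagonal)\<^sup>2 | Some l \<Rightarrow> (norm (p - q l))\<^sup>2)"

definition mean :: "nat \<Rightarrow> (label \<Rightarrow> point) \<Rightarrow> selection \<Rightarrow> point" where
  "mean N q s = (THE p. is_arg_min (selection_cost N q s) (\<lambda>_. True) p)"

text \<open>The diagram with off-diagonal points \<open>f a\<close> for \<open>a\<close> in the finite set \<open>A\<close>.\<close>

definition diagram_of :: "('a \<Rightarrow> point) \<Rightarrow> 'a set \<Rightarrow> diagram" where
  "diagram_of f A = Abs_diagram (\<lambda>p. if fst p = snd p then \<infinity>
     else if fst p < snd p then enat (card {a \<in> A. f a = p}) else 0)"

lemma mult_diagram_of:
  assumes "finite A"
  shows "mult (diagram_of f A) p = (if fst p = snd p then \<infinity>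
     else if fst p < snd p then enat (card {a \<in> A. f a = p}) else 0)"
proof -
  have "{p. fst p < snd p \<and> card {a \<in> A. f a = p} \<noteq> 0} \<subseteq> f ` A"
    by (auto simp: card_eq_0_iff) (metis imageI)
  then have "countable {p. fst p < snd p \<and> card {a \<in> A. f a = p} \<noteq> 0}"
    using assms by (meson countable_finite finite_imageI finite_subset)
  then have "countable {p. fst p < snd p \<and> (if fst p = snd p then \<infinity>
     else if fst p < snd p then enat (card {a \<in> A. f a = p}) else 0) \<noteq> 0}"
    by (rule countable_subset[rotated]) (auto simp: zero_enat_def)
  then show ?thesis
    unfolding diagram_of_def by (subst Abs_diagram_inverse) auto
qed

definition empty_diagram :: diagram where
  "empty_diagram = Abs_diagram (\<lambda>p. if fst p = snd p then \<infinity> else 0)"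

definition mean_diagram :: "nat \<Rightarrow> (label \<Rightarrow> point) \<Rightarrow> selection set \<Rightarrow> diagram" where
  "mean_diagram N q G = diagram_of (mean N q) G"

definition frechet :: "nat \<Rightarrow> (nat \<Rightarrow> diagram) \<Rightarrow> diagram \<Rightarrow> ennreal" where
  "frechet N X Z = (\<Sum>i<N. (W2 Z (X i))\<^sup>2)"

definition optimal_grouping ::
    "nat \<Rightarrow> label set \<Rightarrow> (label \<Rightarrow> point) \<Rightarrow> selection set \<Rightarrow> bool" where
  "optimal_grouping N A q G \<longleftrightarrow> is_grouping N A G \<and>
     is_arg_min (frechet N (\<lambda>i. diagram_of q {l \<in> A. fst l = i}))
       (\<lambda>Z. W2 Z empty_diagram < \<infinity>) (mean_diagram N q G)"


subsection \<open>The random grouping and the probabilistic Frechet mean\<close>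

text \<open>\<open>None\<close> is the extra point \<open>\<Delta>\<close>, which is isolated in the measurable structure.\<close>

definition perturb :: "real \<Rightarrow> point \<Rightarrow> point option measure" where
  "perturb \<alpha> x = (let r = min \<alpha> (infdist x diagonal) in
     measure_of UNIV {B. Some -` B \<in> sets borel}
       (\<lambda>B. ennreal (1 / (pi * \<alpha>\<^sup>2)) * emeasure lborel (Some -` B \<inter> ball x r)
            + ennreal ((\<alpha>\<^sup>2 - r\<^sup>2) / \<alpha>\<^sup>2) * indicator B None))"

text \<open>The grouping obtained from the outcome \<open>\<omega>\<close> of the perturbation of the points labeled by
  \<open>A\<close>.  It is undefined (\<open>None\<close>) on the null set of outcomes for which the perturbed points do not
  form diagrams or the perturbed diagrams do not have a unique optimal grouping.\<close>

definition grouping_of_outcome ::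
    "nat \<Rightarrow> label set \<Rightarrow> (label \<Rightarrow> point option) \<Rightarrow> selection set option" where
  "grouping_of_outcome N A \<omega> =
     (let A' = {l \<in> A. \<omega> l \<noteq> None}; q' = (\<lambda>l. the (\<omega> l)) in
      if (\<forall>l\<in>A'. fst (q' l) < snd (q' l)) \<and> (\<exists>!G. optimal_grouping N A' q' G)
      then Some ((THE G. optimal_grouping N A' q' G) \<union> trivial_selection ` (A - A'))
      else None)"

definition prob_grouping ::
    "nat \<Rightarrow> real \<Rightarrow> (nat \<Rightarrow> diagram) \<Rightarrow> selection set \<Rightarrow> real" where
  "prob_grouping N \<alpha> X G =
     (let P = (\<Pi>\<^sub>M l\<in>labels N X. perturb \<alpha> (loc l))
      in measure P {\<omega> \<in> space P. grouping_of_outcome N (labels N X) \<omega> = Some G})"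

definition pfm :: "nat \<Rightarrow> nat \<Rightarrow> real \<Rightarrow> real \<Rightarrow> (nat \<Rightarrow> diagram) \<Rightarrow> diagram measure" where
  "pfm N K M \<alpha> X =
     measure_of (dgm_space M (N * K)) (sets (dgm_borel M (N * K)))
       (\<lambda>B. \<Sum>G\<in>{G. is_grouping N (labels N X) G}.
              ennreal (prob_grouping N \<alpha> X G) * indicator B (mean_diagram N loc G))"

text \<open>The set functions given to \<^const>\<open>measure_of\<close> are indeed measures.\<close>

lemma sets_perturb: "sets (perturb \<alpha> x) = {B. Some -` B \<in> sets borel}"
  and emeasure_perturb:
    "Some -` B \<in> sets borel \<Longrightarrow> r = min \<alpha> (infdist x diagonal) \<Longrightarrow>
      emeasure (perturb \<alpha> x) B =
        ennreal (1 / (pi * \<alpha>\<^sup>2)) * emeasure lborel (Some -` B \<inter> ball x r)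
        + ennreal ((\<alpha>\<^sup>2 - r\<^sup>2) / \<alpha>\<^sup>2) * indicator B None"
proof -
  let ?S = "{B :: point option set. Some -` B \<in> sets borel}"
  have sa: "sigma_algebra UNIV ?S"
    unfolding sigma_algebra_iff2 by (auto simp: vimage_Diff vimage_UN)
  show "sets (perturb \<alpha> x) = ?S"
    using sigma_algebra.sigma_sets_eq[OF sa] by (simp add: perturb_def Let_def)
  assume B: "Some -` B \<in> sets borel" and r: "r = min \<alpha> (infdist x diagonal)"
  let ?f = "\<lambda>B. ennreal (1 / (pi * \<alpha>\<^sup>2)) * emeasure lborel (Some -` B \<inter> ball x r)
            + ennreal ((\<alpha>\<^sup>2 - r\<^sup>2) / \<alpha>\<^sup>2) * indicator B None"
  have "countably_additive ?S ?f"
  proof (rule countably_additiveI)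
    fix A :: "nat \<Rightarrow> point option set"
    assume A: "range A \<subseteq> ?S" "disjoint_family A"
    have "(\<Sum>n. emeasure lborel (Some -` A n \<inter> ball x r))
        = emeasure lborel (\<Union>n. Some -` A n \<inter> ball x r)"
      using A by (intro suminf_emeasure) (auto simp: disjoint_family_on_def)
    then show "(\<Sum>n. ?f (A n)) = ?f (\<Union>n. A n)"
      using A by (simp add: suminf_add[symmetric] suminf_indicator vimage_UN Int_UN_distrib2)
  qed
  moreover have "positive ?S ?f"
    by (simp add: positive_def)
  ultimately show "emeasure (perturb \<alpha> x) B = ?f B"
    using emeasure_measure_of_sigma[OF sa, of ?f B] B r
    by (simp add: perturb_def Let_def)
qed

lemma prob_space_perturb:
  assumes "\<alpha> > 0"
  shows "prob_space (perturb \<alpha> x)"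
proof
  define r where "r = min \<alpha> (infdist x diagonal)"
  have r: "0 \<le> r" "r \<le> \<alpha>"
    using assms by (auto simp: r_def infdist_nonneg)
  then have sq: "r\<^sup>2 \<le> \<alpha>\<^sup>2"
    by (simp add: power_mono)
  have "emeasure lborel (ball x r) = ennreal (pi * r\<^sup>2)"
    using emeasure_ball[OF r(1), of x] by (simp add: unit_ball_vol_2 power2_eq_square)
  then have "emeasure (perturb \<alpha> x) UNIV
      = ennreal (1 / (pi * \<alpha>\<^sup>2)) * ennreal (pi * r\<^sup>2) + ennreal ((\<alpha>\<^sup>2 - r\<^sup>2) / \<alpha>\<^sup>2)"
    by (simp add: emeasure_perturb[OF _ r_def])
  also have "\<dots> = ennreal (1 / (pi * \<alpha>\<^sup>2) * (pi * r\<^sup>2) + (\<alpha>\<^sup>2 - r\<^sup>2) / \<alpha>\<^sup>2)"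
    using sq by (simp add: ennreal_mult[symmetric] ennreal_plus[symmetric] del: ennreal_plus)
  also have "\<dots> = 1"
    using assms by (simp add: field_simps)
  finally show "emeasure (perturb \<alpha> x) (space (perturb \<alpha> x)) = 1"
    by (simp add: perturb_def Let_def space_measure_of_conv)
qed

lemma sets_pfm: "sets (pfm N K M \<alpha> X) = sets (dgm_borel M (N * K))"
  and emeasure_pfm:
    "B \<in> sets (dgm_borel M (N * K)) \<Longrightarrow> emeasure (pfm N K M \<alpha> X) B =
       (\<Sum>G\<in>{G. is_grouping N (labels N X) G}.
          ennreal (prob_grouping N \<alpha> X G) * indicator B (mean_diagram N loc G))"
proof -
  let ?S = "sets (dgm_borel M (N * K))"
  have sp: "space (dgm_borel M (N * K)) = dgm_space M (N * K)"
    by (auto simp: dgm_borel_def dgm_open_def space_measure_of_conv)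
  have sa: "sigma_algebra (dgm_space M (N * K)) ?S"
    using sets.sigma_algebra_axioms[of "dgm_borel M (N * K)"] by (simp add: sp)
  show "sets (pfm N K M \<alpha> X) = ?S"
    using sa by (simp add: pfm_def sigma_algebra.sets_measure_of_eq)
  assume B: "B \<in> ?S"
  let ?f = "\<lambda>B. \<Sum>G\<in>{G. is_grouping N (labels N X) G}.
    ennreal (prob_grouping N \<alpha> X G) * indicator B (mean_diagram N loc G)"
  have "countably_additive ?S ?f"
    by (rule countably_additiveI) (simp add: suminf_sum suminf_indicator)
  moreover have "positive ?S ?f"
    by (simp add: positive_def)
  ultimately show "emeasure (pfm N K M \<alpha> X) B = ?f B"
    using emeasure_measure_of_sigma[OF sa, of ?f B] B by (simp add: pfm_def)
qed

end

theory Submission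
  imports Defs
begin

text \<open>Match the off-diagonal points of \<open>X\<close> and \<open>Y\<close> optimally, with total cost \<open>\<delta>\<^sup>2\<close>.  The laws of the
  perturbations of two matched points at distance \<open>t\<close> differ by at most \<open>4 t / \<alpha>\<close> in total
  variation, and a point at distance \<open>d\<close> from the diagonal survives its perturbation with
  probability at most \<open>d\<^sup>2 / \<alpha>\<^sup>2\<close>.  Hence, up to an event of probability \<open>O(\<delta>)\<close>, the random groupings of
  \<open>X\<close> and \<open>Y\<close> can be coupled so that they correspond under the matching and consist of trivial
  selections elsewhere; then their means are at distance at most \<open>\<delta>\<close>.  On the exceptional event the
  distance is bounded by the diameter, and for \<open>\<delta> > 1\<close> the diameter bound alone suffices.

  That the random grouping is almost surely defined rests on the minimum of the Frechet function
  being the least cost of a grouping: these costs are distinct for distinct groupings outside a null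
  set, since moving a single point across the diagonal changes their differences.\<close>

subsection \<open>Optimal matchings of finite diagrams\<close>


text \<open>Optimality of a grouping is a minimum over all diagrams, finite or not, and over
  bijections of uncountable sets. Both are reduced to finite combinatorics: between finite diagrams
  \<open>W2\<close> is a minimum over partial matchings in which unmatched points pay their squared
  distance to the diagonal, and any competitor, matched to the data, breaks up into selections. The
  obstacle is that a mean diagram may be matched to the data more cheaply than its grouping
  suggests, so that its Frechet value is only bounded by the grouping cost. Genericity therefore
  also asks for distinct persistence sums, so that a mean determines its selection.

  As to the constants, two balls of the kind considered differ by an area of at most 4 pi \<alpha>
  t, and the density 1 / (pi \<alpha>^2) turns this into the total variation bound. Cauchy-Schwarz
  and sqrt n \<le> (n + 1) / 2 with n = N K add these bounds up to 2 (N K + 1) \<delta> / \<alpha>.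
  The squared distance of the measures is thus of order \<delta> and not \<delta>^2, whence the
  exponent 1/2.\<close>

lemma ennsqrt_power2 [simp]: "(ennsqrt a)\<^sup>2 = a"
  by (cases a) (auto simp: ennsqrt_def ennreal_power)

lemma ennsqrt_ennreal: "0 \<le> x \<Longrightarrow> ennsqrt (ennreal x) = ennreal (sqrt x)"
  by (simp add: ennsqrt_def)

lemma ennreal_le_power2_iff: "a \<le> b \<longleftrightarrow> a\<^sup>2 \<le> (b :: ennreal)\<^sup>2"
proof
  show "a\<^sup>2 \<le> b\<^sup>2" if "a \<le> b" using that by (rule power_mono) simp
  show "a \<le> b" if "a\<^sup>2 \<le> b\<^sup>2"
    using that
    by (cases a; cases b) (auto simp: ennreal_power top_power_ennreal top_unique dest: power2_le_imp_le)
qed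

lemma ennsqrt_of_power2 [simp]: "ennsqrt (a\<^sup>2) = a"
  by (metis ennreal_le_power2_iff ennsqrt_power2 order_antisym order_refl)

lemma ennsqrt_le_iff [simp]: "ennsqrt a \<le> ennsqrt b \<longleftrightarrow> a \<le> b"
  by (simp add: ennreal_le_power2_iff[of "ennsqrt a"])

lemma ennsqrt_less_iff [simp]: "ennsqrt a < ennsqrt b \<longleftrightarrow> a < b"
  by (simp add: less_le_not_le)

text \<open>The squared cost: \<open>W2\<close> is always used through its square, so that the root
  leaves the estimates and the costs of several diagrams add.\<close>

definition matching_cost :: "diagram \<Rightarrow> (point \<times> nat \<Rightarrow> point \<times> nat) \<Rightarrow> ennreal" where
  "matching_cost X \<phi> = (\<Sum>\<^sub>\<infinity>z\<in>elems X. ennreal ((norm (fst z - fst (\<phi> z)))\<^sup>2))"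

lemma W2_power2_le: "\<phi> \<in> matchings X Y \<Longrightarrow> (W2 X Y)\<^sup>2 \<le> matching_cost X \<phi>"
  using INF_lower[of \<phi> "matchings X Y" "\<lambda>\<phi>. ennsqrt (matching_cost X \<phi>)"]
  by (simp add: W2_def matching_cost_def ennreal_le_power2_iff[of _ "ennsqrt _"])

text \<open>Attainment of the infimum is shown below between finite diagrams; in general a nearly
  optimal matching has to do.\<close>

lemma W2_power2_less_obtains:
  assumes "(W2 X Y)\<^sup>2 < c"
  obtains \<phi> where "\<phi> \<in> matchings X Y" "matching_cost X \<phi> < c"
proof -
  have "W2 X Y < ennsqrt c"
    using assms ennsqrt_less_iff[of "(W2 X Y)\<^sup>2" c] by simp
  then obtain \<phi> where "\<phi> \<in> matchings X Y" "ennsqrt (matching_cost X \<phi>) < ennsqrt c"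
    by (auto simp: W2_def matching_cost_def INF_less_iff)
  then show ?thesis using that by simp
qed

text \<open>The coordinates along and across the diagonal, scaled by sqrt 2. The squared norm is
  half the sum of their squares and the distance to the diagonal depends on \<open>pers\<close>
  alone, so that all later minimizations decouple.\<close>

definition csum :: "point \<Rightarrow> real" where "csum p = fst p + snd p"
definition pers :: "point \<Rightarrow> real" where "pers p = snd p - fst p"

lemma point_eq_iff: "p = q \<longleftrightarrow> csum p = csum q \<and> pers p = pers q"
  by (auto simp: csum_def pers_def prod_eq_iff)

lemma norm_diff_power2:
  "(norm (p - q))\<^sup>2 = ((csum p - csum q)\<^sup>2 + (pers p - pers q)\<^sup>2) / 2" for p q :: point
  proof -
  have "(norm (p - q))\<^sup>2 = (fst p - fst q)\<^sup>2 + (snd p - snd q)\<^sup>2"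
    by (simp add: norm_prod_def real_sqrt_pow2)
  then show ?thesis
    by (simp add: csum_def pers_def power2_eq_square field_simps)
qed

definition diag_proj :: "point \<Rightarrow> point" where "diag_proj p = (csum p / 2, csum p / 2)"

lemma diag_proj_mem [simp]: "diag_proj p \<in> diagonal"
  by (auto simp: diag_proj_def diagonal_def intro: exI[of _ "csum p / 2"])

lemma diagonal_nonempty: "diagonal \<noteq> {}"
  using diag_proj_mem by blast

lemma mem_diagonal_iff: "p \<in> diagonal \<longleftrightarrow> pers p = 0"
  by (cases p) (auto simp: diagonal_def pers_def)

lemma norm_diag_proj: "(norm (p - diag_proj p))\<^sup>2 = (pers p)\<^sup>2 / 2"
  by (simp add: norm_diff_power2 diag_proj_def csum_def pers_def)

lemma norm_diagonal_ge: "z \<in> diagonal \<Longrightarrow> (pers p)\<^sup>2 / 2 \<le> (norm (p - z))\<^sup>2"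
  by (simp add: norm_diff_power2 mem_diagonal_iff)

lemma infdist_diagonal_power2: "(infdist p diagonal)\<^sup>2 = (pers p)\<^sup>2 / 2"
proof (rule antisym)
  have "infdist p diagonal \<le> norm (p - diag_proj p)"
    by (metis diag_proj_mem dist_norm infdist_le)
  then show "(infdist p diagonal)\<^sup>2 \<le> (pers p)\<^sup>2 / 2"
    by (metis norm_diag_proj infdist_nonneg power_mono)
  have "sqrt ((pers p)\<^sup>2 / 2) \<le> infdist p diagonal"
    unfolding infdist_notempty[OF diagonal_nonempty]
    by (intro cINF_greatest diagonal_nonempty)
      (metis dist_norm norm_diagonal_ge norm_ge_zero real_le_lsqrt)
  then show "(pers p)\<^sup>2 / 2 \<le> (infdist p diagonal)\<^sup>2"
    by (rule sqrt_le_D)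
qed

lemma mult_below_diagonal: "pers p < 0 \<Longrightarrow> mult X p = 0"
  and mult_diagonal: "pers p = 0 \<Longrightarrow> mult X p = \<infinity>"
  using mult[of X] by (cases p; force simp: pers_def)+

lemma mem_elems_iff: "z \<in> elems X \<longleftrightarrow> enat (snd z) < mult X (fst z)"
  by (cases z) (simp add: elems_def)

lemma mem_offdiag_iff: "z \<in> offdiag X \<longleftrightarrow> z \<in> elems X \<and> 0 < pers (fst z)"
  using mult_below_diagonal[of "fst z" X]
  by (cases "pers (fst z)" "0::real" rule: linorder_cases)
     (auto simp: offdiag_def mem_diagonal_iff mem_elems_iff)

lemma elems_minus_offdiag: "elems X - offdiag X = {z. fst z \<in> diagonal}"
  using mult_diagonal[of _ X]
  by (auto simp: offdiag_def mem_elems_iff mem_diagonal_iff)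

lemma diagonal_mem_elems: "fst z \<in> diagonal \<Longrightarrow> z \<in> elems X"
  using elems_minus_offdiag[of X] by blast

lemma infinite_nat_bij_betw:
  assumes "infinite (A :: nat set)" "infinite (B :: nat set)"
  shows "\<exists>f. bij_betw f A B"
  using bij_betw_trans[OF bij_betw_inv_into[OF bij_enumerate[OF assms(1)]] bij_enumerate[OF assms(2)]]
  by blast

text \<open>A finite partial matching covering all off-diagonal points extends to a matching at no cost,
  since only cofinitely many copies of each diagonal point remain.\<close>

lemma matching_extend:
  assumes \<rho>: "bij_betw \<rho> S T" and fin: "finite S"
    and S: "offdiag X \<subseteq> S" "S \<subseteq> elems X" and T: "offdiag Y \<subseteq> T" "T \<subseteq> elems Y"
  shows "\<exists>\<phi>\<in>matchings X Y. matching_cost X \<phi> = ennreal (\<Sum>z\<in>S. (norm (fst z - fst (\<rho> z)))\<^sup>2)"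
proof -
  have finT: "finite T" using \<rho> fin bij_betw_finite by blast
  have fib: "infinite {k. (p, k) \<in> elems Z - F}" if "p \<in> diagonal" "finite F" for p Z and F :: "(point \<times> nat) set"
  proof -
    have "{k. (p, k) \<in> elems Z - F} = UNIV - {k. (p, k) \<in> F}"
      using diagonal_mem_elems[of "(p, _)"] that by auto
    moreover have "finite {k. (p, k) \<in> F}"
      using finite_vimageI[OF that(2), of "Pair p"] by (simp add: vimage_def inj_on_def)
    ultimately show ?thesis by (simp add: Diff_infinite_finite)
  qed
  have "\<exists>b. bij_betw b {k. (p, k) \<in> elems X - S} {k. (p, k) \<in> elems Y - T}" for p
  proof (cases "p \<in> diagonal")
    case True
    then show ?thesis using fib fin finT by (intro infinite_nat_bij_betw) auto
  next
    case False
    \<comment> \<open>Off the diagonal nothing remains, since \<open>S\<close> and \<open>T\<close>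
      contain all off-diagonal points.\<close>
    then have *: "{k. (p, k) \<in> elems X - S} = {}" "{k. (p, k) \<in> elems Y - T} = {}"
      using S T by (auto simp: offdiag_def)
    show ?thesis unfolding * by (simp add: bij_betw_def)
  qed
  then obtain b where b: "\<And>p. bij_betw (b p) {k. (p, k) \<in> elems X - S} {k. (p, k) \<in> elems Y - T}"
    by metis
  \<comment> \<open>The remaining elements keep their location and change only their copy number,
    hence cost nothing.\<close>
  define \<psi> where "\<psi> z = (fst z, b (fst z) (snd z))" for z :: "point \<times> nat"
  have \<psi>: "bij_betw \<psi> (elems X - S) (elems Y - T)"
    unfolding bij_betw_def
  proof
    show "inj_on \<psi> (elems X - S)"
    proof (rule inj_onI)
      fix z w assume "z \<in> elems X - S" "w \<in> elems X - S" "\<psi> z = \<psi> w"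
      then show "z = w"
        using bij_betw_imp_inj_on[OF b[of "fst z"]]
        by (cases z; cases w) (auto simp: \<psi>_def inj_on_def)
    qed
    show "\<psi> ` (elems X - S) = elems Y - T"
    proof (intro set_eqI iffI)
      fix w assume "w \<in> \<psi> ` (elems X - S)"
      then obtain z where "z \<in> elems X - S" "w = \<psi> z" by auto
      then show "w \<in> elems Y - T"
        using bij_betw_apply[OF b[of "fst z"], of "snd z"] by (auto simp: \<psi>_def)
    next
      fix w assume "w \<in> elems Y - T"
      then have "snd w \<in> b (fst w) ` {k. (fst w, k) \<in> elems X - S}"
        using bij_betw_imp_surj_on[OF b[of "fst w"]] by simp
      then obtain k where "(fst w, k) \<in> elems X - S" "snd w = b (fst w) k" by auto
      then show "w \<in> \<psi> ` (elems X - S)"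
        by (intro image_eqI[of _ _ "(fst w, k)"]) (auto simp: \<psi>_def prod_eq_iff)
    qed
  qed
  define \<phi> where "\<phi> z = (if z \<in> S then \<rho> z else \<psi> z)" for z
  have "bij_betw \<phi> S T" using \<rho> by (rule bij_betw_cong[THEN iffD1, rotated]) (simp add: \<phi>_def)
  moreover have "bij_betw \<phi> (elems X - S) (elems Y - T)"
    using \<psi> by (rule bij_betw_cong[THEN iffD1, rotated]) (simp add: \<phi>_def)
  ultimately have "bij_betw \<phi> (S \<union> (elems X - S)) (T \<union> (elems Y - T))"
    by (rule bij_betw_combine) auto
  then have "\<phi> \<in> matchings X Y"
    using S T by (simp add: matchings_def Un_absorb1)
  moreover have "matching_cost X \<phi> = (\<Sum>\<^sub>\<infinity>z\<in>S. ennreal ((norm (fst z - fst (\<rho> z)))\<^sup>2))"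
    unfolding matching_cost_def using S(2)
    by (intro infsum_cong_neutral) (auto simp: \<phi>_def \<psi>_def)
  ultimately show ?thesis
    using fin by (auto simp: sum_ennreal)
qed

section \<open>Partial matchings of off-diagonal points and their cost\<close>

definition partial_matchings :: "'a set \<Rightarrow> 'b set \<Rightarrow> ('a \<times> 'b) set set" where
  "partial_matchings A B = {R. R \<subseteq> A \<times> B \<and> inj_on fst R \<and> inj_on snd R}"

text \<open>Unmatched points of either side pay their squared distance to the diagonal. The index
  types are left free: the points are numbered copies here, labels and selections later.\<close>

definition partial_cost ::
    "('a \<Rightarrow> point) \<Rightarrow> 'a set \<Rightarrow> ('b \<Rightarrow> point) \<Rightarrow> 'b set \<Rightarrow> ('a \<times> 'b) set \<Rightarrow> real" where
  "partial_cost f A g B R = (\<Sum>(a, b)\<in>R. (norm (f a - g b))\<^sup>2)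
     + (\<Sum>a\<in>A - fst ` R. (pers (f a))\<^sup>2 / 2) + (\<Sum>b\<in>B - snd ` R. (pers (g b))\<^sup>2 / 2)"

lemma partial_cost_nonneg: "0 \<le> partial_cost f A g B R"
  unfolding partial_cost_def by (intro add_nonneg_nonneg sum_nonneg) auto

lemma finite_partial_matchings: "finite A \<Longrightarrow> finite B \<Longrightarrow> finite (partial_matchings A B)"
  by (rule finite_subset[of _ "Pow (A \<times> B)"]) (auto simp: partial_matchings_def)

lemma empty_partial_matching: "{} \<in> partial_matchings A B"
  by (simp add: partial_matchings_def)

text \<open>Pairing the unmatched points with their projections to the diagonal gives a matching
  that covers all off-diagonal points; \<open>matching_extend\<close> does the rest.\<close>

lemma matching_of_partial:
  assumes fin: "finite (offdiag X)" "finite (offdiag Y)"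
    and R: "R \<in> partial_matchings (offdiag X) (offdiag Y)"
  shows "\<exists>\<phi>\<in>matchings X Y. matching_cost X \<phi>
    = ennreal (partial_cost fst (offdiag X) fst (offdiag Y) R)"
proof -
  let ?U = "offdiag X" and ?V = "offdiag Y"
  define U0 where "U0 = ?U - fst ` R"
  define V0 where "V0 = ?V - snd ` R"
  have R1: "R \<subseteq> ?U \<times> ?V" and i1: "inj_on fst R" and i2: "inj_on snd R"
    using R by (auto simp: partial_matchings_def)
  have finR: "finite R" using finite_subset[OF R1] fin by simp
  have fin0: "finite U0" "finite V0" using fin by (auto simp: U0_def V0_def)
  \<comment> \<open>Different points may project to the same diagonal point; the injection
    \<open>e\<close> sends them to different copies of it.\<close>
  obtain e :: "(point \<times> nat) \<Rightarrow> nat" where e: "inj_on e (?U \<union> ?V)"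
    using finite_imp_inj_to_nat_seg[of "?U \<union> ?V"] fin by auto
  define i where "i z = (diag_proj (fst z), e z)" for z
  have inj: "inj_on i U0" "inj_on i V0"
    using e by (auto simp: inj_on_def i_def U0_def V0_def)
  \<comment> \<open>The pairs of \<open>R\<close> on matched points, the projection on unmatched
    points of \<open>X\<close>, and the inverse projection on the copies reserved for the unmatched
    points of \<open>Y\<close>.\<close>
  define \<rho> where "\<rho> z = (if z \<in> fst ` R then snd (the_inv_into R fst z)
     else if z \<in> U0 then i z else the_inv_into V0 i z)" for z
  have i_diag: "fst (i z) \<in> diagonal" for z by (simp add: i_def)
  have disj: "i ` B \<inter> offdiag Z = {}" for B Z
    by (auto simp: offdiag_def i_def)
  have b1: "bij_betw \<rho> (fst ` R) (snd ` R)"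
  proof -
    have "bij_betw (snd \<circ> the_inv_into R fst) (fst ` R) (snd ` R)"
      using i1 i2 by (intro bij_betw_trans[of _ _ R]) (auto simp: bij_betw_the_inv_into bij_betw_def inj_on_the_inv_into)
    then show ?thesis by (rule bij_betw_cong[THEN iffD1, rotated]) (simp add: \<rho>_def)
  qed
  have b2: "bij_betw \<rho> U0 (i ` U0)"
    using inj_on_imp_bij_betw[OF inj(1)]
    by (rule bij_betw_cong[THEN iffD1, rotated]) (auto simp: \<rho>_def U0_def)
  have b3: "bij_betw \<rho> (i ` V0) V0"
    using bij_betw_the_inv_into[OF inj_on_imp_bij_betw[OF inj(2)]]
  proof (rule bij_betw_cong[THEN iffD1, rotated])
    fix z assume "z \<in> i ` V0"
    then have "z \<notin> ?U" using disj by blast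
    then show "the_inv_into V0 i z = \<rho> z"
      using R1 by (auto simp: \<rho>_def U0_def)
  qed
  have b12: "bij_betw \<rho> (fst ` R \<union> U0) (snd ` R \<union> i ` U0)"
    by (rule bij_betw_combine[OF b1 b2]) (use R1 disj[of U0 Y] in force)
  have b: "bij_betw \<rho> ((fst ` R \<union> U0) \<union> i ` V0) ((snd ` R \<union> i ` U0) \<union> V0)"
    by (rule bij_betw_combine[OF b12 b3]) (use disj[of U0 Y] in \<open>auto simp: V0_def\<close>)
  have U: "fst ` R \<union> U0 = ?U" and V: "snd ` R \<union> V0 = ?V" using R1 by (auto simp: U0_def V0_def)
  have fU: "finite (?U \<union> i ` V0)" using fin fin0 by simp
  have "\<exists>\<phi>\<in>matchings X Y. matching_cost X \<phi>
      = ennreal (\<Sum>z\<in>?U \<union> i ` V0. (norm (fst z - fst (\<rho> z)))\<^sup>2)"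
  proof (rule matching_extend[OF _ fU])
    have "snd ` R \<union> i ` U0 \<union> V0 = ?V \<union> i ` U0" using V by blast
    then show "bij_betw \<rho> (?U \<union> i ` V0) (?V \<union> i ` U0)"
      using b by (simp only: U)
    have "i ` B \<subseteq> elems Z" for B Z
      using i_diag by (auto intro!: diagonal_mem_elems simp del: fst_conv)
    then show "?U \<union> i ` V0 \<subseteq> elems X" "?V \<union> i ` U0 \<subseteq> elems Y"
      by (simp_all add: offdiag_def)
  qed simp_all
  moreover have "(\<Sum>z\<in>?U \<union> i ` V0. (norm (fst z - fst (\<rho> z)))\<^sup>2)
      = partial_cost fst ?U fst ?V R"
  proof -
    have "(\<Sum>z\<in>?U \<union> i ` V0. (norm (fst z - fst (\<rho> z)))\<^sup>2)
      = (\<Sum>z\<in>?U. (norm (fst z - fst (\<rho> z)))\<^sup>2) + (\<Sum>z\<in>i ` V0. (norm (fst z - fst (\<rho> z)))\<^sup>2)"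
      using disj[of V0 X] fin fin0 by (intro sum.union_disjoint) auto
    also have "(\<Sum>z\<in>?U. (norm (fst z - fst (\<rho> z)))\<^sup>2)
       = (\<Sum>z\<in>fst ` R. (norm (fst z - fst (\<rho> z)))\<^sup>2) + (\<Sum>z\<in>U0. (norm (fst z - fst (\<rho> z)))\<^sup>2)"
      unfolding U[symmetric] using finR fin0 by (intro sum.union_disjoint) (auto simp: U0_def)
    also have "(\<Sum>z\<in>fst ` R. (norm (fst z - fst (\<rho> z)))\<^sup>2) = (\<Sum>(z,w)\<in>R. (norm (fst z - fst w))\<^sup>2)"
    proof -
      have "\<rho> (fst r) = snd r" if "r \<in> R" for r
        using that by (simp add: \<rho>_def the_inv_into_f_f[OF i1 that])
      then show ?thesis
        by (simp add: sum.reindex[OF i1] case_prod_beta)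
    qed
    also have "(\<Sum>z\<in>U0. (norm (fst z - fst (\<rho> z)))\<^sup>2) = (\<Sum>z\<in>U0. (pers (fst z))\<^sup>2 / 2)"
      by (intro sum.cong) (auto simp: \<rho>_def U0_def i_def norm_diag_proj)
    also have "(\<Sum>z\<in>i ` V0. (norm (fst z - fst (\<rho> z)))\<^sup>2) = (\<Sum>w\<in>V0. (pers (fst w))\<^sup>2 / 2)"
    proof -
      have "\<rho> (i w) = w" if "w \<in> V0" for w
        using disj[of V0 X] that R1 the_inv_into_f_f[OF inj(2) that] by (auto simp: \<rho>_def U0_def)
      then show ?thesis
        using inj by (subst sum.reindex)
          (auto intro!: sum.cong simp: i_def norm_minus_commute[of "diag_proj _"] norm_diag_proj)
    qed
    finally show ?thesis by (simp add: partial_cost_def U0_def V0_def)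
  qed
  ultimately show ?thesis by simp
qed

lemma sum_le_matching_cost:
  assumes "finite T" "T \<subseteq> elems X"
  shows "(\<Sum>z\<in>T. ennreal ((norm (fst z - fst (\<phi> z)))\<^sup>2)) \<le> matching_cost X \<phi>"
proof -
  have "infsum (\<lambda>z. ennreal ((norm (fst z - fst (\<phi> z)))\<^sup>2)) T \<le> matching_cost X \<phi>"
    unfolding matching_cost_def
    by (rule infsum_mono_neutral) (use assms in \<open>auto intro: nonneg_summable_on_complete\<close>)
  then show ?thesis using assms by simp
qed

text \<open>Only the pairs with both ends off the diagonal are kept. Every other off-diagonal point
  was matched to some diagonal point, which is at least as far away as the diagonal itself.\<close>

lemma partial_of_matching:
  assumes fin: "finite (offdiag X)" "finite (offdiag Y)" and \<phi>: "\<phi> \<in> matchings X Y"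
  shows "\<exists>R\<in>partial_matchings (offdiag X) (offdiag Y).
    ennreal (partial_cost fst (offdiag X) fst (offdiag Y) R) \<le> matching_cost X \<phi>"
proof -
  let ?U = "offdiag X" and ?V = "offdiag Y"
  have b: "bij_betw \<phi> (elems X) (elems Y)" using \<phi> by (simp add: matchings_def)
  have Ue: "?U \<subseteq> elems X" and Ve: "?V \<subseteq> elems Y" by (auto simp: offdiag_def)
  define \<psi> where "\<psi> = inv_into (elems X) \<phi>"
  have \<psi>: "\<psi> w \<in> elems X" "\<phi> (\<psi> w) = w" if "w \<in> ?V" for w
    using that Ve b unfolding \<psi>_def
    by (auto simp: bij_betw_def inv_into_into f_inv_into_f)
  have inj: "inj_on \<phi> (elems X)" using b by (simp add: bij_betw_def)
  have \<psi>\<phi>: "\<psi> (\<phi> z) = z" if "z \<in> elems X" for z using inj that by (simp add: \<psi>_def)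
  define U1 where "U1 = {z \<in> ?U. \<phi> z \<in> ?V}"
  define R where "R = (\<lambda>z. (z, \<phi> z)) ` U1"
  have R: "R \<in> partial_matchings ?U ?V"
    using inj_on_subset[OF inj Ue] by (auto simp: partial_matchings_def R_def U1_def inj_on_def)
  have fstR: "fst ` R = U1" and sndR: "snd ` R = \<phi> ` U1" by (force simp: R_def)+
  define V0 where "V0 = ?V - \<phi> ` U1"
  have V0: "\<psi> w \<in> elems X - ?U" if "w \<in> V0" for w
    using that \<psi>[of w] by (force simp: V0_def U1_def)
  have \<phi>e: "\<phi> z \<in> elems Y" if "z \<in> elems X" for z using b that by (auto simp: bij_betw_def)
  let ?c = "\<lambda>z. (norm (fst z - fst (\<phi> z)))\<^sup>2"
  have finU1: "finite U1" using fin by (simp add: U1_def)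
  have "partial_cost fst ?U fst ?V R \<le> (\<Sum>z\<in>U1. ?c z) + (\<Sum>z\<in>?U - U1. ?c z) + (\<Sum>w\<in>V0. ?c (\<psi> w))"
    unfolding partial_cost_def fstR sndR V0_def[symmetric]
  proof (intro add_mono sum_mono)
    show "(\<Sum>(a, b)\<in>R. (norm (fst a - fst b))\<^sup>2) \<le> (\<Sum>z\<in>U1. ?c z)"
      unfolding R_def by (subst sum.reindex) (auto simp: inj_on_def)
  next
    fix z assume "z \<in> ?U - U1"
    then have "fst (\<phi> z) \<in> diagonal"
      using elems_minus_offdiag[of Y] \<phi>e[of z] Ue by (auto simp: U1_def)
    then show "(pers (fst z))\<^sup>2 / 2 \<le> ?c z" by (rule norm_diagonal_ge)
  next
    fix w assume w: "w \<in> V0"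
    then have "fst (\<psi> w) \<in> diagonal"
      using elems_minus_offdiag[of X] V0[OF w] by auto
    then show "(pers (fst w))\<^sup>2 / 2 \<le> ?c (\<psi> w)"
      using norm_diagonal_ge[of "fst (\<psi> w)" "fst w"] \<psi>(2)[of w] w
      by (simp add: norm_minus_commute V0_def)
  qed
  also have "\<dots> = (\<Sum>z\<in>?U. ?c z) + (\<Sum>z\<in>\<psi> ` V0. ?c z)"
  proof -
    have "inj_on \<psi> V0" by (metis \<psi>(2) DiffD1 V0_def inj_onI)
    then have "(\<Sum>z\<in>\<psi> ` V0. ?c z) = (\<Sum>w\<in>V0. ?c (\<psi> w))" by (simp add: sum.reindex)
    moreover have "(\<Sum>z\<in>U1. ?c z) + (\<Sum>z\<in>?U - U1. ?c z) = (\<Sum>z\<in>?U. ?c z)"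
      using sum.subset_diff[of U1 ?U ?c] fin by (simp add: U1_def add.commute)
    ultimately show ?thesis by simp
  qed
  \<comment> \<open>Unmatched points of \<open>Y\<close> are charged to their preimages, which lie
    on the diagonal and so outside \<open>offdiag X\<close>: no term is used twice.\<close>
  also have "\<dots> = (\<Sum>z\<in>?U \<union> \<psi> ` V0. ?c z)"
    using V0 fin by (intro sum.union_disjoint[symmetric]) (auto simp: V0_def)
  finally have "ennreal (partial_cost fst ?U fst ?V R) \<le> ennreal (\<Sum>z\<in>?U \<union> \<psi> ` V0. ?c z)"
    by (simp add: ennreal_leI)
  also have "\<dots> = (\<Sum>z\<in>?U \<union> \<psi> ` V0. ennreal (?c z))" by (simp add: sum_ennreal)
  also have "\<dots> \<le> matching_cost X \<phi>"
    using V0 fin Ue by (intro sum_le_matching_cost) (auto simp: V0_def)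
  finally show ?thesis using R by blast
qed

text \<open>From bijections between uncountable sets to a minimum over a finite set; this makes the
  distance attained and, later, measurable in the locations.\<close>

lemma W2_partial:
  assumes "finite (offdiag X)" "finite (offdiag Y)"
  shows "(W2 X Y)\<^sup>2 = (INF R\<in>partial_matchings (offdiag X) (offdiag Y).
    ennreal (partial_cost fst (offdiag X) fst (offdiag Y) R))"
proof (rule antisym)
  show "(W2 X Y)\<^sup>2 \<le> (INF R\<in>partial_matchings (offdiag X) (offdiag Y).
    ennreal (partial_cost fst (offdiag X) fst (offdiag Y) R))"
    using matching_of_partial[OF assms] W2_power2_le
    by (intro INF_greatest) fastforce
  show "(INF R\<in>partial_matchings (offdiag X) (offdiag Y).
    ennreal (partial_cost fst (offdiag X) fst (offdiag Y) R)) \<le> (W2 X Y)\<^sup>2" (is "?L \<le> _")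
  proof (rule ccontr)
    assume "\<not> ?thesis"
    then have "(W2 X Y)\<^sup>2 < ?L" by simp
    then obtain \<phi> where \<phi>: "\<phi> \<in> matchings X Y" "matching_cost X \<phi> < ?L"
      by (rule W2_power2_less_obtains)
    then obtain R where "R \<in> partial_matchings (offdiag X) (offdiag Y)"
      "ennreal (partial_cost fst (offdiag X) fst (offdiag Y) R) \<le> matching_cost X \<phi>"
      using partial_of_matching[OF assms] by blast
    then have "?L \<le> matching_cost X \<phi>"
      by (meson INF_lower2)
    then show False using \<phi>(2) by simp
  qed
qed

lemma W2_partial_attained:
  assumes "finite (offdiag X)" "finite (offdiag Y)"
  obtains R where "R \<in> partial_matchings (offdiag X) (offdiag Y)"
    "(W2 X Y)\<^sup>2 = ennreal (partial_cost fst (offdiag X) fst (offdiag Y) R)"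
proof -
  let ?P = "partial_matchings (offdiag X) (offdiag Y)"
  let ?I = "(\<lambda>R. ennreal (partial_cost fst (offdiag X) fst (offdiag Y) R)) ` ?P"
  have "finite ?I" "?I \<noteq> {}"
    using finite_partial_matchings[OF assms] empty_partial_matching by blast+
  then have "Inf ?I \<in> ?I" by (metis Min_Inf Min_in)
  then show ?thesis using that W2_partial[OF assms] by auto
qed

lemma matching_attained:
  assumes "finite (offdiag X)" "finite (offdiag Y)"
  obtains \<phi> where "\<phi> \<in> matchings X Y" "matching_cost X \<phi> = (W2 X Y)\<^sup>2"
  using W2_partial_attained[OF assms] matching_of_partial[OF assms] by metis

subsection \<open>Labelled diagrams and means of selections\<close>


lemma diagram_of_reindex:
  assumes "bij_betw h A B" "\<And>a. a \<in> A \<Longrightarrow> g (h a) = f a"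
  shows "diagram_of f A = diagram_of g B"
proof -
  have *: "card {a \<in> A. f a = p} = card {b \<in> B. g b = p}" for p
  proof (rule bij_betw_same_card)
    show "bij_betw h {a \<in> A. f a = p} {b \<in> B. g b = p}"
      using assms by (auto simp: bij_betw_def inj_on_def)
  qed
  show ?thesis by (simp only: diagram_of_def *)
qed

lemma mult_diagram_of_pos:
  "finite A \<Longrightarrow> 0 < pers p \<Longrightarrow> mult (diagram_of f A) p = enat (card {a \<in> A. f a = p})"
  by (auto simp: mult_diagram_of pers_def)

text \<open>Numbering each fibre of \<open>f\<close> from 0 identifies the index set with the
  numbered copies that make up \<open>offdiag\<close>.\<close>

lemma labelled_offdiag:
  assumes fin: "finite A" and above: "\<And>a. a \<in> A \<Longrightarrow> 0 < pers (f a)"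
  shows "\<exists>e. bij_betw e A (offdiag (diagram_of f A)) \<and> (\<forall>a. fst (e a) = f a)"
proof -
  have "\<forall>p. \<exists>h. bij_betw h {a \<in> A. f a = p} {0..<card {a \<in> A. f a = p}}"
    using fin by (intro allI ex_bij_betw_finite_nat) simp
  from choice[OF this]
  obtain h where h: "\<And>p. bij_betw (h p) {a \<in> A. f a = p} {0..<card {a \<in> A. f a = p}}"
    by blast
  define e where "e a = (f a, h (f a) a)" for a
  have off: "z \<in> offdiag (diagram_of f A) \<longleftrightarrow>
      0 < pers (fst z) \<and> snd z < card {a \<in> A. f a = fst z}" for z
    using fin by (auto simp: mem_offdiag_iff mem_elems_iff mult_diagram_of_pos)
  have "bij_betw e A (offdiag (diagram_of f A))"
    unfolding bij_betw_def
  proof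
    show "inj_on e A"
    proof (rule inj_onI)
      fix a b assume "a \<in> A" "b \<in> A" "e a = e b"
      then have "f a = f b" "h (f b) a = h (f b) b" by (auto simp: e_def)
      then show "a = b"
        using inj_onD[OF bij_betw_imp_inj_on[OF h[of "f b"]], of a b] \<open>a \<in> A\<close> \<open>b \<in> A\<close> by simp
    qed
    show "e ` A = offdiag (diagram_of f A)"
    proof (intro set_eqI iffI)
      fix z assume "z \<in> e ` A"
      then show "z \<in> offdiag (diagram_of f A)"
        using above bij_betwE[OF h[of "fst z"]] by (auto simp: off e_def)
    next
      fix z assume z: "z \<in> offdiag (diagram_of f A)"
      then have "snd z \<in> h (fst z) ` {a \<in> A. f a = fst z}"
        using bij_betw_imp_surj_on[OF h[of "fst z"]] by (simp add: off)
      then obtain a where "a \<in> A" "f a = fst z" "snd z = h (fst z) a" by blast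
      then have "a \<in> A" "z = e a" by (simp_all add: e_def prod_eq_iff[of z])
      then show "z \<in> e ` A" by blast
    qed
  qed
  then show ?thesis by (intro exI[of _ e]) (simp add: e_def)
qed

lemma finite_offdiag_diagram_of:
  assumes "finite A" shows "finite (offdiag (diagram_of f A))"
proof (rule finite_subset)
  show "offdiag (diagram_of f A) \<subseteq> f ` A \<times> {..<card A}"
  proof
    fix z assume "z \<in> offdiag (diagram_of f A)"
    then have *: "snd z < card {a \<in> A. f a = fst z}"
      using assms by (auto simp: mem_offdiag_iff mem_elems_iff mult_diagram_of_pos)
    then have "{a \<in> A. f a = fst z} \<noteq> {}" by (metis card.empty less_nat_zero_code)
    moreover have "card {a \<in> A. f a = fst z} \<le> card A"
      using assms by (intro card_mono) auto
    ultimately show "z \<in> f ` A \<times> {..<card A}"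
      using * by (cases z) force
  qed
qed (use assms in simp)

lemma partial_matching_reindex:
  assumes e: "bij_betw e A U" "bij_betw e' B V"
    and f: "\<And>a. a \<in> A \<Longrightarrow> f' (e a) = f a" "\<And>b. b \<in> B \<Longrightarrow> g' (e' b) = g b"
    and R: "R \<in> partial_matchings A B"
  shows "map_prod e e' ` R \<in> partial_matchings U V"
    and "partial_cost f' U g' V (map_prod e e' ` R) = partial_cost f A g B R"
proof -
  have RAB: "R \<subseteq> A \<times> B" and i: "inj_on fst R" "inj_on snd R"
    using R by (auto simp: partial_matchings_def)
  have ie: "inj_on e A" "inj_on e' B" and im: "e ` A = U" "e' ` B = V"
    using e by (auto simp: bij_betw_def)
  have fR: "fst ` map_prod e e' ` R = e ` fst ` R" "snd ` map_prod e e' ` R = e' ` snd ` R"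
    by (auto simp: image_image)
  have inj: "inj_on (map_prod e e') R"
    using inj_on_subset[OF map_prod_inj_on[OF ie] RAB] .
  have "inj_on (fst \<circ> map_prod e e') R"
    unfolding fst_comp_map_prod using RAB by (intro comp_inj_on i inj_on_subset[OF ie(1)]) auto
  moreover have "inj_on (snd \<circ> map_prod e e') R"
    unfolding snd_comp_map_prod using RAB by (intro comp_inj_on i inj_on_subset[OF ie(2)]) auto
  moreover have "map_prod e e' ` R \<subseteq> U \<times> V" using RAB im by auto
  ultimately show "map_prod e e' ` R \<in> partial_matchings U V"
    by (simp add: partial_matchings_def inj_on_imageI)
  have sub: "fst ` R \<subseteq> A" "snd ` R \<subseteq> B" using RAB by auto
  have d: "U - e ` fst ` R = e ` (A - fst ` R)" "V - e' ` snd ` R = e' ` (B - snd ` R)"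
    using inj_on_image_set_diff[OF ie(1) _ sub(1), of A] inj_on_image_set_diff[OF ie(2) _ sub(2), of B]
    by (simp_all add: im)
  have "(\<Sum>(a, b)\<in>map_prod e e' ` R. (norm (f' a - g' b))\<^sup>2) = (\<Sum>(a, b)\<in>R. (norm (f a - g b))\<^sup>2)"
    unfolding sum.reindex[OF inj] using RAB f by (intro sum.cong refl) auto
  moreover have "(\<Sum>a\<in>U - e ` fst ` R. (pers (f' a))\<^sup>2 / 2) = (\<Sum>a\<in>A - fst ` R. (pers (f a))\<^sup>2 / 2)"
    unfolding d sum.reindex[OF inj_on_diff[OF ie(1)]] using f by (intro sum.cong refl) auto
  moreover have "(\<Sum>b\<in>V - e' ` snd ` R. (pers (g' b))\<^sup>2 / 2) = (\<Sum>b\<in>B - snd ` R. (pers (g b))\<^sup>2 / 2)"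
    unfolding d sum.reindex[OF inj_on_diff[OF ie(2)]] using f by (intro sum.cong refl) auto
  ultimately show "partial_cost f' U g' V (map_prod e e' ` R) = partial_cost f A g B R"
    unfolding partial_cost_def fR by simp
qed

text \<open>The distance in terms of arbitrary index sets: mean diagrams are indexed by selections
  and the data by labels, and neither knows the numbering of copies.\<close>

lemma W2_labelled:
  assumes fin: "finite A" "finite B"
    and above: "\<And>a. a \<in> A \<Longrightarrow> 0 < pers (f a)" "\<And>b. b \<in> B \<Longrightarrow> 0 < pers (g b)"
  shows "(W2 (diagram_of f A) (diagram_of g B))\<^sup>2
    = (INF R\<in>partial_matchings A B. ennreal (partial_cost f A g B R))"
proof -
  let ?X = "diagram_of f A" and ?Y = "diagram_of g B"
  obtain e where e: "bij_betw e A (offdiag ?X)" "\<And>a. fst (e a) = f a"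
    using labelled_offdiag fin above by metis
  obtain e' where e': "bij_betw e' B (offdiag ?Y)" "\<And>b. fst (e' b) = g b"
    using labelled_offdiag fin above by metis
  define d where "d = inv_into A e"
  define d' where "d' = inv_into B e'"
  have d: "bij_betw d (offdiag ?X) A" "bij_betw d' (offdiag ?Y) B"
    using e e' by (simp_all add: d_def d'_def bij_betw_inv_into)
  have fd: "f (d z) = fst z" if "z \<in> offdiag ?X" for z
    using that e by (metis bij_betw_inv_into_right d_def)
  have gd: "g (d' z) = fst z" if "z \<in> offdiag ?Y" for z
    using that e' by (metis bij_betw_inv_into_right d'_def)
  have "(W2 ?X ?Y)\<^sup>2 = (INF R\<in>partial_matchings (offdiag ?X) (offdiag ?Y).
    ennreal (partial_cost fst (offdiag ?X) fst (offdiag ?Y) R))"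
    using fin by (intro W2_partial finite_offdiag_diagram_of)
  also have "\<dots> = (INF R\<in>partial_matchings A B. ennreal (partial_cost f A g B R))"
  proof (rule antisym; rule INF_mono)
    fix R assume R: "R \<in> partial_matchings A B"
    show "\<exists>R'\<in>partial_matchings (offdiag ?X) (offdiag ?Y).
      ennreal (partial_cost fst (offdiag ?X) fst (offdiag ?Y) R') \<le> ennreal (partial_cost f A g B R)"
      using partial_matching_reindex[where f=f and g=g, OF e(1) e'(1) e(2) e'(2) R] by (metis order_refl)
  next
    fix R assume R: "R \<in> partial_matchings (offdiag ?X) (offdiag ?Y)"
    show "\<exists>R'\<in>partial_matchings A B.
      ennreal (partial_cost f A g B R') \<le> ennreal (partial_cost fst (offdiag ?X) fst (offdiag ?Y) R)"
      using partial_matching_reindex[where f'=f and g'=g, OF d fd gd R] by (metis order_refl)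
  qed
  finally show ?thesis .
qed

lemma W2_labelled_le:
  assumes "finite A" "finite B"
    and "\<And>a. a \<in> A \<Longrightarrow> 0 < pers (f a)" "\<And>b. b \<in> B \<Longrightarrow> 0 < pers (g b)"
    and "R \<in> partial_matchings A B"
  shows "(W2 (diagram_of f A) (diagram_of g B))\<^sup>2 \<le> ennreal (partial_cost f A g B R)"
proof -
  have "(W2 (diagram_of f A) (diagram_of g B))\<^sup>2
      = (INF R\<in>partial_matchings A B. ennreal (partial_cost f A g B R))"
    by (rule W2_labelled) (use assms in auto)
  also have "\<dots> \<le> ennreal (partial_cost f A g B R)"
    by (rule INF_lower[OF assms(5)])
  finally show ?thesis .
qed

section \<open>Selections, their costs and their means\<close>

lemma is_selectionD:
  assumes "is_selection N A s" "s i = Some l"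
  shows "i < N" "l \<in> A" "fst l = i"
  using assms(1)[unfolded is_selection_def, rule_format, OF assms(2)] by auto

text \<open>A label records its own diagram in its first component, so a selection is determined by
  its range. Comparing selections thus becomes comparing sets of labels.\<close>

lemma selection_bij:
  assumes "is_selection N A s"
  shows "bij_betw fst (ran s) (dom s)" "l \<in> ran s \<longleftrightarrow> s (fst l) = Some l"
proof -
  have *: "fst l = i" if "s i = Some l" for i l
    using is_selectionD[OF assms that] by simp
  have ran: "s (fst l) = Some l" if l: "l \<in> ran s" for l
  proof -
    obtain i where "s i = Some l" using l unfolding ran_def by blast
    then show ?thesis using *[of i l] by simp
  qed
  then show "l \<in> ran s \<longleftrightarrow> s (fst l) = Some l" for l
    using ranI[of s "fst l" l] by blast
  have "inj_on fst (ran s)"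
  proof (rule inj_onI)
    fix l l' assume "l \<in> ran s" "l' \<in> ran s" "fst l = fst l'"
    then have "Some l = Some l'" using ran by metis
    then show "l = l'" by simp
  qed
  moreover have "fst ` ran s = dom s"
  proof (intro set_eqI iffI)
    fix i assume "i \<in> dom s"
    then obtain l where l: "s i = Some l" by blast
    then show "i \<in> fst ` ran s" using *[OF l] ranI[of s i l] by force
  next
    fix i assume "i \<in> fst ` ran s"
    then obtain l j where l: "s j = Some l" "i = fst l" unfolding ran_def by blast
    then show "i \<in> dom s" using *[OF l(1)] by blast
  qed
  ultimately show "bij_betw fst (ran s) (dom s)" by (simp add: bij_betw_def)
qed

lemma selection_ran:
  assumes "is_selection N A s"
  shows "finite (ran s)" "ran s \<subseteq> A" "card (ran s) \<le> N" "ran s = {} \<longleftrightarrow> s = Map.empty"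
proof -
  have d: "dom s \<subseteq> {..<N}" using assms by (auto simp: is_selection_def)
  then have "finite (dom s)" by (rule finite_subset) simp
  then show "finite (ran s)" by (rule finite_ran)
  show "ran s \<subseteq> A" using assms by (auto simp: is_selection_def ran_def)
  show "card (ran s) \<le> N"
    using bij_betw_same_card[OF selection_bij(1)[OF assms]] card_mono[OF _ d] by simp
  show "ran s = {} \<longleftrightarrow> s = Map.empty"
    by (metis domIff dom_eq_empty_conv ex_in_conv not_None_eq ranI ran_empty)
qed

lemma selection_eqI:
  assumes "is_selection N A s" "is_selection N B t" "ran s = ran t"
  shows "s = t"
proof
  fix i
  have "s i = Some l \<longleftrightarrow> t i = Some l" for l
    using selection_bij(2)[OF assms(1), of l] selection_bij(2)[OF assms(2), of l]
      is_selectionD[OF assms(1)] is_selectionD[OF assms(2)] assms(3) by metis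
  then show "s i = t i" by (metis not_None_eq)
qed

lemma sum_selection:
  assumes "is_selection N A s"
  shows "(\<Sum>i<N. case s i of None \<Rightarrow> c | Some l \<Rightarrow> h l)
    = (\<Sum>l\<in>ran s. h l) + (real N - real (card (ran s))) * c"
proof -
  have d: "dom s \<subseteq> {..<N}" using assms by (auto simp: is_selection_def)
  have "(\<Sum>i<N. case s i of None \<Rightarrow> c | Some l \<Rightarrow> h l)
    = (\<Sum>i\<in>{..<N} - dom s. case s i of None \<Rightarrow> c | Some l \<Rightarrow> h l)
      + (\<Sum>i\<in>dom s. case s i of None \<Rightarrow> c | Some l \<Rightarrow> h l)"
    using d by (intro sum.subset_diff) auto
  also have "(\<Sum>i\<in>{..<N} - dom s. case s i of None \<Rightarrow> c | Some l \<Rightarrow> h l)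
      = (\<Sum>i\<in>{..<N} - dom s. c)"
    by (intro sum.cong refl) (metis DiffD2 domIff option.case(1))
  also have "\<dots> = (real N - real (card (ran s))) * c"
    using d card_mono[OF _ d] bij_betw_same_card[OF selection_bij(1)[OF assms]]
    by (simp add: card_Diff_subset finite_subset of_nat_diff)
  also have "(\<Sum>i\<in>dom s. case s i of None \<Rightarrow> c | Some l \<Rightarrow> h l) = (\<Sum>l\<in>ran s. h l)"
    by (rule sum.reindex_bij_betw[OF selection_bij(1)[OF assms], symmetric, THEN trans])
       (use selection_bij(2)[OF assms] in \<open>auto intro!: sum.cong\<close>)
  finally show ?thesis by simp
qed

text \<open>The minimum of \<open>selection_cost\<close> over the plane. Entries \<Delta> exert no
  pull along the diagonal and pull towards \<open>pers\<close> 0 across it, hence the weight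
  \<open>card (ran s)\<close> for \<open>csum\<close> and \<open>N\<close> for
  \<open>pers\<close>.\<close>

definition min_cost :: "nat \<Rightarrow> (label \<Rightarrow> point) \<Rightarrow> selection \<Rightarrow> real" where
  "min_cost N q s = ((\<Sum>l\<in>ran s. (csum (q l))\<^sup>2 + (pers (q l))\<^sup>2)
     - (\<Sum>l\<in>ran s. csum (q l))\<^sup>2 / card (ran s) - (\<Sum>l\<in>ran s. pers (q l))\<^sup>2 / N) / 2"

text \<open>Completing the square in the coordinates along and across the diagonal.\<close>

lemma complete_square:
  "0 < k \<Longrightarrow> k * (x - a / k)\<^sup>2 = k * x\<^sup>2 - 2 * x * a + a\<^sup>2 / k" for k :: real
  by (simp add: power2_eq_square field_simps)

lemma selection_cost_eq:
  assumes s: "is_selection N A s" "s \<noteq> Map.empty"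
  shows "selection_cost N q s x = min_cost N q s
    + (card (ran s) * (csum x - (\<Sum>l\<in>ran s. csum (q l)) / card (ran s))\<^sup>2
       + N * (pers x - (\<Sum>l\<in>ran s. pers (q l)) / N)\<^sup>2) / 2"
proof -
  let ?k = "real (card (ran s))"
  have k: "?k > 0" "real N > 0"
    using selection_ran[OF s(1)] s(2) by (simp_all add: card_gt_0_iff) (metis card_0_eq gr0I le_zero_eq)
  have "selection_cost N q s x = (\<Sum>l\<in>ran s. (norm (x - q l))\<^sup>2) + (N - ?k) * ((pers x)\<^sup>2 / 2)"
    unfolding selection_cost_def infdist_diagonal_power2 by (rule sum_selection[OF s(1)])
  also have "(\<Sum>l\<in>ran s. (norm (x - q l))\<^sup>2) = (\<Sum>l\<in>ran s.
      ((csum x)\<^sup>2 + (pers x)\<^sup>2) / 2 - csum x * csum (q l) - pers x * pers (q l)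
        + ((csum (q l))\<^sup>2 + (pers (q l))\<^sup>2) / 2)"
    by (intro sum.cong) (auto simp: norm_diff_power2 power2_diff field_simps)
  also have "\<dots> = ?k * (((csum x)\<^sup>2 + (pers x)\<^sup>2) / 2) - csum x * (\<Sum>l\<in>ran s. csum (q l))
      - pers x * (\<Sum>l\<in>ran s. pers (q l)) + (\<Sum>l\<in>ran s. (csum (q l))\<^sup>2 + (pers (q l))\<^sup>2) / 2"
    unfolding sum.distrib sum_subtractf sum_divide_distrib[symmetric] sum_distrib_left[symmetric]
    by (simp add: distrib_left add_divide_distrib)
  finally show ?thesis
    using k by (simp add: min_cost_def complete_square sum.distrib add_divide_distrib diff_divide_distrib algebra_simps)
qed

lemma selection_cost_empty: "selection_cost N q Map.empty x = N * (pers x)\<^sup>2 / 2"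
  by (simp add: selection_cost_def infdist_diagonal_power2)

lemma selection_cost_ge:
  assumes "is_selection N A s" "s \<noteq> Map.empty"
  shows "min_cost N q s \<le> selection_cost N q s x"
  by (simp add: selection_cost_eq[OF assms])

lemma selection_cost_eq_min_iff:
  assumes "is_selection N A s" "s \<noteq> Map.empty"
  shows "selection_cost N q s x = min_cost N q s \<longleftrightarrow>
    csum x = (\<Sum>l\<in>ran s. csum (q l)) / card (ran s) \<and> pers x = (\<Sum>l\<in>ran s. pers (q l)) / N"
proof -
  have "card (ran s) > 0" "N > 0"
    using selection_ran[OF assms(1)] assms(2) by (simp_all add: card_gt_0_iff) (metis card_0_eq gr0I le_zero_eq)
  then show ?thesis
    by (auto simp: selection_cost_eq[OF assms] add_nonneg_eq_0_iff)
qed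

lemma csum_pers_surj: "\<exists>x. csum x = a \<and> pers x = b"
  by (intro exI[of _ "((a - b) / 2, (a + b) / 2)"]) (simp add: csum_def pers_def field_simps)

text \<open>Both weights in the completed squares are positive, so the excess over
  \<open>min_cost\<close> vanishes at exactly one point, the one that \<open>THE\<close>
  picks.\<close>

lemma mean_coords:
  assumes "is_selection N A s" "s \<noteq> Map.empty"
  shows "csum (mean N q s) = (\<Sum>l\<in>ran s. csum (q l)) / card (ran s)"
    and "pers (mean N q s) = (\<Sum>l\<in>ran s. pers (q l)) / N"
proof -
  obtain x0 where x0: "csum x0 = (\<Sum>l\<in>ran s. csum (q l)) / card (ran s)"
      "pers x0 = (\<Sum>l\<in>ran s. pers (q l)) / N"
    using csum_pers_surj by blast
  have min0: "selection_cost N q s x0 = min_cost N q s"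
    using x0 by (simp add: selection_cost_eq_min_iff[OF assms])
  have iff: "selection_cost N q s x = min_cost N q s \<longleftrightarrow> x = x0" for x
    by (simp add: selection_cost_eq_min_iff[OF assms] point_eq_iff x0)
  have "is_arg_min (selection_cost N q s) (\<lambda>_. True) x \<longleftrightarrow> x = x0" for x
  proof
    assume "is_arg_min (selection_cost N q s) (\<lambda>_. True) x"
    then have "selection_cost N q s x \<le> min_cost N q s"
      using min0 unfolding is_arg_min_def by (metis not_less)
    then show "x = x0"
      using selection_cost_ge[OF assms, of q x] by (simp add: iff[symmetric])
  next
    assume "x = x0"
    then show "is_arg_min (selection_cost N q s) (\<lambda>_. True) x"
      using min0 selection_cost_ge[OF assms, of q] by (simp add: is_arg_min_def not_less)
  qed
  then have "mean N q s = x0" by (simp add: mean_def)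
  then show "csum (mean N q s) = (\<Sum>l\<in>ran s. csum (q l)) / card (ran s)"
    "pers (mean N q s) = (\<Sum>l\<in>ran s. pers (q l)) / N" using x0 by auto
qed

lemma selection_cost_min_iff_mean:
  assumes "is_selection N A s" "s \<noteq> Map.empty"
  shows "selection_cost N q s x = min_cost N q s \<longleftrightarrow> x = mean N q s"
  by (simp add: selection_cost_eq_min_iff[OF assms] point_eq_iff mean_coords[OF assms])

lemma pers_mean_pos:
  assumes "is_selection N A s" "s \<noteq> Map.empty" "\<And>l. l \<in> A \<Longrightarrow> 0 < pers (q l)"
  shows "0 < pers (mean N q s)"
proof -
  have "0 < (\<Sum>l\<in>ran s. pers (q l))"
    using selection_ran[OF assms(1)] assms by (intro sum_pos) auto
  moreover have "N > 0" using selection_ran[OF assms(1)] assms(2) by (metis card_0_eq gr0I le_zero_eq)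
  ultimately show ?thesis by (simp add: mean_coords[OF assms(1,2)])
qed

lemma min_cost_nonneg:
  assumes "is_selection N A s" "s \<noteq> Map.empty"
  shows "0 \<le> min_cost N q s"
proof -
  have "selection_cost N q s (mean N q s) \<ge> 0"
    unfolding selection_cost_def by (intro sum_nonneg) (auto split: option.split)
  then show ?thesis using selection_cost_min_iff_mean[OF assms] by metis
qed

subsection \<open>Groupings and the minimum of the Frechet function\<close>


declare split_paired_All [simp del] split_paired_Ex [simp del]

definition grouping_cost :: "nat \<Rightarrow> (label \<Rightarrow> point) \<Rightarrow> selection set \<Rightarrow> real" where
  "grouping_cost N q G = (\<Sum>s\<in>G. min_cost N q s)"

abbreviation diagrams_of :: "label set \<Rightarrow> (label \<Rightarrow> point) \<Rightarrow> nat \<Rightarrow> diagram" where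
  "diagrams_of A q \<equiv> \<lambda>i. diagram_of q {l \<in> A. fst l = i}"

lemma is_groupingD:
  assumes "is_grouping N A G" "s \<in> G"
  shows "is_selection N A s" "s \<noteq> Map.empty"
  using assms unfolding is_grouping_def by blast+

lemma grouping_unique:
  assumes "is_grouping N A G" "s \<in> G" "t \<in> G" "l \<in> ran s" "l \<in> ran t"
  shows "s = t"
proof -
  have "l \<in> A" using selection_ran(2)[OF is_groupingD(1)[OF assms(1,2)]] assms(4) by blast
  then have "\<exists>!s. s \<in> G \<and> l \<in> ran s" using assms(1) unfolding is_grouping_def by blast
  then show ?thesis using assms by blast
qed

lemma finite_selections:
  assumes "finite A" shows "finite {s. is_selection N A s}"
proof (rule finite_subset)
  show "{s. is_selection N A s} \<subseteq> (\<Union>D\<in>Pow {..<N}. {s. dom s = D \<and> ran s \<subseteq> A})"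
    by (auto simp: is_selection_def ran_def)
  show "finite (\<Union>D\<in>Pow {..<N}. {s. dom s = D \<and> ran s \<subseteq> A})"
    using assms by (intro finite_UN_I) (auto intro: finite_set_of_finite_maps finite_subset)
qed

lemma finite_groupings:
  assumes "finite A"
  shows "finite {G. is_grouping N A G}" "is_grouping N A G \<Longrightarrow> finite G"
proof -
  have sub: "{G. is_grouping N A G} \<subseteq> Pow {s. is_selection N A s}"
    by (auto simp: is_grouping_def)
  then show "finite {G. is_grouping N A G}"
    by (rule finite_subset) (simp add: finite_selections assms)
  show "is_grouping N A G \<Longrightarrow> finite G"
    using sub finite_subset[OF _ finite_selections[OF assms]] by blast
qed

lemma trivial_selection:
  "ran (trivial_selection l) = {l}" "trivial_selection l \<noteq> Map.empty"
  "l \<in> A \<Longrightarrow> fst l < N \<Longrightarrow> is_selection N A (trivial_selection l)"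
  unfolding is_selection_def trivial_selection_def by (simp, simp, metis map_upd_Some_unfold option.distinct(1))

lemma is_selection_mono: "is_selection N B s \<Longrightarrow> B \<subseteq> A \<Longrightarrow> is_selection N A s"
  unfolding is_selection_def by blast

text \<open>This is how a grouping of the surviving points becomes one of all points. A label of
  \<open>B\<close> lies in no added selection and a label outside \<open>B\<close> in no old one, so
  uniqueness persists.\<close>

lemma is_grouping_Un_trivial:
  assumes "is_grouping N B G" "B \<subseteq> A" "\<And>l. l \<in> A \<Longrightarrow> fst l < N"
  shows "is_grouping N A (G \<union> trivial_selection ` (A - B))"
  unfolding is_grouping_def
proof (intro conjI ballI)
  fix s assume "s \<in> G \<union> trivial_selection ` (A - B)"
  then consider "s \<in> G" | l where "l \<in> A" "s = trivial_selection l" by blast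
  then have "is_selection N A s \<and> s \<noteq> Map.empty"
  proof cases
    case 1
    from is_groupingD[OF assms(1) this] show ?thesis by (simp add: is_selection_mono[OF _ assms(2)])
  next
    case 2
    then show ?thesis using trivial_selection(2)[of l] trivial_selection(3)[OF _ assms(3)] by simp
  qed
  then show "is_selection N A s" "s \<noteq> Map.empty" by simp_all
next
  fix l assume l: "l \<in> A"
  have r: "ran s \<subseteq> B" if "s \<in> G" for s
    using selection_ran(2)[OF is_groupingD(1)[OF assms(1) that]] .
  show "\<exists>!s. s \<in> G \<union> trivial_selection ` (A - B) \<and> l \<in> ran s"
  proof (cases "l \<in> B")
    case True
    then have "\<exists>!s. s \<in> G \<and> l \<in> ran s"
      using assms(1) unfolding is_grouping_def by blast
    moreover have "l \<notin> ran s" if "s \<in> trivial_selection ` (A - B)" for s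
      using that True trivial_selection(1) by fastforce
    ultimately show ?thesis by blast
  next
    case False
    show ?thesis
    proof (rule ex1I)
      show "trivial_selection l \<in> G \<union> trivial_selection ` (A - B) \<and> l \<in> ran (trivial_selection l)"
        using l False by (auto simp: trivial_selection(1))
      show "s = trivial_selection l"
        if "s \<in> G \<union> trivial_selection ` (A - B) \<and> l \<in> ran s" for s
        using that r[of s] False by (auto simp: trivial_selection(1))
    qed
  qed
qed

lemma trivial_grouping:
  "(\<And>l. l \<in> A \<Longrightarrow> fst l < N) \<Longrightarrow> is_grouping N A (trivial_selection ` A)"
  using is_grouping_Un_trivial[of N "{}" "{}" A] by (simp add: is_grouping_def)

text \<open>The ranges of the selections of a grouping partition \<open>A\<close>.\<close>

lemma sum_grouping:
  assumes G: "is_grouping N A G" and fin: "finite A"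
  shows "(\<Sum>s\<in>G. \<Sum>l\<in>ran s. h l) = (\<Sum>l\<in>A. h l)"
proof -
  have "(\<Union>s\<in>G. ran s) = A"
    using selection_ran(2)[OF is_groupingD(1)[OF G]] G unfolding is_grouping_def by blast
  moreover have "(\<Sum>l\<in>(\<Union>s\<in>G. ran s). h l) = (\<Sum>s\<in>G. \<Sum>l\<in>ran s. h l)"
    using finite_groupings(2)[OF fin G] selection_ran(1)[OF is_groupingD(1)[OF G]]
      grouping_unique[OF G] by (intro sum.UNION_disjoint) blast+
  ultimately show ?thesis by simp
qed

text \<open>The ranges are disjoint and nonempty. This bounds the number of means by
  \<open>N * K\<close>.\<close>

lemma card_grouping_le:
  assumes G: "is_grouping N A G" and fin: "finite A"
  shows "card G \<le> card A"
proof -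
  have "card G = (\<Sum>s\<in>G. 1)" by simp
  also have "\<dots> \<le> (\<Sum>s\<in>G. card (ran s))"
    using selection_ran[OF is_groupingD(1)[OF G]] is_groupingD(2)[OF G]
    by (intro sum_mono) (metis One_nat_def Suc_leI card_gt_0_iff)
  also have "\<dots> = card A"
    using sum_grouping[OF G fin, of "\<lambda>_. 1::nat"] by simp
  finally show ?thesis .
qed

lemma bij_betw_ex1: "w \<in> B \<Longrightarrow> bij_betw f A B \<Longrightarrow> \<exists>!z. z \<in> A \<and> f z = w"
  unfolding bij_betw_def inj_on_def by blast

text \<open>Selections read off from matchings of a diagram \<open>Z\<close> to the data:
  \<open>s z\<close> collects the off-diagonal partners of \<open>z\<close>. Elements on the
  diagonal take part too, and since \<open>elems Z\<close> is infinite the cost is bounded over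
  finite subsets only.\<close>

definition matching_selections where
  "matching_selections N A q Z \<phi> s \<longleftrightarrow> (\<forall>z. is_selection N A (s z)) \<and>
    (\<forall>l\<in>A. \<exists>!z. z \<in> elems Z \<and> l \<in> ran (s z)) \<and>
    (\<forall>T. finite T \<and> T \<subseteq> elems Z \<longrightarrow>
      (\<Sum>z\<in>T. ennreal (selection_cost N q (s z) (fst z))) \<le> (\<Sum>i<N. matching_cost Z (\<phi> i)))"

lemma matching_selectionsD:
  assumes "matching_selections N A q Z \<phi> s"
  shows "is_selection N A (s z)" "l \<in> A \<Longrightarrow> \<exists>!z. z \<in> elems Z \<and> l \<in> ran (s z)"
    "finite T \<Longrightarrow> T \<subseteq> elems Z \<Longrightarrow>
      (\<Sum>z\<in>T. ennreal (selection_cost N q (s z) (fst z))) \<le> (\<Sum>i<N. matching_cost Z (\<phi> i))"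
  using assms unfolding matching_selections_def by simp_all

lemma matching_selections_exist:
  assumes fin: "finite A" and above: "\<And>l. l \<in> A \<Longrightarrow> 0 < pers (q l)"
    and idx: "\<And>l. l \<in> A \<Longrightarrow> fst l < N"
    and \<phi>: "\<And>i. i < N \<Longrightarrow> \<phi> i \<in> matchings Z (diagrams_of A q i)"
  shows "\<exists>s. matching_selections N A q Z \<phi> s"
proof -
  define B where "B i = {l \<in> A. fst l = i}" for i
  have "\<exists>e. bij_betw e (B i) (offdiag (diagram_of q (B i))) \<and> (\<forall>l. fst (e l) = q l)" for i
  proof -
    have "finite (B i)" "\<And>l. l \<in> B i \<Longrightarrow> 0 < pers (q l)" using fin above by (auto simp: B_def)
    then show ?thesis by (rule labelled_offdiag)
  qed
  then obtain e where e: "\<And>i. bij_betw (e i) (B i) (offdiag (diagram_of q (B i)))"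
      "\<And>i l. fst (e i l) = q l" by metis
  \<comment> \<open>A partner on the diagonal becomes \<Delta>. This can only lower the cost, as the
    diagonal is at most as far away as that partner.\<close>
  define s where "s z i = (if i < N \<and> \<phi> i z \<in> offdiag (diagram_of q (B i))
    then Some (inv_into (B i) (e i) (\<phi> i z)) else None)" for z i
  have s_iff: "s z i = Some l \<longleftrightarrow> i < N \<and> l \<in> B i \<and> \<phi> i z = e i l" for z i l
  proof
    assume *: "s z i = Some l"
    then have "i < N" "\<phi> i z \<in> offdiag (diagram_of q (B i))" "l = inv_into (B i) (e i) (\<phi> i z)"
      by (auto simp: s_def split: if_splits)
    then show "i < N \<and> l \<in> B i \<and> \<phi> i z = e i l"
      using e(1)[of i] by (metis bij_betw_def f_inv_into_f inv_into_into)
  next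
    assume "i < N \<and> l \<in> B i \<and> \<phi> i z = e i l"
    then show "s z i = Some l"
      using e(1)[of i] bij_betwE[OF e(1)[of i]] by (simp add: s_def bij_betw_inv_into_left)
  qed
  have sel: "is_selection N A (s z)" for z
    unfolding is_selection_def s_iff by (auto simp: B_def)
  have ran: "l \<in> ran (s z) \<longleftrightarrow> \<phi> (fst l) z = e (fst l) l" if "l \<in> A" for l z
    unfolding selection_bij(2)[OF sel] s_iff using idx[OF that] that by (simp add: B_def)
  have m: "bij_betw (\<phi> i) (elems Z) (elems (diagram_of q (B i)))" if "i < N" for i
    using \<phi>[OF that] by (simp add: matchings_def B_def)
  show ?thesis
  unfolding matching_selections_def
  proof (intro exI[of _ s] conjI allI ballI impI, rule sel)
    fix l assume l: "l \<in> A"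
    then have "l \<in> B (fst l)" by (simp add: B_def)
    then have "e (fst l) l \<in> elems (diagram_of q (B (fst l)))"
      using bij_betwE[OF e(1)[of "fst l"]] by (auto simp: offdiag_def)
    then have "\<exists>!z. z \<in> elems Z \<and> \<phi> (fst l) z = e (fst l) l"
      using m[OF idx[OF l]] by (rule bij_betw_ex1)
    then show "\<exists>!z. z \<in> elems Z \<and> l \<in> ran (s z)" using ran[OF l] by simp
  next
    fix T assume "finite T \<and> T \<subseteq> elems Z"
    then have T: "finite T" "T \<subseteq> elems Z" by auto
    have term_le: "(case s z i of None \<Rightarrow> (infdist (fst z) diagonal)\<^sup>2 | Some l \<Rightarrow> (norm (fst z - q l))\<^sup>2)
        \<le> (norm (fst z - fst (\<phi> i z)))\<^sup>2" if "z \<in> T" "i < N" for z i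
    proof (cases "s z i")
      case None
      then have "\<phi> i z \<notin> offdiag (diagram_of q (B i))" using that by (auto simp: s_def split: if_splits)
      moreover have "\<phi> i z \<in> elems (diagram_of q (B i))"
        using m[OF that(2)] that T by (auto simp: bij_betw_def)
      ultimately have "fst (\<phi> i z) \<in> diagonal" by (auto simp: offdiag_def)
      then show ?thesis using None norm_diagonal_ge[of "fst (\<phi> i z)" "fst z"]
        by (simp add: infdist_diagonal_power2)
    next
      case (Some l)
      then show ?thesis using s_iff[of z i l] e(2) by simp
    qed
    have "(\<Sum>z\<in>T. ennreal (selection_cost N q (s z) (fst z)))
      \<le> (\<Sum>z\<in>T. \<Sum>i<N. ennreal ((norm (fst z - fst (\<phi> i z)))\<^sup>2))"
      unfolding selection_cost_def
      by (intro sum_mono) (auto simp: sum_ennreal intro!: ennreal_leI sum_mono term_le)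
    also have "\<dots> = (\<Sum>i<N. \<Sum>z\<in>T. ennreal ((norm (fst z - fst (\<phi> i z)))\<^sup>2))"
      by (rule sum.swap)
    also have "\<dots> \<le> (\<Sum>i<N. matching_cost Z (\<phi> i))"
      by (intro sum_mono sum_le_matching_cost T)
    finally show "(\<Sum>z\<in>T. ennreal (selection_cost N q (s z) (fst z)))
      \<le> (\<Sum>i<N. matching_cost Z (\<phi> i))" .
  qed
qed

text \<open>A nonempty selection contains a label, and the label determines the element that chose
  it. Since there are finitely many selections, only finitely many elements have a nonempty
  one.\<close>

lemma grouping_of_selections:
  assumes fin: "finite A" and s: "\<And>z. is_selection N A (s z)"
    "\<And>l. l \<in> A \<Longrightarrow> \<exists>!z. z \<in> E \<and> l \<in> ran (s z)"
    and F: "F = {z \<in> E. s z \<noteq> Map.empty}"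
  shows "inj_on s F" "finite F" "is_grouping N A (s ` F)"
proof -
  have ran: "ran (s z) \<subseteq> A" for z by (rule selection_ran(2)[OF s(1)])
  show inj: "inj_on s F"
  proof (rule inj_onI)
    fix z w assume zw: "z \<in> F" "w \<in> F" "s z = s w"
    then have "ran (s z) \<noteq> {}" using selection_ran(4)[OF s(1)] F by blast
    then obtain l where "l \<in> ran (s z)" by blast
    moreover from this have "\<exists>!z. z \<in> E \<and> l \<in> ran (s z)" using ran s(2) by blast
    moreover have "z \<in> E" "w \<in> E" "s z = s w" using zw F by auto
    ultimately show "z = w" by metis
  qed
  have "s ` F \<subseteq> {t. is_selection N A t}" using s(1) by auto
  then show "finite F"
    using inj finite_selections[OF fin] by (metis finite_imageD finite_subset)
  show "is_grouping N A (s ` F)"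
    unfolding is_grouping_def
  proof (intro conjI ballI)
    fix t assume "t \<in> s ` F"
    then show "is_selection N A t" "t \<noteq> Map.empty" using s(1) F by auto
  next
    fix l assume "l \<in> A"
    then obtain z where z: "z \<in> E" "l \<in> ran (s z)" "\<And>w. w \<in> E \<Longrightarrow> l \<in> ran (s w) \<Longrightarrow> w = z"
      using s(2) by blast
    have "s z \<noteq> Map.empty" using z(2) by auto
    then have "z \<in> F" using z(1) F by simp
    show "\<exists>!t. t \<in> s ` F \<and> l \<in> ran t"
    proof (rule ex1I)
      show "s z \<in> s ` F \<and> l \<in> ran (s z)" using \<open>z \<in> F\<close> z(2) by simp
      fix t assume "t \<in> s ` F \<and> l \<in> ran t"
      then obtain w where "w \<in> F" "t = s w" "l \<in> ran (s w)" by blast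
      then show "t = s z" using z(3)[of w] F by simp
    qed
  qed
qed

text \<open>Nearly optimal matchings of any competitor \<open>Z\<close> to the data yield selections
  that form a grouping, and moving each element to the mean of its selection only lowers the
  cost.\<close>

lemma frechet_greatest:
  assumes fin: "finite A" and above: "\<And>l. l \<in> A \<Longrightarrow> 0 < pers (q l)"
    and idx: "\<And>l. l \<in> A \<Longrightarrow> fst l < N" and N: "N > 0"
    and c: "\<And>G. is_grouping N A G \<Longrightarrow> c \<le> ennreal (grouping_cost N q G)"
  shows "c \<le> frechet N (diagrams_of A q) Z"
proof (rule ennreal_le_epsilon)
  fix e :: real assume *: "frechet N (diagrams_of A q) Z < \<top>" and e: "0 < e"
  \<comment> \<open>A slack of \<open>e / N\<close> for each of the \<open>N\<close> diagrams adds
    up to \<open>e\<close>.\<close>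
  have "\<exists>\<phi>\<in>matchings Z (diagrams_of A q i).
      matching_cost Z \<phi> < (W2 Z (diagrams_of A q i))\<^sup>2 + ennreal (e / N)" if "i < N" for i
  proof -
    have "(W2 Z (diagrams_of A q i))\<^sup>2 \<le> frechet N (diagrams_of A q) Z"
      unfolding frechet_def using that by (intro member_le_sum) auto
    then have "(W2 Z (diagrams_of A q i))\<^sup>2 < \<top>" using * by (rule le_less_trans)
    then have "(W2 Z (diagrams_of A q i))\<^sup>2 < (W2 Z (diagrams_of A q i))\<^sup>2 + ennreal (e / N)"
      using e N by (cases "(W2 Z (diagrams_of A q i))\<^sup>2") (auto simp: ennreal_plus[symmetric] ennreal_less_iff simp del: ennreal_plus)
    then show ?thesis by (rule W2_power2_less_obtains) blast
  qed
  then have "\<forall>i. \<exists>\<phi>. i < N \<longrightarrow> \<phi> \<in> matchings Z (diagrams_of A q i) \<and>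
      matching_cost Z \<phi> < (W2 Z (diagrams_of A q i))\<^sup>2 + ennreal (e / N)" by blast
  from choice[OF this] obtain \<phi> where \<phi>: "\<And>i. i < N \<Longrightarrow> \<phi> i \<in> matchings Z (diagrams_of A q i)"
    "\<And>i. i < N \<Longrightarrow> matching_cost Z (\<phi> i) < (W2 Z (diagrams_of A q i))\<^sup>2 + ennreal (e / N)"
    by blast
  obtain s where "matching_selections N A q Z \<phi> s"
    using matching_selections_exist[where q = q and Z = Z and \<phi> = \<phi>, OF fin above idx \<phi>(1)] by auto
  note s = matching_selectionsD[OF this]
  define F where "F = {z \<in> elems Z. s z \<noteq> Map.empty}"
  note F = grouping_of_selections[where s = s and E = "elems Z", OF fin s(1,2) F_def]
  have "c \<le> ennreal (\<Sum>z\<in>F. min_cost N q (s z))"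
    using c[OF F(3)] by (simp add: grouping_cost_def sum.reindex[OF F(1)])
  also have "\<dots> = (\<Sum>z\<in>F. ennreal (min_cost N q (s z)))"
    using min_cost_nonneg[OF s(1)] by (intro sum_ennreal[symmetric]) (auto simp: F_def)
  also have "\<dots> \<le> (\<Sum>z\<in>F. ennreal (selection_cost N q (s z) (fst z)))"
    using selection_cost_ge[OF s(1)] by (intro sum_mono ennreal_leI) (auto simp: F_def)
  also have "\<dots> \<le> (\<Sum>i<N. matching_cost Z (\<phi> i))"
    by (rule s(3)) (use F in \<open>auto simp: F_def\<close>)
  also have "\<dots> \<le> (\<Sum>i<N. (W2 Z (diagrams_of A q i))\<^sup>2 + ennreal (e / N))"
    using \<phi>(2) by (intro sum_mono) (auto intro: less_imp_le)
  also have "\<dots> = frechet N (diagrams_of A q) Z + ennreal e"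
    using N e by (simp add: sum.distrib frechet_def ennreal_of_nat_eq_real_of_nat ennreal_mult[symmetric])
  finally show "c \<le> frechet N (diagrams_of A q) Z + ennreal e" .
qed

text \<open>Each mean is matched with the entries that its selection chooses. It is only an
  inequality, as other matchings of the mean diagram may be cheaper.\<close>

lemma frechet_mean_le:
  assumes fin: "finite A" and above: "\<And>l. l \<in> A \<Longrightarrow> 0 < pers (q l)" and G: "is_grouping N A G"
  shows "frechet N (diagrams_of A q) (mean_diagram N q G) \<le> ennreal (grouping_cost N q G)"
proof -
  note finG = finite_groupings(2)[OF fin G]
  let ?c = "\<lambda>t i. case t i of None \<Rightarrow> (infdist (mean N q t) diagonal)\<^sup>2 | Some l \<Rightarrow> (norm (mean N q t - q l))\<^sup>2"
  have "(W2 (mean_diagram N q G) (diagrams_of A q i))\<^sup>2 \<le> ennreal (\<Sum>t\<in>G. ?c t i)" for i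
  proof -
    let ?B = "{l \<in> A. fst l = i}"
    define H where "H = {t \<in> G. t i \<noteq> None}"
    define R where "R = (\<lambda>t. (t, the (t i))) ` H"
    have sel: "l \<in> A" "fst l = i" "l \<in> ran t" if "t \<in> G" "t i = Some l" for t l
      using is_selectionD[OF is_groupingD(1)[OF G that(1)] that(2)] that(2) by (auto intro: ranI)
    have 1: "fst ` R = H" by (force simp: R_def)
    have 2: "snd ` R = ?B"
    proof (intro set_eqI iffI)
      fix l assume "l \<in> snd ` R"
      then show "l \<in> ?B" using sel by (auto simp: R_def H_def)
    next
      fix l assume l: "l \<in> ?B"
      then obtain t where "t \<in> G" "l \<in> ran t" using G unfolding is_grouping_def by blast
      moreover from this have ti: "t i = Some l"
        using selection_bij(2)[OF is_groupingD(1)[OF G]] l by auto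
      ultimately have "(t, l) \<in> R" unfolding R_def H_def by (intro image_eqI[of _ _ t]) (simp_all del: not_None_eq)
      then show "l \<in> snd ` R" by force
    qed
    have "inj_on (\<lambda>t. the (t i)) H"
      using sel(3) grouping_unique[OF G] by (auto simp: inj_on_def H_def) metis
    then have R: "R \<in> partial_matchings G ?B"
    proof -
      assume "inj_on (\<lambda>t. the (t i)) H"
      then have "inj_on fst R" "inj_on snd R" by (auto simp: R_def inj_on_def)
      moreover have "R \<subseteq> fst ` R \<times> snd ` R" by force
      moreover have "fst ` R \<subseteq> G" unfolding 1 by (simp add: H_def)
      ultimately show ?thesis using 2 unfolding partial_matchings_def by blast
    qed
    have "(W2 (mean_diagram N q G) (diagrams_of A q i))\<^sup>2
      \<le> ennreal (partial_cost (mean N q) G q ?B R)"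
      unfolding mean_diagram_def
      using finG fin above R pers_mean_pos[OF is_groupingD[OF G] above]
      by (intro W2_labelled_le) auto
    also have "partial_cost (mean N q) G q ?B R
      = (\<Sum>t\<in>H. (norm (mean N q t - q (the (t i))))\<^sup>2) + (\<Sum>t\<in>G - H. (pers (mean N q t))\<^sup>2 / 2)"
      unfolding partial_cost_def 1 2
      by (simp add: R_def sum.reindex inj_on_def)
    also have "\<dots> = (\<Sum>t\<in>H. ?c t i) + (\<Sum>t\<in>G - H. ?c t i)"
      by (intro arg_cong2[where f="(+)"] sum.cong refl) (auto simp: H_def infdist_diagonal_power2)
    also have "\<dots> = (\<Sum>t\<in>G. ?c t i)"
      using sum.subset_diff[of H G "\<lambda>t. ?c t i"] finG by (simp add: H_def add.commute)
    finally show ?thesis .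
  qed
  then have "frechet N (diagrams_of A q) (mean_diagram N q G) \<le> (\<Sum>i<N. ennreal (\<Sum>t\<in>G. ?c t i))"
    unfolding frechet_def by (intro sum_mono)
  also have "\<dots> = ennreal (\<Sum>i<N. \<Sum>t\<in>G. ?c t i)"
    by (intro sum_ennreal sum_nonneg) (auto split: option.split)
  also have "(\<Sum>i<N. \<Sum>t\<in>G. ?c t i) = (\<Sum>t\<in>G. selection_cost N q t (mean N q t))"
    unfolding selection_cost_def by (rule sum.swap)
  also have "\<dots> = grouping_cost N q G"
    unfolding grouping_cost_def
    by (intro sum.cong refl) (simp add: selection_cost_min_iff_mean[OF is_groupingD[OF G]])
  finally show ?thesis .
qed

lemma empty_diagram_eq: "empty_diagram = diagram_of f {}"
  by (simp add: empty_diagram_def diagram_of_def zero_enat_def[symmetric] cong: if_cong)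

text \<open>A minimum over all diagrams becomes finitely many comparisons. The left side remains the
  Frechet value of the mean diagram, which in general is only bounded by
  \<open>grouping_cost N q G\<close>.\<close>

lemma optimal_grouping_iff:
  assumes fin: "finite A" and above: "\<And>l. l \<in> A \<Longrightarrow> 0 < pers (q l)"
    and idx: "\<And>l. l \<in> A \<Longrightarrow> fst l < N" and N: "N > 0"
  shows "optimal_grouping N A q G \<longleftrightarrow> is_grouping N A G \<and> (\<forall>G'. is_grouping N A G' \<longrightarrow>
    frechet N (diagrams_of A q) (mean_diagram N q G) \<le> ennreal (grouping_cost N q G'))"
proof -
  have finite_W2: "W2 (mean_diagram N q G) empty_diagram < \<infinity>" if G: "is_grouping N A G" for G
  proof -
    have "(W2 (mean_diagram N q G) empty_diagram)\<^sup>2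
      \<le> ennreal (partial_cost (mean N q) G (q :: label \<Rightarrow> point) {} {})"
      unfolding mean_diagram_def empty_diagram_eq[of q]
      using finite_groupings(2)[OF fin G] pers_mean_pos[OF is_groupingD[OF G] above]
      by (intro W2_labelled_le empty_partial_matching) auto
    then have "(W2 (mean_diagram N q G) empty_diagram)\<^sup>2 < \<infinity>"
      by (rule le_less_trans) simp
    then show ?thesis
      by (cases "W2 (mean_diagram N q G) empty_diagram") (auto simp: top_power_ennreal)
  qed
  show ?thesis
  proof
    assume "optimal_grouping N A q G"
    then have G: "is_grouping N A G" and arg_min: "is_arg_min (frechet N (diagrams_of A q))
        (\<lambda>Z. W2 Z empty_diagram < \<infinity>) (mean_diagram N q G)"
      unfolding optimal_grouping_def by blast+
    have m: "frechet N (diagrams_of A q) (mean_diagram N q G) \<le> frechet N (diagrams_of A q) Z"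
      if "W2 Z empty_diagram < \<infinity>" for Z
    proof (rule ccontr)
      assume "\<not> ?thesis"
      then show False using arg_min that unfolding is_arg_min_def not_le by blast
    qed
    have "frechet N (diagrams_of A q) (mean_diagram N q G) \<le> ennreal (grouping_cost N q G')"
      if "is_grouping N A G'" for G'
      using m[OF finite_W2[OF that]] frechet_mean_le[where q = q, OF fin above that]
      by (rule order_trans)
    then show "is_grouping N A G \<and> (\<forall>G'. is_grouping N A G' \<longrightarrow>
      frechet N (diagrams_of A q) (mean_diagram N q G) \<le> ennreal (grouping_cost N q G'))"
      using G by simp
  next
    assume G: "is_grouping N A G \<and> (\<forall>G'. is_grouping N A G' \<longrightarrow>
      frechet N (diagrams_of A q) (mean_diagram N q G) \<le> ennreal (grouping_cost N q G'))"
    then have "frechet N (diagrams_of A q) (mean_diagram N q G) \<le> frechet N (diagrams_of A q) Z" for Z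
      using fin above idx N by (intro frechet_greatest) auto
    then show "optimal_grouping N A q G"
      using G finite_W2 by (auto simp: optimal_grouping_def is_arg_min_def not_less)
  qed
qed

text \<open>The mean of a selection has \<open>1 / N\<close> times its persistence sum as
  persistence, so distinct sums over subsets make a mean determine its selection; distinct costs
  make the cheapest grouping unique.\<close>

definition generic :: "nat \<Rightarrow> label set \<Rightarrow> (label \<Rightarrow> point) \<Rightarrow> bool" where
  "generic N A q \<longleftrightarrow>
     (\<forall>B\<in>Pow A. \<forall>B'\<in>Pow A. B \<noteq> B' \<longrightarrow> (\<Sum>l\<in>B. pers (q l)) \<noteq> (\<Sum>l\<in>B'. pers (q l))) \<and>
     (\<forall>G\<in>{G. is_grouping N A G}. \<forall>G'\<in>{G. is_grouping N A G}.
        G \<noteq> G' \<longrightarrow> grouping_cost N q G \<noteq> grouping_cost N q G')"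

lemma genericD:
  assumes "generic N A q"
  shows "B \<subseteq> A \<Longrightarrow> B' \<subseteq> A \<Longrightarrow> (\<Sum>l\<in>B. pers (q l)) = (\<Sum>l\<in>B'. pers (q l)) \<Longrightarrow> B = B'"
    and "is_grouping N A G \<Longrightarrow> is_grouping N A G' \<Longrightarrow>
      grouping_cost N q G = grouping_cost N q G' \<Longrightarrow> G = G'"
  using assms[unfolded generic_def, THEN conjunct1, rule_format, of B B']
    assms[unfolded generic_def, THEN conjunct2, rule_format, of G G'] by auto

text \<open>Since distinct selections have distinct means at a generic location, optimal matchings from
  the mean diagram back to the given diagrams recover the grouping.\<close>

lemma optimal_grouping_cost_le:
  assumes fin: "finite A" and above: "\<And>l. l \<in> A \<Longrightarrow> 0 < pers (q l)"
    and idx: "\<And>l. l \<in> A \<Longrightarrow> fst l < N" and N: "N > 0" and gen: "generic N A q"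
    and opt: "optimal_grouping N A q G" and G': "is_grouping N A G'"
  shows "grouping_cost N q G \<le> grouping_cost N q G'"
proof -
  have G: "is_grouping N A G" and le: "\<And>G'. is_grouping N A G' \<Longrightarrow>
    frechet N (diagrams_of A q) (mean_diagram N q G) \<le> ennreal (grouping_cost N q G')"
    using opt optimal_grouping_iff[OF fin above idx N] by auto
  note finG = finite_groupings(2)[OF fin G]
  note pos = pers_mean_pos[OF is_groupingD[OF G] above]
  define Z where "Z = mean_diagram N q G"
  have "\<exists>\<phi>\<in>matchings Z (diagrams_of A q i). matching_cost Z \<phi> = (W2 Z (diagrams_of A q i))\<^sup>2" for i
  proof -
    have "finite (offdiag Z)" "finite (offdiag (diagrams_of A q i))"
      unfolding Z_def mean_diagram_def using fin finG by (simp_all add: finite_offdiag_diagram_of)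
    then obtain \<phi> where "\<phi> \<in> matchings Z (diagrams_of A q i)"
        "matching_cost Z \<phi> = (W2 Z (diagrams_of A q i))\<^sup>2"
      by (rule matching_attained)
    then show ?thesis by blast
  qed
  then have "\<forall>i. \<exists>\<phi>. \<phi> \<in> matchings Z (diagrams_of A q i) \<and>
      matching_cost Z \<phi> = (W2 Z (diagrams_of A q i))\<^sup>2" by blast
  from choice[OF this] obtain \<phi> where \<phi>: "\<And>i. \<phi> i \<in> matchings Z (diagrams_of A q i)"
    "\<And>i. matching_cost Z (\<phi> i) = (W2 Z (diagrams_of A q i))\<^sup>2" by blast
  obtain s where "matching_selections N A q Z \<phi> s"
    using matching_selections_exist[where q = q and Z = Z and \<phi> = \<phi>, OF fin above idx \<phi>(1)] by auto
  note s = matching_selectionsD[OF this]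
  define F where "F = {z \<in> elems Z. s z \<noteq> Map.empty}"
  note F = grouping_of_selections[where s = s and E = "elems Z", OF fin s(1,2) F_def]
  have F_cost: "grouping_cost N q (s ` F) = (\<Sum>z\<in>F. min_cost N q (s z))"
    by (simp add: grouping_cost_def sum.reindex[OF F(1)])
  have nonneg: "0 \<le> selection_cost N q t x" for t x
    unfolding selection_cost_def by (intro sum_nonneg) (auto split: option.split)
  \<comment> \<open>Optimality bounds the cost of any finite set of elements of \<open>Z\<close> by
    every grouping cost, in particular by that of the grouping recovered from the matchings.\<close>
  have T_le: "(\<Sum>z\<in>T. selection_cost N q (s z) (fst z)) \<le> grouping_cost N q G'"
    if "finite T" "T \<subseteq> elems Z" "is_grouping N A G'" for T G'
  proof -
    have "ennreal (\<Sum>z\<in>T. selection_cost N q (s z) (fst z))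
        = (\<Sum>z\<in>T. ennreal (selection_cost N q (s z) (fst z)))"
      by (simp add: sum_ennreal nonneg)
    also have "\<dots> \<le> (\<Sum>i<N. matching_cost Z (\<phi> i))" by (rule s(3)[OF that(1,2)])
    also have "\<dots> = frechet N (diagrams_of A q) (mean_diagram N q G)"
      by (simp add: frechet_def \<phi>(2) flip: Z_def)
    also have "\<dots> \<le> ennreal (grouping_cost N q G')" by (rule le[OF that(3)])
    finally show ?thesis
      using min_cost_nonneg[OF is_groupingD[OF that(3)]]
      by (subst (asm) ennreal_le_iff) (auto simp: grouping_cost_def intro!: sum_nonneg)
  qed
  have FE: "F \<subseteq> elems Z" by (auto simp: F_def)
  have min_le: "min_cost N q (s z) \<le> selection_cost N q (s z) (fst z)" if "z \<in> F" for z
    using that selection_cost_ge[OF s(1)] by (simp add: F_def)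
  \<comment> \<open>With the recovered grouping as competitor there is no room for a further
    element, whose cost would be \<open>N\<close> times its squared distance to the
    diagonal.\<close>
  have outside: "pers (fst z) = 0" if "z \<in> elems Z - F" for z
  proof -
    have "s z = Map.empty" using that by (auto simp: F_def)
    moreover have "(\<Sum>w\<in>insert z F. selection_cost N q (s w) (fst w)) \<le> (\<Sum>w\<in>F. min_cost N q (s w))"
      using T_le[of "insert z F" "s ` F"] that F FE F_cost by simp
    moreover have "(\<Sum>w\<in>F. min_cost N q (s w)) \<le> (\<Sum>w\<in>F. selection_cost N q (s w) (fst w))"
      by (intro sum_mono min_le)
    ultimately have "N * (pers (fst z))\<^sup>2 / 2 \<le> 0"
      using that F(2) by (simp add: selection_cost_empty)
    then show ?thesis using N by (simp add: mult_le_0_iff)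
  qed
  \<comment> \<open>The same comparison on \<open>F\<close> alone forces equality term by term, so
    every element sits at the mean of its selection.\<close>
  have inside: "fst z = mean N q (s z)" if "z \<in> F" for z
  proof -
    have "(\<Sum>w\<in>F. selection_cost N q (s w) (fst w)) = (\<Sum>w\<in>F. min_cost N q (s w))"
      using T_le[OF F(2) FE F(3)] F_cost sum_mono[of F, OF min_le] by fastforce
    then have "(\<Sum>w\<in>F. selection_cost N q (s w) (fst w) - min_cost N q (s w)) = 0"
      by (simp add: sum_subtractf)
    then have "selection_cost N q (s z) (fst z) = min_cost N q (s z)"
      using that F(2) min_le by (subst (asm) sum_nonneg_eq_0_iff) auto
    then show ?thesis using selection_cost_min_iff_mean[OF s(1)] that by (auto simp: F_def)
  qed
  obtain e where e: "bij_betw e G (offdiag Z)" "\<And>t. fst (e t) = mean N q t"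
    unfolding Z_def mean_diagram_def using labelled_offdiag[where f = "mean N q", OF finG pos] by auto
  have sub: "G \<subseteq> s ` F"
  proof
    fix t assume t: "t \<in> G"
    then have "e t \<in> offdiag Z" using e by (auto simp: bij_betw_def)
    then have zF: "e t \<in> F"
      using outside[of "e t"] by (auto simp: mem_offdiag_iff)
    then have "mean N q t = mean N q (s (e t))" using inside[of "e t"] e(2) by simp
    moreover have "s (e t) \<noteq> Map.empty" using zF by (simp add: F_def)
    ultimately have "(\<Sum>l\<in>ran t. pers (q l)) = (\<Sum>l\<in>ran (s (e t)). pers (q l))"
      using mean_coords(2)[where q = q, OF is_groupingD[OF G t]] mean_coords(2)[where q = q, OF s(1)] N by simp
    then have "ran t = ran (s (e t))"
      by (rule genericD(1)[OF gen selection_ran(2)[OF is_groupingD(1)[OF G t]] selection_ran(2)[OF s(1)]])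
    then have "t = s (e t)" by (rule selection_eqI[OF is_groupingD(1)[OF G t] s(1)])
    then show "t \<in> s ` F" using zF by blast
  qed
  \<comment> \<open>Each recovered selection shares a label with some selection of \<open>G\<close>.
    The latter is recovered as well, and in a grouping the label belongs to only one
    selection.\<close>
  have "s ` F \<subseteq> G"
  proof
    fix t assume t: "t \<in> s ` F"
    then have "ran t \<noteq> {}" using is_groupingD[OF F(3)] selection_ran(4) by metis
    then obtain l where l: "l \<in> ran t" by blast
    then obtain u where "u \<in> G" "l \<in> ran u"
      using G selection_ran(2)[OF is_groupingD(1)[OF F(3) t]] unfolding is_grouping_def by blast
    then show "t \<in> G" using grouping_unique[OF F(3) t _ l] sub by blast
  qed
  then have "s ` F = G" using sub by blast
  then have "grouping_cost N q G \<le> (\<Sum>z\<in>F. selection_cost N q (s z) (fst z))"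
    using F_cost sum_mono[of F, OF min_le] by simp
  also have "\<dots> \<le> grouping_cost N q G'" by (rule T_le[OF F(2) FE G'])
  finally show ?thesis .
qed

text \<open>A cheapest grouping is optimal because its cost bounds the Frechet value of its mean.
  Two optimal groupings both have least cost, and genericity identifies them.\<close>

lemma unique_optimal_grouping:
  assumes fin: "finite A" and above: "\<And>l. l \<in> A \<Longrightarrow> 0 < pers (q l)"
    and idx: "\<And>l. l \<in> A \<Longrightarrow> fst l < N" and N: "N > 0" and gen: "generic N A q"
  shows "\<exists>!G. optimal_grouping N A q G"
proof (rule ex_ex1I)
  let ?S = "{G. is_grouping N A G}"
  have S: "finite ?S" "?S \<noteq> {}"
    using finite_groupings(1)[OF fin] trivial_grouping[OF idx] by auto
  define G where "G = arg_min_on (grouping_cost N q) ?S"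
  have G: "is_grouping N A G" "\<And>G'. is_grouping N A G' \<Longrightarrow> grouping_cost N q G \<le> grouping_cost N q G'"
    using arg_min_if_finite(1)[OF S] arg_min_least[OF S] by (auto simp: G_def)
  have "optimal_grouping N A q G"
  proof (rule optimal_grouping_iff[where q = q, OF fin above idx N, THEN iffD2])
    show "is_grouping N A G \<and> (\<forall>G'. is_grouping N A G' \<longrightarrow>
      frechet N (diagrams_of A q) (mean_diagram N q G) \<le> ennreal (grouping_cost N q G'))"
      using G(1) order_trans[OF frechet_mean_le[where q = q, OF fin above G(1)] ennreal_leI[OF G(2)]]
      by simp
  qed
  then show "\<exists>G. optimal_grouping N A q G" ..
next
  fix G G' assume opt: "optimal_grouping N A q G" "optimal_grouping N A q G'"
  then have G: "is_grouping N A G" "is_grouping N A G'" by (auto simp: optimal_grouping_def)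
  have "grouping_cost N q G = grouping_cost N q G'"
    using optimal_grouping_cost_le[where q = q, OF fin above idx N gen opt(1) G(2)]
      optimal_grouping_cost_le[where q = q, OF fin above idx N gen opt(2) G(1)] by simp
  then show "G = G'" by (rule genericD(2)[OF gen G])
qed

subsection \<open>Relabelling groupings\<close>


text \<open>Matched points of two tuples carry different labels; a map of labels that keeps the
  first component transports selections and groupings between them.\<close>

definition relabel :: "(label \<Rightarrow> label) \<Rightarrow> selection \<Rightarrow> selection" where
  "relabel f s = (\<lambda>i. map_option f (s i))"

lemma relabel_selection:
  assumes s: "is_selection N A s" and f: "\<And>l. l \<in> A \<Longrightarrow> f l \<in> B" "\<And>l. l \<in> A \<Longrightarrow> fst (f l) = fst l"
  shows "is_selection N B (relabel f s)" "ran (relabel f s) = f ` ran s"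
    "relabel f s = Map.empty \<longleftrightarrow> s = Map.empty"
proof -
  show "is_selection N B (relabel f s)"
    unfolding is_selection_def
  proof (intro allI impI)
    fix i l assume "relabel f s i = Some l"
    then obtain a where a: "s i = Some a" "l = f a" by (auto simp: relabel_def)
    show "i < N \<and> l \<in> B \<and> fst l = i"
      using is_selectionD[OF s a(1)] a(2) f by simp
  qed
  show "ran (relabel f s) = f ` ran s"
    unfolding relabel_def by (rule ran_map_option)
  show "relabel f s = Map.empty \<longleftrightarrow> s = Map.empty"
    by (simp add: relabel_def fun_eq_iff)
qed

context
  fixes N :: nat and A B :: "label set" and f and q q' :: "label \<Rightarrow> point"
  assumes f: "bij_betw f A B" and fst_f: "\<And>l. l \<in> A \<Longrightarrow> fst (f l) = fst l"
    and q: "\<And>l. l \<in> A \<Longrightarrow> q' (f l) = q l"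
begin

lemma relabel_mem: "l \<in> A \<Longrightarrow> f l \<in> B"
  using f by (auto simp: bij_betw_def)

lemma selection_cost_relabel:
  assumes "is_selection N A s"
  shows "selection_cost N q' (relabel f s) = selection_cost N q s"
proof
  fix p
  show "selection_cost N q' (relabel f s) p = selection_cost N q s p"
    unfolding selection_cost_def
  proof (intro sum.cong refl)
    fix i
    show "(case relabel f s i of None \<Rightarrow> (infdist p diagonal)\<^sup>2 | Some l \<Rightarrow> (norm (p - q' l))\<^sup>2)
      = (case s i of None \<Rightarrow> (infdist p diagonal)\<^sup>2 | Some l \<Rightarrow> (norm (p - q l))\<^sup>2)"
      using q[OF is_selectionD(2)[OF assms]] by (cases "s i") (simp_all add: relabel_def)
  qed
qed

lemma inj_on_relabel: "inj_on (relabel f) {s. is_selection N A s}"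
proof (rule inj_onI)
  fix s t assume st: "s \<in> {s. is_selection N A s}" "t \<in> {s. is_selection N A s}" "relabel f s = relabel f t"
  then have s: "is_selection N A s" "is_selection N A t" by auto
  have "f ` ran s = f ` ran t"
    using relabel_selection(2)[OF s(1) relabel_mem fst_f] relabel_selection(2)[OF s(2) relabel_mem fst_f] st(3) by simp
  then have "ran s = ran t"
    using inj_on_image_eq_iff[OF bij_betw_imp_inj_on[OF f]] selection_ran(2)[OF s(1)] selection_ran(2)[OF s(2)]
    by blast
  then show "s = t" by (rule selection_eqI[OF s])
qed

lemma is_grouping_relabel:
  assumes G: "is_grouping N A G"
  shows "is_grouping N B (relabel f ` G)"
  unfolding is_grouping_def
proof (intro conjI ballI)
  fix s assume "s \<in> relabel f ` G"
  then obtain t where t: "t \<in> G" "s = relabel f t" by blast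
  note r = relabel_selection[OF is_groupingD(1)[OF G t(1)] relabel_mem fst_f]
  show "is_selection N B s" unfolding t(2) by (rule r)
  show "s \<noteq> Map.empty" using r(3) is_groupingD(2)[OF G t(1)] t(2) by simp
next
  fix l' assume "l' \<in> B"
  then obtain l where l: "l \<in> A" "l' = f l" using f by (auto simp: bij_betw_def)
  then obtain t where t: "t \<in> G" "l \<in> ran t" using G unfolding is_grouping_def by blast
  have r: "ran (relabel f u) = f ` ran u" if "u \<in> G" for u
    by (rule relabel_selection(2)[OF is_groupingD(1)[OF G that] relabel_mem fst_f])
  show "\<exists>!s. s \<in> relabel f ` G \<and> l' \<in> ran s"
  proof (rule ex1I)
    show "relabel f t \<in> relabel f ` G \<and> l' \<in> ran (relabel f t)"
      using t l r[OF t(1)] by simp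
    fix s assume "s \<in> relabel f ` G \<and> l' \<in> ran s"
    then obtain u where u: "u \<in> G" "s = relabel f u" "l' \<in> f ` ran u" using r by auto
    then obtain l2 where l2: "l2 \<in> ran u" "f l2 = f l" using l(2) by auto
    then have "l2 = l"
      using inj_onD[OF bij_betw_imp_inj_on[OF f] l2(2)] l(1)
        selection_ran(2)[OF is_groupingD(1)[OF G u(1)]] by auto
    then show "s = relabel f t" using grouping_unique[OF G u(1) t(1) _ t(2)] l2 u(2) by simp
  qed
qed

lemma mean_diagram_relabel:
  assumes G: "is_grouping N A G"
  shows "mean_diagram N q' (relabel f ` G) = mean_diagram N q G"
  unfolding mean_diagram_def
proof (rule diagram_of_reindex[symmetric])
  have "inj_on (relabel f) G"
    by (rule inj_on_subset[OF inj_on_relabel]) (use is_groupingD(1)[OF G] in auto)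
  then show "bij_betw (relabel f) G (relabel f ` G)" by (rule inj_on_imp_bij_betw)
  show "mean N q' (relabel f s) = mean N q s" if "s \<in> G" for s
    unfolding mean_def selection_cost_relabel[OF is_groupingD(1)[OF G that]] ..
qed

lemma diagrams_of_relabel: "diagrams_of B q' i = diagrams_of A q i"
proof (rule diagram_of_reindex[symmetric])
  show "bij_betw f {l \<in> A. fst l = i} {l \<in> B. fst l = i}"
    using f fst_f by (auto simp: bij_betw_def inj_on_def)
  show "q' (f l) = q l" if "l \<in> {l \<in> A. fst l = i}" for l
    using that q by simp
qed

lemma optimal_grouping_relabel:
  assumes "optimal_grouping N A q G"
  shows "optimal_grouping N B q' (relabel f ` G)"
proof -
  have G: "is_grouping N A G" using assms by (simp add: optimal_grouping_def)
  show ?thesis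
    using assms unfolding optimal_grouping_def
    by (simp add: is_grouping_relabel[OF G] mean_diagram_relabel[OF G] diagrams_of_relabel)
qed

end

lemma unique_optimal_grouping_relabel:
  assumes f: "bij_betw f A B" and fst_f: "\<And>l. l \<in> A \<Longrightarrow> fst (f l) = fst l"
    and q: "\<And>l. l \<in> A \<Longrightarrow> q' (f l) = q l"
    and G0: "\<And>G. optimal_grouping N A q G \<longleftrightarrow> G = G0"
  shows "optimal_grouping N B q' G \<longleftrightarrow> G = relabel f ` G0"
proof
  assume "G = relabel f ` G0"
  then show "optimal_grouping N B q' G"
    using optimal_grouping_relabel[where q = q and q' = q', OF f fst_f q] G0 by simp
next
  \<comment> \<open>Relabelling back by the inverse carries any optimal grouping of \<open>B\<close>
    to an optimal one of \<open>A\<close>, hence to \<open>G0\<close>.\<close>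
  define g where "g = inv_into A f"
  have g: "bij_betw g B A" using f by (simp add: g_def bij_betw_inv_into)
  have fg: "f (g l) = l" if "l \<in> B" for l
    using f that by (simp add: g_def bij_betw_inv_into_right)
  have gA: "g l \<in> A" if "l \<in> B" for l using g that by (auto simp: bij_betw_def)
  assume opt: "optimal_grouping N B q' G"
  then have G: "is_grouping N B G" by (simp add: optimal_grouping_def)
  have "optimal_grouping N A q (relabel g ` G)"
  proof (rule optimal_grouping_relabel[OF g _ _ opt])
    show "fst (g l) = fst l" if "l \<in> B" for l using fst_f[OF gA[OF that]] fg[OF that] by simp
    show "q (g l) = q' l" if "l \<in> B" for l using q[OF gA[OF that]] fg[OF that] by simp
  qed
  then have "relabel g ` G = G0" using G0[of "relabel g ` G"] by simp
  moreover have "relabel f (relabel g s) = s" if "s \<in> G" for s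
  proof
    fix i
    show "relabel f (relabel g s) i = s i"
      using fg[OF is_selectionD(2)[OF is_groupingD(1)[OF G that]]]
      by (cases "s i") (simp_all add: relabel_def)
  qed
  ultimately show "G = relabel f ` G0" by (auto simp: image_image)
qed

text \<open>Trades \<open>THE\<close> and unique existence for a witness \<open>G0\<close>, the form
  in which outcomes can be transported and measured.\<close>

lemma grouping_of_outcome_eq_Some_iff:
  fixes \<omega> :: "label \<Rightarrow> point option"
  shows "grouping_of_outcome N A \<omega> = Some H \<longleftrightarrow>
    (\<forall>l\<in>{l \<in> A. \<omega> l \<noteq> None}. 0 < pers (the (\<omega> l))) \<and>
    (\<exists>G0. (\<forall>G. optimal_grouping N {l \<in> A. \<omega> l \<noteq> None} (\<lambda>l. the (\<omega> l)) G \<longleftrightarrow> G = G0) \<and>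
      H = G0 \<union> trivial_selection ` (A - {l \<in> A. \<omega> l \<noteq> None}))"
    (is "?L \<longleftrightarrow> ?P \<and> ?R")
proof -
  define q where "q = (\<lambda>l. the (\<omega> l))"
  define A' where "A' = {l \<in> A. \<omega> l \<noteq> None}"
  note defs = q_def[symmetric] A'_def[symmetric]
  have P: "(\<forall>l\<in>A'. fst (q l) < snd (q l)) \<longleftrightarrow> ?P" by (simp add: pers_def q_def A'_def)
  have eq: "grouping_of_outcome N A \<omega> = (if ?P \<and> (\<exists>!G. optimal_grouping N A' q G)
      then Some ((THE G. optimal_grouping N A' q G) \<union> trivial_selection ` (A - A')) else None)"
    by (simp only: grouping_of_outcome_def Let_def P[symmetric] q_def A'_def)
  have the_eq: "(THE G. optimal_grouping N A' q G) = G0" "\<exists>!G. optimal_grouping N A' q G"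
    if "\<forall>G. optimal_grouping N A' q G \<longleftrightarrow> G = G0" for G0
    using that by (auto intro!: the_equality)
  show ?thesis
  proof
    assume ?L
    then have *: "?P" "\<exists>!G. optimal_grouping N A' q G"
      "H = (THE G. optimal_grouping N A' q G) \<union> trivial_selection ` (A - A')"
      unfolding eq by (simp_all split: if_splits)
    from *(2) obtain G0 where "\<forall>G. optimal_grouping N A' q G \<longleftrightarrow> G = G0" by metis
    then have ?R using *(3) the_eq[of G0] unfolding q_def A'_def by auto
    then show "?P \<and> ?R" using *(1) by simp
  next
    assume *: "?P \<and> ?R"
    then obtain G0 where G0: "\<forall>G. optimal_grouping N A' q G \<longleftrightarrow> G = G0"
      "H = G0 \<union> trivial_selection ` (A - A')" unfolding q_def A'_def by blast
    show ?L unfolding eq G0(2) the_eq(1)[OF G0(1)]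
      by (rule if_P[OF conjI[OF conjunct1[OF *] the_eq(2)[OF G0(1)]]])
  qed
qed

text \<open>The surviving labels of \<open>L\<close> are the images of the survivors of
  \<open>J\<close>, so the optimal grouping is merely renamed. Vanished labels give trivial
  selections, whether they come from \<open>J\<close> or not.\<close>

lemma grouping_of_outcome_relabel:
  assumes f: "inj_on f J" "f ` J \<subseteq> L" "\<And>l. l \<in> J \<Longrightarrow> fst (f l) = fst l"
    and \<omega>: "\<And>l. l \<in> J \<Longrightarrow> \<omega>' l = \<omega> (f l)" "\<And>l. l \<in> L - f ` J \<Longrightarrow> \<omega> l = None"
    and g: "grouping_of_outcome N J \<omega>' = Some g"
  shows "grouping_of_outcome N L \<omega> = Some (relabel f ` g \<union> trivial_selection ` (L - f ` J))"
proof -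
  define J' where "J' = {l \<in> J. \<omega>' l \<noteq> None}"
  define L' where "L' = {l \<in> L. \<omega> l \<noteq> None}"
  have L': "L' = f ` J'"
  proof (intro set_eqI iffI)
    fix l assume l: "l \<in> L'"
    then have "l \<in> f ` J" using \<omega>(2)[of l] by (cases "l \<in> f ` J") (simp_all add: L'_def)
    then obtain j where "j \<in> J" "l = f j" by blast
    then show "l \<in> f ` J'" using l \<omega>(1)[of j] by (simp add: L'_def J'_def)
  next
    fix l assume "l \<in> f ` J'"
    then obtain j where "j \<in> J" "l = f j" "\<omega>' j \<noteq> None" unfolding J'_def by blast
    then show "l \<in> L'" using \<omega>(1)[of j] f(2) by (auto simp: L'_def)
  qed
  obtain G0 where above: "\<forall>l\<in>J'. 0 < pers (the (\<omega>' l))"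
    and G0: "\<And>G. optimal_grouping N J' (\<lambda>l. the (\<omega>' l)) G \<longleftrightarrow> G = G0"
    and gG0: "g = G0 \<union> trivial_selection ` (J - J')"
    using g unfolding grouping_of_outcome_eq_Some_iff J'_def by auto
  have bij: "bij_betw f J' L'"
    unfolding L' by (rule inj_on_imp_bij_betw) (rule inj_on_subset[OF f(1)], simp add: J'_def)
  have J'J: "l \<in> J" if "l \<in> J'" for l using that by (simp add: J'_def)
  have opt: "optimal_grouping N L' (\<lambda>l. the (\<omega> l)) G \<longleftrightarrow> G = relabel f ` G0" for G
    using unique_optimal_grouping_relabel[where q = "\<lambda>l. the (\<omega>' l)" and q' = "\<lambda>l. the (\<omega> l)", OF bij f(3)[OF J'J] _ G0]
      \<omega>(1)[OF J'J] by simp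
  have triv: "relabel f (trivial_selection l) = trivial_selection (f l)" if "l \<in> J" for l
    using f(3)[OF that] by (auto simp: relabel_def trivial_selection_def)
  have "L - L' = f ` (J - J') \<union> (L - f ` J)"
    using f(2) L' inj_on_image_set_diff[OF f(1), of J J'] by (auto simp: J'_def)
  then have "relabel f ` g \<union> trivial_selection ` (L - f ` J) = relabel f ` G0 \<union> trivial_selection ` (L - L')"
    using triv by (auto simp: gG0 image_Un image_image)
  then show ?thesis
    unfolding grouping_of_outcome_eq_Some_iff L'_def[symmetric]
    using opt above \<omega>(1)[OF J'J] L' by auto
qed

lemma is_grouping_of_outcome:
  assumes "grouping_of_outcome N A \<omega> = Some G" "\<And>l. l \<in> A \<Longrightarrow> fst l < N"
  shows "is_grouping N A G"
proof -
  define A' where "A' = {l \<in> A. \<omega> l \<noteq> None}"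
  obtain G0 where "\<forall>G. optimal_grouping N A' (\<lambda>l. the (\<omega> l)) G \<longleftrightarrow> G = G0"
    "G = G0 \<union> trivial_selection ` (A - A')"
    using assms(1) unfolding grouping_of_outcome_eq_Some_iff A'_def[symmetric] by auto
  then have "is_grouping N A' G0" "G = G0 \<union> trivial_selection ` (A - A')"
    by (auto simp: optimal_grouping_def)
  then show ?thesis using is_grouping_Un_trivial[of N A' G0 A] assms(2) by (simp add: A'_def)
qed

lemma grouping_of_outcome_generic:
  assumes "finite A" "\<And>l. l \<in> A \<Longrightarrow> fst l < N" "N > 0"
    and "\<And>l. l \<in> A \<Longrightarrow> \<omega> l \<noteq> None \<Longrightarrow> 0 < pers (the (\<omega> l))"
    and "generic N {l \<in> A. \<omega> l \<noteq> None} (\<lambda>l. the (\<omega> l))"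
  shows "grouping_of_outcome N A \<omega> \<noteq> None"
proof -
  let ?A' = "{l \<in> A. \<omega> l \<noteq> None}"
  have "\<exists>!G. optimal_grouping N ?A' (\<lambda>l. the (\<omega> l)) G"
    by (rule unique_optimal_grouping[OF _ _ _ assms(3,5)]) (use assms in auto)
  then obtain G0 where "\<forall>G. optimal_grouping N ?A' (\<lambda>l. the (\<omega> l)) G \<longleftrightarrow> G = G0"
    unfolding Ex1_def by blast
  then have "grouping_of_outcome N A \<omega> = Some (G0 \<union> trivial_selection ` (A - ?A'))"
    unfolding grouping_of_outcome_eq_Some_iff using assms(4) by auto
  then show ?thesis by simp
qed

text \<open>Only the selection containing \<open>l\<close> feels the move. The first increment
  depends on \<open>d\<close>, \<open>N\<close> and \<open>q l\<close> alone and is common to all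
  groupings; the second is linear in \<open>d\<close>, with a slope given by the companions of
  \<open>l\<close>.\<close>

lemma grouping_cost_shift:
  assumes G: "is_grouping N A G" "finite A" and s: "s \<in> G" "l \<in> ran s"
    and q': "csum (q' l) = csum (q l)" "pers (q' l) = pers (q l) + d" "\<And>k. k \<noteq> l \<Longrightarrow> q' k = q k"
  shows "grouping_cost N q' G = grouping_cost N q G
    + ((2 * d * pers (q l) + d\<^sup>2) * (1 - 1 / N) / 2) - d * (\<Sum>k\<in>ran s - {l}. pers (q k)) / N"
proof -
  note finG = finite_groupings(2)[OF G(2,1)]
  note fin = selection_ran(1)[OF is_groupingD(1)[OF G(1) s(1)]]
  have other: "min_cost N q' t = min_cost N q t" if "t \<in> G - {s}" for t
  proof -
    have "l \<notin> ran t" using grouping_unique[OF G(1) s(1) _ s(2)] that by blast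
    then have "q' k = q k" if "k \<in> ran t" for k using q'(3) that by metis
    then show ?thesis by (simp add: min_cost_def)
  qed
  have split: "(\<Sum>k\<in>ran s. h k) = h l + (\<Sum>k\<in>ran s - {l}. h k)" for h :: "label \<Rightarrow> real"
    using fin s(2) by (rule sum.remove)
  have same: "(\<Sum>k\<in>ran s - {l}. h (q' k)) = (\<Sum>k\<in>ran s - {l}. h (q k))" for h :: "point \<Rightarrow> real"
    using q'(3) by (intro sum.cong) auto
  \<comment> \<open>The square of the persistence sum contributes the factor
    \<open>1 - 1 / N\<close> and the mixed term with the companions; \<open>N = 0\<close> fits
    because division by 0 gives 0.\<close>
  have "min_cost N q' s = min_cost N q s + ((2 * d * pers (q l) + d\<^sup>2) * (1 - 1 / N) / 2)
      - d * (\<Sum>k\<in>ran s - {l}. pers (q k)) / N"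
    unfolding min_cost_def split
      same[of csum] same[of pers] same[of "\<lambda>p. (csum p)\<^sup>2 + (pers p)\<^sup>2"] q'(1,2)
    by (cases "N = 0") (simp_all add: power2_eq_square field_simps)
  moreover have "grouping_cost N r G = min_cost N r s + (\<Sum>t\<in>G - {s}. min_cost N r t)" for r
    unfolding grouping_cost_def using finG s(1) by (rule sum.remove)
  ultimately show ?thesis using other by simp
qed

subsection \<open>Measurability and null sets\<close>


lemma space_perturb [simp]: "space (perturb \<alpha> x) = UNIV"
  by (simp add: perturb_def Let_def space_measure_of_conv)

lemma borel_measurable_csum [measurable]: "csum \<in> borel_measurable borel"
  and borel_measurable_pers [measurable]: "pers \<in> borel_measurable borel"
  unfolding csum_def[abs_def] pers_def[abs_def]
  by (intro borel_measurable_continuous_onI continuous_intros)+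

lemma measurable_the_perturb: "the \<in> borel_measurable (perturb \<alpha> x)"
proof (rule measurableI)
  fix B :: "point set" assume "B \<in> sets borel"
  moreover have "Some -` (the -` B) = B" by auto
  ultimately show "the -` B \<inter> space (perturb \<alpha> x) \<in> sets (perturb \<alpha> x)"
    by (simp add: sets_perturb)
qed simp

text \<open>The centres are separated from the labels: later the labels \<open>J\<close> carry both
  the points of one tuple and their partners in the other.\<close>

definition perturbations :: "real \<Rightarrow> label set \<Rightarrow> (label \<Rightarrow> point) \<Rightarrow> (label \<Rightarrow> point option) measure" where
  "perturbations \<alpha> A x = (\<Pi>\<^sub>M l\<in>A. perturb \<alpha> (x l))"

lemma space_perturbations: "space (perturbations \<alpha> A x) = A \<rightarrow>\<^sub>E UNIV"
  by (simp add: perturbations_def space_PiM)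

lemma measurable_coordinate:
  "l \<in> A \<Longrightarrow> (\<lambda>\<omega>. \<omega> l) \<in> perturbations \<alpha> A x \<rightarrow>\<^sub>M perturb \<alpha> (x l)"
  unfolding perturbations_def by (rule measurable_component_singleton)

lemma measurable_perturbed_point:
  assumes "l \<in> A"
  shows "(\<lambda>\<omega>. csum (the (\<omega> l))) \<in> borel_measurable (perturbations \<alpha> A x)"
    and "(\<lambda>\<omega>. pers (the (\<omega> l))) \<in> borel_measurable (perturbations \<alpha> A x)"
proof -
  have *: "(\<lambda>\<omega>. the (\<omega> l)) \<in> borel_measurable (perturbations \<alpha> A x)"
    using measurable_coordinate[OF assms] measurable_the_perturb by (rule measurable_compose)
  show "(\<lambda>\<omega>. csum (the (\<omega> l))) \<in> borel_measurable (perturbations \<alpha> A x)"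
    by (rule measurable_compose[OF * borel_measurable_csum])
  show "(\<lambda>\<omega>. pers (the (\<omega> l))) \<in> borel_measurable (perturbations \<alpha> A x)"
    by (rule measurable_compose[OF * borel_measurable_pers])
qed

lemma pred_None:
  assumes "l \<in> A"
  shows "Measurable.pred (perturbations \<alpha> A x) (\<lambda>\<omega>. \<omega> l = None)"
proof (rule measurable_compose[OF measurable_coordinate[OF assms], where g = "\<lambda>y. y = None"])
  show "Measurable.pred (perturb \<alpha> (x l)) (\<lambda>y. y = None)"
  proof -
    have "Some -` {None :: point option} = {}" by auto
    then show ?thesis unfolding pred_def by (simp add: sets_perturb)
  qed
qed

lemma measurable_min_cost:
  assumes "is_selection N A0 t" "A0 \<subseteq> A"
  shows "(\<lambda>\<omega>. min_cost N (\<lambda>l. the (\<omega> l)) t) \<in> borel_measurable (perturbations \<alpha> A x)"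
proof -
  have m: "(\<lambda>\<omega>. csum (the (\<omega> l))) \<in> borel_measurable (perturbations \<alpha> A x)"
    "(\<lambda>\<omega>. pers (the (\<omega> l))) \<in> borel_measurable (perturbations \<alpha> A x)" if "l \<in> ran t" for l
  proof -
    have "l \<in> A" using selection_ran(2)[OF assms(1)] assms(2) that by blast
    then show "(\<lambda>\<omega>. csum (the (\<omega> l))) \<in> borel_measurable (perturbations \<alpha> A x)"
      "(\<lambda>\<omega>. pers (the (\<omega> l))) \<in> borel_measurable (perturbations \<alpha> A x)"
      by (rule measurable_perturbed_point)+
  qed
  show ?thesis
    unfolding min_cost_def
    by (intro borel_measurable_divide borel_measurable_diff borel_measurable_sum borel_measurable_power
        borel_measurable_add borel_measurable_const m)
qed

lemma measurable_grouping_cost: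
  assumes "is_grouping N A0 G" "A0 \<subseteq> A"
  shows "(\<lambda>\<omega>. grouping_cost N (\<lambda>l. the (\<omega> l)) G) \<in> borel_measurable (perturbations \<alpha> A x)"
  unfolding grouping_cost_def
  by (intro borel_measurable_sum measurable_min_cost[OF is_groupingD(1)[OF assms(1)] assms(2)])

lemma measurable_partial_cost:
  assumes G: "is_grouping N A0 G" and B: "B \<subseteq> A" and A0: "A0 \<subseteq> A" and R: "R \<in> partial_matchings G B"
  shows "(\<lambda>\<omega>. partial_cost (mean N (\<lambda>l. the (\<omega> l))) G (\<lambda>l. the (\<omega> l)) B R)
    \<in> borel_measurable (perturbations \<alpha> A x)"
proof -
  let ?M = "perturbations \<alpha> A x"
  have RB: "R \<subseteq> G \<times> B" using R by (simp add: partial_matchings_def)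
  have m: "(\<lambda>\<omega>. csum (the (\<omega> l))) \<in> borel_measurable ?M"
    "(\<lambda>\<omega>. pers (the (\<omega> l))) \<in> borel_measurable ?M" if "l \<in> A" for l
    by (rule measurable_perturbed_point[OF that])+
  have mean: "(\<lambda>\<omega>. csum (mean N (\<lambda>l. the (\<omega> l)) t)) \<in> borel_measurable ?M"
    "(\<lambda>\<omega>. pers (mean N (\<lambda>l. the (\<omega> l)) t)) \<in> borel_measurable ?M" if "t \<in> G" for t
  proof -
    have "l \<in> A" if "l \<in> ran t" for l
      using selection_ran(2)[OF is_groupingD(1)[OF G \<open>t \<in> G\<close>]] A0 that by blast
    then show "(\<lambda>\<omega>. csum (mean N (\<lambda>l. the (\<omega> l)) t)) \<in> borel_measurable ?M"
      "(\<lambda>\<omega>. pers (mean N (\<lambda>l. the (\<omega> l)) t)) \<in> borel_measurable ?M"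
      unfolding mean_coords[OF is_groupingD[OF G that]]
      by (intro borel_measurable_divide borel_measurable_sum borel_measurable_const m; simp)+
  qed
  have 1: "(\<lambda>\<omega>. \<Sum>r\<in>R. (norm (mean N (\<lambda>l. the (\<omega> l)) (fst r) - the (\<omega> (snd r))))\<^sup>2) \<in> borel_measurable ?M"
    unfolding norm_diff_power2
  proof (intro borel_measurable_sum borel_measurable_divide borel_measurable_add borel_measurable_power
      borel_measurable_diff borel_measurable_const)
    fix r assume "r \<in> R"
    then have r: "fst r \<in> G" "snd r \<in> A" using subsetD[OF RB, of r] B by (auto simp: mem_Times_iff)
    show "(\<lambda>\<omega>. csum (mean N (\<lambda>l. the (\<omega> l)) (fst r))) \<in> borel_measurable ?M"
      "(\<lambda>\<omega>. pers (mean N (\<lambda>l. the (\<omega> l)) (fst r))) \<in> borel_measurable ?M" by (rule mean[OF r(1)])+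
    show "(\<lambda>\<omega>. csum (the (\<omega> (snd r)))) \<in> borel_measurable ?M"
      "(\<lambda>\<omega>. pers (the (\<omega> (snd r)))) \<in> borel_measurable ?M" by (rule m[OF r(2)])+
  qed
  have 2: "(\<lambda>\<omega>. \<Sum>a\<in>G - fst ` R. (pers (mean N (\<lambda>l. the (\<omega> l)) a))\<^sup>2 / 2) \<in> borel_measurable ?M"
    by (intro borel_measurable_sum borel_measurable_divide borel_measurable_power
        borel_measurable_const mean) simp
  have 3: "(\<lambda>\<omega>. \<Sum>b\<in>B - snd ` R. (pers (the (\<omega> b)))\<^sup>2 / 2) \<in> borel_measurable ?M"
    by (intro borel_measurable_sum borel_measurable_divide borel_measurable_power
        borel_measurable_const m) (use B in auto)
  show ?thesis
    unfolding partial_cost_def case_prod_beta by (intro borel_measurable_add 1 2 3)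
qed

text \<open>An explicit finite expression in the locations, hence measurable on the whole space of
  outcomes; it equals the Frechet value where all points lie above the diagonal.\<close>

definition frechet_formula :: "nat \<Rightarrow> label set \<Rightarrow> (label \<Rightarrow> point) \<Rightarrow> selection set \<Rightarrow> ennreal" where
  "frechet_formula N A q G = (\<Sum>i<N. INF R\<in>partial_matchings G {l \<in> A. fst l = i}.
     ennreal (partial_cost (mean N q) G q {l \<in> A. fst l = i} R))"

lemma frechet_eq_formula:
  assumes "finite A" "\<And>l. l \<in> A \<Longrightarrow> 0 < pers (q l)" "is_grouping N A G"
  shows "frechet N (diagrams_of A q) (mean_diagram N q G) = frechet_formula N A q G"
  unfolding frechet_def frechet_formula_def mean_diagram_def
proof (intro sum.cong refl)
  fix i
  show "(W2 (diagram_of (mean N q) G) (diagrams_of A q i))\<^sup>2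
    = (INF R\<in>partial_matchings G {l \<in> A. fst l = i}.
        ennreal (partial_cost (mean N q) G q {l \<in> A. fst l = i} R))"
    by (rule W2_labelled) (use assms finite_groupings(2)[OF assms(1,3)]
        pers_mean_pos[where q = q, OF is_groupingD[OF assms(3)] assms(2)] in auto)
qed

lemma measurable_frechet_formula:
  assumes G: "is_grouping N A0 G" and A0: "A0 \<subseteq> A" "finite A"
  shows "(\<lambda>\<omega>. frechet_formula N A0 (\<lambda>l. the (\<omega> l)) G) \<in> borel_measurable (perturbations \<alpha> A x)"
  unfolding frechet_formula_def
proof (intro borel_measurable_sum borel_measurable_INF measurable_compose[OF _ measurable_ennreal]
    measurable_partial_cost[OF G _ A0(1)])
  fix i
  have "finite A0" using A0 by (rule finite_subset)
  then show "countable (partial_matchings G {l \<in> A0. fst l = i})"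
    by (intro countable_finite finite_partial_matchings) (simp_all add: finite_groupings(2)[OF _ G])
qed (use A0 in auto)

text \<open>Once the set \<open>A0\<close> of survivors is fixed, all quantifiers range over finite
  sets independent of the outcome, so the event is a finite combination of measurable
  conditions.\<close>

lemma grouping_of_outcome_formula:
  assumes A: "finite A" "\<And>l. l \<in> A \<Longrightarrow> fst l < N" "N > 0"
  shows "grouping_of_outcome N A \<omega> = Some H \<longleftrightarrow> (\<exists>A0\<in>Pow A.
    (\<forall>l\<in>A. \<omega> l = None \<longleftrightarrow> l \<notin> A0) \<and> (\<forall>l\<in>A0. 0 < pers (the (\<omega> l))) \<and>
    (\<exists>G0\<in>{G. is_grouping N A0 G}. H = G0 \<union> trivial_selection ` (A - A0) \<and>
      (\<forall>G\<in>{G. is_grouping N A0 G}. (\<forall>G'\<in>{G. is_grouping N A0 G}.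
        frechet_formula N A0 (\<lambda>l. the (\<omega> l)) G \<le> ennreal (grouping_cost N (\<lambda>l. the (\<omega> l)) G'))
        \<longleftrightarrow> G = G0)))" (is "_ \<longleftrightarrow> (\<exists>A0\<in>Pow A. ?N A0 \<and> ?P A0 \<and> ?Q A0)")
proof -
  define A' where "A' = {l \<in> A. \<omega> l \<noteq> None}"
  have A': "?N A0 \<longleftrightarrow> A0 = A'" if "A0 \<in> Pow A" for A0
    using that by (auto simp: A'_def simp del: not_None_eq)
  have sub: "A' \<in> Pow A" by (auto simp: A'_def)
  have fin: "finite A'" using A(1) by (simp add: A'_def)
  have idx: "\<And>l. l \<in> A' \<Longrightarrow> fst l < N" using A(2) by (simp add: A'_def)
  have "(\<exists>G0. (\<forall>G. optimal_grouping N A' (\<lambda>l. the (\<omega> l)) G \<longleftrightarrow> G = G0) \<and>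
      H = G0 \<union> trivial_selection ` (A - A')) \<longleftrightarrow> ?Q A'" if above: "?P A'"
  proof -
    have opt: "optimal_grouping N A' (\<lambda>l. the (\<omega> l)) G \<longleftrightarrow> is_grouping N A' G \<and>
      (\<forall>G'\<in>{G. is_grouping N A' G}.
        frechet_formula N A' (\<lambda>l. the (\<omega> l)) G \<le> ennreal (grouping_cost N (\<lambda>l. the (\<omega> l)) G'))" for G
    proof -
      have "optimal_grouping N A' (\<lambda>l. the (\<omega> l)) G \<longleftrightarrow> is_grouping N A' G \<and> (\<forall>G'. is_grouping N A' G' \<longrightarrow>
        frechet N (diagrams_of A' (\<lambda>l. the (\<omega> l))) (mean_diagram N (\<lambda>l. the (\<omega> l)) G)
          \<le> ennreal (grouping_cost N (\<lambda>l. the (\<omega> l)) G'))"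
        by (rule optimal_grouping_iff[OF fin _ idx A(3)]) (use above in auto)
      then show ?thesis
        using frechet_eq_formula[where q = "\<lambda>l. the (\<omega> l)" and G = G and N = N, OF fin] above by auto
    qed
    show ?thesis unfolding opt by blast
  qed
  then have "grouping_of_outcome N A \<omega> = Some H \<longleftrightarrow> ?P A' \<and> ?Q A'"
    unfolding grouping_of_outcome_eq_Some_iff A'_def[symmetric] by (rule conj_cong[OF refl])
  also have "\<dots> \<longleftrightarrow> (\<exists>A0\<in>Pow A. ?N A0 \<and> ?P A0 \<and> ?Q A0)"
  proof
    assume "?P A' \<and> ?Q A'"
    then show "\<exists>A0\<in>Pow A. ?N A0 \<and> ?P A0 \<and> ?Q A0"
      using A'[OF sub] by (intro bexI[OF _ sub]) simp
  next
    assume "\<exists>A0\<in>Pow A. ?N A0 \<and> ?P A0 \<and> ?Q A0"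
    then obtain A0 where "A0 \<in> Pow A" and conj: "?N A0 \<and> ?P A0 \<and> ?Q A0" by (rule bexE)
    then have "A0 = A'" using A'[of A0] by simp
    from conj[THEN conjunct2, unfolded this] show "?P A' \<and> ?Q A'" .
  qed
  finally show ?thesis .
qed

lemma pred_grouping_of_outcome:
  assumes A: "finite A" "\<And>l. l \<in> A \<Longrightarrow> fst l < N" "N > 0"
  shows "Measurable.pred (perturbations \<alpha> A x) (\<lambda>\<omega>. grouping_of_outcome N A \<omega> = Some H)"
proof (simp only: grouping_of_outcome_formula[OF A], intro pred_intros_finite(3,4) pred_intros_logic)
  show "finite (Pow A)" using A(1) by simp
  fix A0 assume "A0 \<in> Pow A"
  then have A0: "A0 \<subseteq> A" "finite A0" using A(1) by (auto intro: finite_subset)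
  show "finite A" "finite A0" "finite {G. is_grouping N A0 G}" "finite {G. is_grouping N A0 G}"
    "finite {G. is_grouping N A0 G}" 
    using A(1) A0 finite_groupings(1) by blast+
  show "Measurable.pred (perturbations \<alpha> A x) (\<lambda>\<omega>. \<omega> l = None)" if "l \<in> A" for l
    by (rule pred_None[OF that])
  show "Measurable.pred (perturbations \<alpha> A x) (\<lambda>\<omega>. 0 < pers (the (\<omega> l)))" if "l \<in> A0" for l
    using measurable_perturbed_point(2)[of l A \<alpha> x] that A0 unfolding pred_def
    by (intro borel_measurable_less borel_measurable_const) auto
  show "Measurable.pred (perturbations \<alpha> A x)
      (\<lambda>\<omega>. frechet_formula N A0 (\<lambda>l. the (\<omega> l)) G \<le> ennreal (grouping_cost N (\<lambda>l. the (\<omega> l)) G'))"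
    if "G \<in> {G. is_grouping N A0 G}" "G' \<in> {G. is_grouping N A0 G}" for G G'
    unfolding pred_def
    by (intro borel_measurable_le measurable_frechet_formula[OF _ A0(1) A(1)]
        measurable_compose[OF measurable_grouping_cost[OF _ A0(1)] measurable_ennreal]) (use that in auto)
qed simp_all

text \<open>Distinct translates of \<open>S\<close> in the direction \<open>(- 1, 1)\<close> are
  disjoint. Infinitely many translates of a bounded piece, all of the same measure, fit into one
  ball of finite measure, so the piece is null.\<close>

lemma plane_null:
  assumes S: "S \<in> sets (borel :: point measure)"
    and line: "\<And>p t. p \<in> S \<Longrightarrow> t \<noteq> 0 \<Longrightarrow> p + t *\<^sub>R (- 1, 1) \<notin> S"
  shows "emeasure lborel S = 0"
proof -
  let ?v = "(- 1, 1) :: point"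
  have null: "emeasure lborel (S \<inter> ball 0 r) = 0" for r
  proof -
    define T where "T = S \<inter> ball 0 r"
    \<comment> \<open>Distinct shifts of bounded length keep all translates inside one ball.\<close>
    define a where "a n = (1 / real (Suc n)) *\<^sub>R ?v" for n
    define U where "U n = (+) (a n) -` T" for n
    have T[measurable]: "T \<in> sets borel" using S by (simp add: T_def)
    have U: "U n \<in> sets borel" for n
      unfolding U_def by (rule measurable_sets_borel[OF _ T]) simp
    have eU: "emeasure lborel (U n) = emeasure lborel T" for n
    proof -
      have "emeasure lborel T = emeasure (distr lborel borel ((+) (a n))) T"
        by (simp only: lborel_distr_plus)
      also have "\<dots> = emeasure lborel (U n)"
        unfolding U_def using T by (subst emeasure_distr) auto
      finally show ?thesis by simp
    qed
    have disj: "disjoint_family U"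
      unfolding disjoint_family_on_def
    proof (intro ballI impI)
      fix m n :: nat assume "m \<noteq> n"
      show "U m \<inter> U n = {}"
      proof (rule ccontr)
        assume "U m \<inter> U n \<noteq> {}"
        then obtain p where "p \<in> U m" "p \<in> U n" by blast
        then have p: "a m + p \<in> S" "a n + p \<in> S" by (simp_all add: U_def T_def)
        have "a n + p = (a m + p) + (1 / real (Suc n) - 1 / real (Suc m)) *\<^sub>R ?v"
          unfolding a_def by (simp add: algebra_simps)
        moreover have "1 / real (Suc n) - 1 / real (Suc m) \<noteq> 0" using \<open>m \<noteq> n\<close> by (simp del: of_nat_Suc)
        ultimately show False using line[OF p(1)] p(2) by metis
      qed
    qed
    have "U n \<subseteq> cball 0 (r + norm ?v)" for n
    proof
      fix p assume "p \<in> U n"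
      then have "norm (a n + p) < r" by (simp add: U_def T_def)
      moreover have "norm (a n) \<le> norm ?v"
        unfolding a_def norm_scaleR by (rule mult_left_le_one_le) auto
      ultimately show "p \<in> cball 0 (r + norm ?v)"
        using norm_triangle_ineq4[of "a n + p" "a n"] by simp
    qed
    then have "(\<Union>n. U n) \<subseteq> cball 0 (r + norm ?v)" by blast
    then have "emeasure lborel (\<Union>n. U n) \<le> emeasure lborel (cball 0 (r + norm ?v) :: point set)"
      by (rule emeasure_mono) simp
    also have "\<dots> < \<infinity>" by (rule emeasure_lborel_cball_finite)
    finally have fin: "emeasure lborel (\<Union>n. U n) < \<infinity>" .
    have le: "of_nat m * emeasure lborel T \<le> emeasure lborel (\<Union>n. U n)" for m
    proof -
      have "of_nat m * emeasure lborel T = (\<Sum>n<m. emeasure lborel (U n))" by (simp add: eU)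
      also have "\<dots> = emeasure lborel (\<Union>n\<in>{..<m}. U n)"
        by (rule sum_emeasure) (use U disj in \<open>auto simp: disjoint_family_on_def\<close>)
      also have "\<dots> \<le> emeasure lborel (\<Union>n. U n)"
        by (rule emeasure_mono) (use U in auto)
      finally show ?thesis .
    qed
    have "emeasure lborel T = 0"
    proof (rule ccontr)
      assume T0: "emeasure lborel T \<noteq> 0"
      obtain b where b: "emeasure lborel (\<Union>n. U n) = ennreal b" "0 \<le> b"
        using fin by (cases "emeasure lborel (\<Union>n. U n)") auto
      have "emeasure lborel T \<le> ennreal b" using le[of 1] b by simp
      then obtain c where c: "emeasure lborel T = ennreal c" "0 \<le> c"
        by (cases "emeasure lborel T") (auto simp: top_unique)
      then have "c > 0" using T0 by (cases "c = 0") auto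
      then obtain m where "b < real m * c" using reals_Archimedean3 by blast
      moreover have "ennreal (real m * c) \<le> ennreal b"
        using le[of m] b c by (simp add: ennreal_mult ennreal_of_nat_eq_real_of_nat)
      ultimately show False using b by (simp add: ennreal_le_iff)
    qed
    then show ?thesis by (simp add: T_def)
  qed
  have "S = (\<Union>n::nat. S \<inter> ball 0 (real n))"
    using reals_Archimedean2 by fastforce
  moreover have "emeasure lborel (\<Union>n::nat. S \<inter> ball 0 (real n)) = 0"
    by (rule emeasure_UN_eq_0) (use null S in auto)
  ultimately show ?thesis by simp
qed

lemma emeasure_perturb_le:
  assumes "S \<in> sets borel"
  shows "emeasure (perturb \<alpha> x) (Some ` S) \<le> ennreal (1 / (pi * \<alpha>\<^sup>2)) * emeasure lborel S"
proof -
  have v: "Some -` Some ` S = S" by auto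
  have "emeasure (perturb \<alpha> x) (Some ` S)
      = ennreal (1 / (pi * \<alpha>\<^sup>2)) * emeasure lborel (S \<inter> ball x (min \<alpha> (infdist x diagonal)))"
    using emeasure_perturb[of "Some ` S" "min \<alpha> (infdist x diagonal)" \<alpha> x, unfolded v] assms by (auto simp: v)
  also have "\<dots> \<le> ennreal (1 / (pi * \<alpha>\<^sup>2)) * emeasure lborel S"
    using assms by (intro mult_left_mono emeasure_mono) auto
  finally show ?thesis .
qed

lemma perturbations_product:
  assumes "\<alpha> > 0"
  shows "product_sigma_finite (\<lambda>l. perturb \<alpha> (x l))" "prob_space (perturbations \<alpha> A x)"
proof -
  show "product_sigma_finite (\<lambda>l. perturb \<alpha> (x l))"
    unfolding product_sigma_finite_def
    by (intro allI prob_space_imp_sigma_finite prob_space_perturb assms)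
  show "prob_space (perturbations \<alpha> A x)"
    unfolding perturbations_def by (intro prob_space_PiM prob_space_perturb assms)
qed

text \<open>Fubini in the coordinate \<open>l\<close>, along which the perturbed point moves across the diagonal.\<close>

lemma perturbations_null:
  assumes \<alpha>: "\<alpha> > 0" and A: "finite A" "l \<in> A" and S: "S \<in> sets (perturbations \<alpha> A x)"
    and line: "\<And>\<omega> p t. \<omega> l = Some p \<Longrightarrow> \<omega> \<in> S \<Longrightarrow> t \<noteq> 0 \<Longrightarrow> fun_upd \<omega> l (Some (p + t *\<^sub>R (- 1, 1))) \<notin> S"
    and None: "\<And>\<omega>. \<omega> \<in> S \<Longrightarrow> \<omega> l \<noteq> None"
  shows "emeasure (perturbations \<alpha> A x) S = 0"
proof -
  interpret product_sigma_finite "\<lambda>l. perturb \<alpha> (x l)" by (rule perturbations_product[OF \<alpha>])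
  define I where "I = A - {l}"
  have I: "finite I" "l \<notin> I" "insert l I = A" using A by (auto simp: I_def)
  let ?P = "\<lambda>I. \<Pi>\<^sub>M l\<in>I. perturb \<alpha> (x l)"
  have SA: "S \<in> sets (?P (insert l I))" using S I by (simp add: perturbations_def)
  have "emeasure (perturbations \<alpha> A x) S = (\<integral>\<^sup>+ \<omega>. indicator S \<omega> \<partial>?P (insert l I))"
    using SA I by (simp add: perturbations_def)
  also have "\<dots> = (\<integral>\<^sup>+ \<omega>. (\<integral>\<^sup>+ y. indicator S (fun_upd \<omega> l y) \<partial>perturb \<alpha> (x l)) \<partial>?P I)"
    using SA by (intro product_nn_integral_insert I) simp
  also have "\<dots> = (\<integral>\<^sup>+ \<omega>. 0 \<partial>?P I)"
  proof (rule nn_integral_cong)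
    fix \<omega> assume \<omega>: "\<omega> \<in> space (?P I)"
    define T where "T = (\<lambda>y. fun_upd \<omega> l y) -` S"
    have T: "T \<in> sets (perturb \<alpha> (x l))"
      using measurable_sets[OF measurable_fun_upd[where J = I and M = "\<lambda>l. perturb \<alpha> (x l)" and I = "insert l I" and i = l and f = "\<lambda>_. \<omega>" and h = "\<lambda>y. y" and N = "perturb \<alpha> (x l)"] SA] \<omega>
      by (simp add: T_def)
    \<comment> \<open>The atom at \<Delta> is avoided, so the slice is measured by the density
      alone.\<close>
    have "None \<notin> T" using None[of "fun_upd \<omega> l None"] by (auto simp: T_def)
    then have TS: "T = Some ` (Some -` T)" by (auto simp: image_iff) (metis not_None_eq)
    have b: "Some -` T \<in> sets borel" using T by (simp add: sets_perturb)
    have "emeasure lborel (Some -` T) = 0"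
    proof (rule plane_null[OF b])
      fix p and t :: real assume p: "p \<in> Some -` T" "t \<noteq> 0"
      then have "fun_upd (fun_upd \<omega> l (Some p)) l (Some (p + t *\<^sub>R (- 1, 1))) \<notin> S"
        by (intro line) (auto simp: T_def)
      then show "p + t *\<^sub>R (- 1, 1) \<notin> Some -` T" by (simp add: T_def)
    qed
    then have "emeasure (perturb \<alpha> (x l)) T = 0"
      using emeasure_perturb_le[OF b, of \<alpha> "x l"] TS by simp
    moreover have "indicator S (fun_upd \<omega> l y) = (indicator T y :: ennreal)" for y
      by (simp add: T_def indicator_def)
    ultimately show "(\<integral>\<^sup>+ y. indicator S (fun_upd \<omega> l y) \<partial>perturb \<alpha> (x l)) = 0"
      using T by simp
  qed
  finally show ?thesis by simp
qed

subsection \<open>Almost sure uniqueness of the optimal grouping\<close>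


lemma pers_shift: "pers (p + t *\<^sub>R (- 1, 1)) = pers p + 2 * t"
  and csum_shift: "csum (p + t *\<^sub>R (- 1, 1)) = csum p"
  by (simp_all add: pers_def csum_def)

text \<open>Some label lies in exactly one of the two sets. Moving its point across the diagonal
  changes one sum and fixes the other, so equality holds at most once along each such line.\<close>

lemma AE_perturbations_pers_sums:
  assumes \<alpha>: "\<alpha> > 0" and A: "finite A" "A0 \<subseteq> A" and B: "B \<subseteq> A0" "B' \<subseteq> A0" "B \<noteq> B'"
  shows "AE \<omega> in perturbations \<alpha> A x. (\<forall>l\<in>A0. \<omega> l \<noteq> None) \<longrightarrow>
    (\<Sum>k\<in>B. pers (the (\<omega> k))) \<noteq> (\<Sum>k\<in>B'. pers (the (\<omega> k)))"
proof -
  let ?P = "perturbations \<alpha> A x"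
  have *: "AE \<omega> in ?P. \<omega> l \<noteq> None \<longrightarrow>
      (\<Sum>k\<in>B. pers (the (\<omega> k))) \<noteq> (\<Sum>k\<in>B'. pers (the (\<omega> k)))"
    if B: "B \<subseteq> A" "B' \<subseteq> A" and l: "l \<in> B" "l \<notin> B'" for B B' l
  proof -
    define S where "S = {\<omega> \<in> space ?P. \<not> \<omega> l = None \<and>
      (\<Sum>k\<in>B. pers (the (\<omega> k))) = (\<Sum>k\<in>B'. pers (the (\<omega> k)))}"
    have fin: "finite B" "finite B'" using A(1) B by (auto intro: finite_subset)
    have lA: "l \<in> A" using l B by blast
    have S: "S \<in> sets ?P"
      unfolding S_def pred_def[symmetric]
    proof (intro pred_intros_logic pred_None[OF lA])
      show "Measurable.pred ?P (\<lambda>\<omega>. (\<Sum>k\<in>B. pers (the (\<omega> k))) = (\<Sum>k\<in>B'. pers (the (\<omega> k))))"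
        unfolding pred_def
        by (intro borel_measurable_eq borel_measurable_sum measurable_perturbed_point) (use B in auto)
    qed
    have "emeasure ?P S = 0"
    proof (rule perturbations_null[OF \<alpha> A(1) lA S])
      fix \<omega> p and t :: real
      assume *: "\<omega> l = Some p" "\<omega> \<in> S" "t \<noteq> 0"
      let ?\<omega> = "fun_upd \<omega> l (Some (p + t *\<^sub>R (- 1, 1)))"
      have "(\<Sum>k\<in>B. pers (the (?\<omega> k))) = (\<Sum>k\<in>B. pers (the (\<omega> k))) + 2 * t"
        using * fin l by (simp add: sum.remove[of B l] pers_shift del: scaleR_Pair)
      moreover have "(\<Sum>k\<in>B'. pers (the (?\<omega> k))) = (\<Sum>k\<in>B'. pers (the (\<omega> k)))"
        using l by (intro sum.cong) auto
      ultimately show "?\<omega> \<notin> S" using * by (simp add: S_def)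
    qed (simp add: S_def)
    then show ?thesis
      by (intro AE_I'[of S]) (use S in \<open>auto simp: null_sets_def S_def\<close>)
  qed
  \<comment> \<open>The claim is symmetric in the two sets; the label decides in which order they
    enter.\<close>
  obtain k where "(k \<in> B \<and> k \<notin> B') \<or> (k \<in> B' \<and> k \<notin> B)" using B(3) by blast
  then show ?thesis
  proof
    assume k: "k \<in> B \<and> k \<notin> B'"
    have "AE \<omega> in ?P. \<omega> k \<noteq> None \<longrightarrow>
      (\<Sum>k\<in>B. pers (the (\<omega> k))) \<noteq> (\<Sum>k\<in>B'. pers (the (\<omega> k)))"
      by (rule *) (use k A B in auto)
    then show ?thesis by eventually_elim (use k B in auto)
  next
    assume k: "k \<in> B' \<and> k \<notin> B"
    have "AE \<omega> in ?P. \<omega> k \<noteq> None \<longrightarrow>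
      (\<Sum>k\<in>B'. pers (the (\<omega> k))) \<noteq> (\<Sum>k\<in>B. pers (the (\<omega> k)))"
      by (rule *) (use k A B in auto)
    then show ?thesis by eventually_elim (use k B in auto)
  qed
qed

text \<open>When the point at \<open>l\<close> moves across the diagonal, the common increments
  cancel and the cost difference changes linearly, with a slope proportional to the difference of
  the persistence sums of the companions. That slope is almost surely nonzero.\<close>

lemma AE_perturbations_costs:
  assumes \<alpha>: "\<alpha> > 0" and A: "finite A" "A0 \<subseteq> A" and G: "is_grouping N A0 G" "is_grouping N A0 G'"
    and s: "s \<in> G" "s' \<in> G'" "l \<in> ran s" "l \<in> ran s'" "s \<noteq> s'" and N: "N > 0"
  shows "AE \<omega> in perturbations \<alpha> A x. (\<forall>l\<in>A0. \<omega> l \<noteq> None) \<longrightarrow>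
    grouping_cost N (\<lambda>l. the (\<omega> l)) G \<noteq> grouping_cost N (\<lambda>l. the (\<omega> l)) G'"
proof -
  let ?P = "perturbations \<alpha> A x"
  define B where "B = ran s - {l}"
  define B' where "B' = ran s' - {l}"
  have ran: "ran s \<subseteq> A0" "ran s' \<subseteq> A0"
    using selection_ran(2)[OF is_groupingD(1)] G s by metis+
  have BA: "B \<subseteq> A0" "B' \<subseteq> A0" "l \<notin> B" "l \<notin> B'" using ran by (auto simp: B_def B'_def)
  have lA: "l \<in> A0" "l \<in> A" using s ran A by auto
  have finA0: "finite A0" using A by (auto intro: finite_subset)
  have "ran s \<noteq> ran s'"
    using selection_eqI[OF is_groupingD(1)[OF G(1) s(1)] is_groupingD(1)[OF G(2) s(2)]] s(5) by blast
  then have "B \<noteq> B'" using s by (auto simp: B_def B'_def)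
  then have "AE \<omega> in ?P. (\<forall>l\<in>A0. \<omega> l \<noteq> None) \<longrightarrow>
      (\<Sum>k\<in>B. pers (the (\<omega> k))) \<noteq> (\<Sum>k\<in>B'. pers (the (\<omega> k)))"
    by (rule AE_perturbations_pers_sums[OF \<alpha> A BA(1,2)])
  moreover
  \<comment> \<open>Demanding unequal sums inside \<open>S\<close> makes the slope nonzero there;
    outcomes with equal sums are excluded by the preceding statement.\<close>
  define S where "S = {\<omega> \<in> space ?P. \<not> \<omega> l = None \<and>
    \<not> (\<Sum>k\<in>B. pers (the (\<omega> k))) = (\<Sum>k\<in>B'. pers (the (\<omega> k))) \<and>
    grouping_cost N (\<lambda>l. the (\<omega> l)) G = grouping_cost N (\<lambda>l. the (\<omega> l)) G'}"
  have S: "S \<in> sets ?P"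
    unfolding S_def pred_def[symmetric]
  proof (intro pred_intros_logic pred_None[OF lA(2)])
    show "Measurable.pred ?P (\<lambda>\<omega>. (\<Sum>k\<in>B. pers (the (\<omega> k))) = (\<Sum>k\<in>B'. pers (the (\<omega> k))))"
      unfolding pred_def
      by (intro borel_measurable_eq borel_measurable_sum measurable_perturbed_point) (use BA A in auto)
    show "Measurable.pred ?P (\<lambda>\<omega>. grouping_cost N (\<lambda>l. the (\<omega> l)) G = grouping_cost N (\<lambda>l. the (\<omega> l)) G')"
      unfolding pred_def
      by (intro borel_measurable_eq measurable_grouping_cost[OF _ A(2)] G)
  qed
  have "emeasure ?P S = 0"
  proof (rule perturbations_null[OF \<alpha> A(1) lA(2) S])
    fix \<omega> p and t :: real
    assume *: "\<omega> l = Some p" "\<omega> \<in> S" "t \<noteq> 0"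
    let ?\<omega> = "fun_upd \<omega> l (Some (p + t *\<^sub>R (- 1, 1)))"
    let ?q = "\<lambda>l. the (\<omega> l)" and ?q' = "\<lambda>l. the (?\<omega> l)"
    have q': "csum (?q' l) = csum (?q l)" "pers (?q' l) = pers (?q l) + 2 * t" "\<And>k. k \<noteq> l \<Longrightarrow> ?q' k = ?q k"
      using *(1) by (simp_all add: pers_shift csum_shift del: scaleR_Pair)
    have "grouping_cost N ?q' G - grouping_cost N ?q' G' = grouping_cost N ?q G - grouping_cost N ?q G'
      - 2 * t * ((\<Sum>k\<in>B. pers (?q k)) - (\<Sum>k\<in>B'. pers (?q k))) / N"
    proof -
      have "grouping_cost N ?q' G = grouping_cost N ?q G
          + ((2 * (2 * t) * pers (?q l) + (2 * t)\<^sup>2) * (1 - 1 / N) / 2) - 2 * t * (\<Sum>k\<in>B. pers (?q k)) / N"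
        unfolding B_def by (rule grouping_cost_shift[where q = ?q and q' = ?q', OF G(1) finA0 s(1,3) q'])
      moreover have "grouping_cost N ?q' G' = grouping_cost N ?q G'
          + ((2 * (2 * t) * pers (?q l) + (2 * t)\<^sup>2) * (1 - 1 / N) / 2) - 2 * t * (\<Sum>k\<in>B'. pers (?q k)) / N"
        unfolding B'_def by (rule grouping_cost_shift[where q = ?q and q' = ?q', OF G(2) finA0 s(2,4) q'])
      moreover have "2 * t * ((\<Sum>k\<in>B. pers (?q k)) - (\<Sum>k\<in>B'. pers (?q k))) / N
          = 2 * t * (\<Sum>k\<in>B. pers (?q k)) / N - 2 * t * (\<Sum>k\<in>B'. pers (?q k)) / N"
        by (simp add: diff_divide_distrib right_diff_distrib)
      ultimately show ?thesis by linarith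
    qed
    moreover have "2 * t * ((\<Sum>k\<in>B. pers (?q k)) - (\<Sum>k\<in>B'. pers (?q k))) / N \<noteq> 0"
      using * N by (simp add: S_def)
    moreover have "grouping_cost N ?q G = grouping_cost N ?q G'" using *(2) by (simp add: S_def)
    ultimately have "grouping_cost N ?q' G \<noteq> grouping_cost N ?q' G'" by linarith
    then show "?\<omega> \<notin> S" unfolding S_def by blast
  qed (simp add: S_def)
  then have "AE \<omega> in ?P. \<omega> \<notin> S"
    by (intro AE_I'[of S]) (use S in \<open>auto simp: null_sets_def\<close>)
  ultimately show ?thesis
    using AE_space by eventually_elim (use lA in \<open>auto simp: S_def\<close>)
qed

lemma AE_generic:
  assumes \<alpha>: "\<alpha> > 0" and A: "finite A" and N: "N > 0"
  shows "AE \<omega> in perturbations \<alpha> A x. generic N {l \<in> A. \<omega> l \<noteq> None} (\<lambda>l. the (\<omega> l))"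
proof -
  let ?P = "perturbations \<alpha> A x"
  \<comment> \<open>The set of survivors is random; the claim is shown for each of the finitely many
    candidates \<open>A0\<close> and then specialized.\<close>
  have "AE \<omega> in ?P. \<forall>A0\<in>Pow A. (\<forall>l\<in>A0. \<omega> l \<noteq> None) \<longrightarrow> generic N A0 (\<lambda>l. the (\<omega> l))"
  proof (rule AE_finite_allI)
    fix A0 assume "A0 \<in> Pow A"
    then have A0: "A0 \<subseteq> A" "finite A0" using A by (auto intro: finite_subset)
    have 1: "AE \<omega> in ?P. \<forall>B\<in>Pow A0. \<forall>B'\<in>Pow A0. B \<noteq> B' \<longrightarrow> (\<forall>l\<in>A0. \<omega> l \<noteq> None) \<longrightarrow>
      (\<Sum>k\<in>B. pers (the (\<omega> k))) \<noteq> (\<Sum>k\<in>B'. pers (the (\<omega> k)))"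
    proof (intro AE_finite_allI AE_impI)
      fix B B' assume "B \<in> Pow A0" "B' \<in> Pow A0" "B \<noteq> B'"
      then show "AE \<omega> in ?P. (\<forall>l\<in>A0. \<omega> l \<noteq> None) \<longrightarrow>
          (\<Sum>k\<in>B. pers (the (\<omega> k))) \<noteq> (\<Sum>k\<in>B'. pers (the (\<omega> k)))"
        by (intro AE_perturbations_pers_sums[OF \<alpha> A A0(1)]) auto
    qed (use A0 in simp_all)
    have 2: "AE \<omega> in ?P. \<forall>G\<in>{G. is_grouping N A0 G}. \<forall>G'\<in>{G. is_grouping N A0 G}. G \<noteq> G' \<longrightarrow>
      (\<forall>l\<in>A0. \<omega> l \<noteq> None) \<longrightarrow>
      grouping_cost N (\<lambda>l. the (\<omega> l)) G \<noteq> grouping_cost N (\<lambda>l. the (\<omega> l)) G'"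
    proof (intro AE_finite_allI AE_impI finite_groupings(1) A0(2))
      fix G G' assume "G \<in> {G. is_grouping N A0 G}" "G' \<in> {G. is_grouping N A0 G}" "G \<noteq> G'"
      then have G: "is_grouping N A0 G" "is_grouping N A0 G'" "G \<noteq> G'" by auto
      \<comment> \<open>Distinct groupings put some label into different selections: take any label
        of a selection that belongs to only one of them.\<close>
      have "\<exists>s\<in>G. \<exists>s'\<in>G'. \<exists>l. l \<in> ran s \<and> l \<in> ran s' \<and> s \<noteq> s'"
      proof -
        have *: "\<exists>s\<in>G. \<exists>s'\<in>G'. \<exists>l. l \<in> ran s \<and> l \<in> ran s' \<and> s \<noteq> s'"
          if G: "is_grouping N A0 G" "is_grouping N A0 G'" and s: "s \<in> G" "s \<notin> G'" for G G' s
        proof -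
          have "ran s \<noteq> {}"
            using selection_ran(4)[OF is_groupingD(1)[OF G(1) s(1)]] is_groupingD(2)[OF G(1) s(1)] by simp
          then obtain l where l: "l \<in> ran s" by blast
          then have "l \<in> A0" using selection_ran(2)[OF is_groupingD(1)[OF G(1) s(1)]] by blast
          then obtain s' where "s' \<in> G'" "l \<in> ran s'" using G(2) unfolding is_grouping_def by blast
          then show ?thesis using s l by blast
        qed
        show ?thesis
        proof (cases "G \<subseteq> G'")
          case True
          then obtain s where "s \<in> G'" "s \<notin> G" using G(3) by blast
          then show ?thesis using *[OF G(2,1)] by blast
        next
          case False
          then show ?thesis using *[OF G(1,2)] by blast
        qed
      qed
      then obtain s s' l where "s \<in> G" "s' \<in> G'" "l \<in> ran s" "l \<in> ran s'" "s \<noteq> s'" by blast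
      then show "AE \<omega> in ?P. (\<forall>l\<in>A0. \<omega> l \<noteq> None) \<longrightarrow>
        grouping_cost N (\<lambda>l. the (\<omega> l)) G \<noteq> grouping_cost N (\<lambda>l. the (\<omega> l)) G'"
        by (rule AE_perturbations_costs[OF \<alpha> A A0(1) G(1,2) _ _ _ _ _ N])
    qed
    from 1 2 show "AE \<omega> in ?P. (\<forall>l\<in>A0. \<omega> l \<noteq> None) \<longrightarrow> generic N A0 (\<lambda>l. the (\<omega> l))"
    proof eventually_elim
      case (elim \<omega>)
      show ?case
      proof
        assume all: "\<forall>l\<in>A0. \<omega> l \<noteq> None"
        show "generic N A0 (\<lambda>l. the (\<omega> l))"
          unfolding generic_def
        proof (intro conjI ballI impI)
          show "(\<Sum>l\<in>B. pers (the (\<omega> l))) \<noteq> (\<Sum>l\<in>B'. pers (the (\<omega> l)))"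
            if "B \<in> Pow A0" "B' \<in> Pow A0" "B \<noteq> B'" for B B'
            by (rule elim(1)[THEN bspec, THEN bspec, THEN mp, THEN mp, OF that all])
          show "grouping_cost N (\<lambda>l. the (\<omega> l)) G \<noteq> grouping_cost N (\<lambda>l. the (\<omega> l)) G'"
            if "G \<in> {G. is_grouping N A0 G}" "G' \<in> {G. is_grouping N A0 G}" "G \<noteq> G'" for G G'
            by (rule elim(2)[THEN bspec, THEN bspec, THEN mp, THEN mp, OF that all])
        qed
      qed
    qed
  qed (use A in simp)
  then show ?thesis
  proof eventually_elim
    case (elim \<omega>)
    have "{l \<in> A. \<omega> l \<noteq> None} \<in> Pow A" by blast
    from elim[THEN bspec, OF this] show ?case by simp
  qed
qed

section \<open>Survival above the diagonal and the law of the random grouping\<close>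

lemma emeasure_lborel_ball:
  "0 \<le> r \<Longrightarrow> emeasure lborel (ball (x :: point) r) = ennreal (pi * r\<^sup>2)"
  using emeasure_ball[of r x] by (simp add: unit_ball_vol_2 power2_eq_square)

text \<open>The open ball around \<open>x\<close> has radius at most the distance to the diagonal,
  so it never reaches it.\<close>

lemma AE_perturb_above:
  assumes x: "0 < pers x"
  shows "AE y in perturb \<alpha> x. y \<noteq> None \<longrightarrow> 0 < pers (the y)"
proof -
  define S where "S = {p. pers p \<le> 0}"
  have "S = pers -` {..0}" by (auto simp: S_def)
  then have S: "S \<in> sets borel" using measurable_sets_borel[OF borel_measurable_pers] by simp
  have "pers p > 0" if "p \<in> ball x (min \<alpha> (infdist x diagonal))" for p
  proof -
    have "norm (x - p) < infdist x diagonal" using that by (simp add: dist_norm)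
    then have "(norm (x - p))\<^sup>2 < (infdist x diagonal)\<^sup>2" by (intro power_strict_mono) auto
    then have less: "((csum x - csum p)\<^sup>2 + (pers x - pers p)\<^sup>2) / 2 < (pers x)\<^sup>2 / 2"
      unfolding norm_diff_power2 infdist_diagonal_power2 .
    have "(pers x - pers p)\<^sup>2 \<le> (csum x - csum p)\<^sup>2 + (pers x - pers p)\<^sup>2" by simp
    also have "\<dots> < (pers x)\<^sup>2" using less by (simp add: divide_less_cancel)
    finally have "(pers x - pers p)\<^sup>2 < (pers x)\<^sup>2" .
    then have "\<bar>pers x - pers p\<bar> < \<bar>pers x\<bar>" using power2_less_imp_less[of "\<bar>pers x - pers p\<bar>" "\<bar>pers x\<bar>"] by simp
    then show ?thesis using x by linarith
  qed
  then have empty: "S \<inter> ball x (min \<alpha> (infdist x diagonal)) = {}" by (force simp: S_def)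
  have v: "Some -` Some ` S = S" by auto
  have "emeasure (perturb \<alpha> x) (Some ` S) = 0"
    using emeasure_perturb[of "Some ` S" "min \<alpha> (infdist x diagonal)" \<alpha> x, unfolded v] S empty
    by (auto simp: v)
  moreover have "Some ` S \<in> sets (perturb \<alpha> x)" using S by (simp add: sets_perturb v)
  ultimately show ?thesis
    by (intro AE_I'[of "Some ` S"]) (auto simp: null_sets_def S_def image_iff not_less)
qed

lemma AE_grouping_of_outcome:
  assumes \<alpha>: "\<alpha> > 0" and A: "finite A" "\<And>l. l \<in> A \<Longrightarrow> fst l < N" "N > 0"
    and above: "\<And>l. l \<in> A \<Longrightarrow> 0 < pers (x l)"
  shows "AE \<omega> in perturbations \<alpha> A x. \<exists>G\<in>{G. is_grouping N A G}. grouping_of_outcome N A \<omega> = Some G"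
proof -
  have "AE \<omega> in perturbations \<alpha> A x. \<forall>l\<in>A. \<omega> l \<noteq> None \<longrightarrow> 0 < pers (the (\<omega> l))"
    unfolding perturbations_def
    by (intro AE_finite_allI A(1) AE_PiM_component prob_space_perturb \<alpha> AE_perturb_above above)
  with AE_generic[OF \<alpha> A(1,3)] show ?thesis
  proof eventually_elim
    case (elim \<omega>)
    have "grouping_of_outcome N A \<omega> \<noteq> None"
      by (rule grouping_of_outcome_generic) (use elim A in auto)
    then obtain G where G: "grouping_of_outcome N A \<omega> = Some G" by blast
    show ?case using is_grouping_of_outcome[OF G A(2)] G by simp
  qed
qed

text \<open>Like \<open>prob_grouping\<close>, but for arbitrary labels and centres, since the
  comparison of two tuples passes through the labels \<open>J\<close> of the matched points
  alone.\<close>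

definition grouping_law :: "nat \<Rightarrow> real \<Rightarrow> label set \<Rightarrow> (label \<Rightarrow> point) \<Rightarrow> selection set \<Rightarrow> real" where
  "grouping_law N \<alpha> A x G = measure (perturbations \<alpha> A x)
     {\<omega> \<in> space (perturbations \<alpha> A x). grouping_of_outcome N A \<omega> = Some G}"

lemma sum_grouping_law:
  assumes \<alpha>: "\<alpha> > 0" and A: "finite A" "\<And>l. l \<in> A \<Longrightarrow> fst l < N" "N > 0" and S: "finite S"
  shows "(\<Sum>G\<in>S. grouping_law N \<alpha> A x G) = measure (perturbations \<alpha> A x)
     {\<omega> \<in> space (perturbations \<alpha> A x). \<exists>G\<in>S. grouping_of_outcome N A \<omega> = Some G}"
proof -
  let ?P = "perturbations \<alpha> A x"
  interpret prob_space ?P by (rule perturbations_product(2)[OF \<alpha>])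
  have "measure ?P (\<Union>G\<in>S. {\<omega> \<in> space ?P. grouping_of_outcome N A \<omega> = Some G})
    = (\<Sum>G\<in>S. grouping_law N \<alpha> A x G)"
    unfolding grouping_law_def
    by (rule finite_measure_finite_Union[OF S])
      (use pred_grouping_of_outcome[where \<alpha> = \<alpha> and x = x, OF A, unfolded pred_def] in \<open>auto simp: disjoint_family_on_def\<close>)
  moreover have "(\<Union>G\<in>S. {\<omega> \<in> space ?P. grouping_of_outcome N A \<omega> = Some G})
    = {\<omega> \<in> space ?P. \<exists>G\<in>S. grouping_of_outcome N A \<omega> = Some G}" by blast
  ultimately show ?thesis by simp
qed

lemma pred_grouping_of_outcome_in:
  assumes A: "finite A" "\<And>l. l \<in> A \<Longrightarrow> fst l < N" "N > 0" and S: "finite S"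
  shows "Measurable.pred (perturbations \<alpha> A x) (\<lambda>\<omega>. \<exists>G\<in>S. grouping_of_outcome N A \<omega> = Some G)"
  by (intro pred_intros_finite(4) S pred_grouping_of_outcome A)

text \<open>Here almost sure existence and uniqueness of the optimal grouping enter: the events are
  disjoint and cover almost every outcome.\<close>

lemma sum_grouping_law_eq_1:
  assumes \<alpha>: "\<alpha> > 0" and A: "finite A" "\<And>l. l \<in> A \<Longrightarrow> fst l < N" "N > 0"
    and above: "\<And>l. l \<in> A \<Longrightarrow> 0 < pers (x l)"
  shows "(\<Sum>G\<in>{G. is_grouping N A G}. grouping_law N \<alpha> A x G) = 1"
proof -
  let ?P = "perturbations \<alpha> A x"
  interpret prob_space ?P by (rule perturbations_product(2)[OF \<alpha>])
  note fin = finite_groupings(1)[OF A(1), of N]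
  have "(\<Sum>G\<in>{G. is_grouping N A G}. grouping_law N \<alpha> A x G) = measure ?P
      {\<omega> \<in> space ?P. \<exists>G\<in>{G. is_grouping N A G}. grouping_of_outcome N A \<omega> = Some G}"
    by (rule sum_grouping_law[OF \<alpha> A(1) _ A(3) fin]) (rule A(2))
  also have "\<dots> = 1"
  proof (subst prob_Collect_eq_1)
    show "{\<omega> \<in> space ?P. \<exists>G\<in>{G. is_grouping N A G}. grouping_of_outcome N A \<omega> = Some G} \<in> events"
      unfolding pred_def[symmetric] by (rule pred_grouping_of_outcome_in[OF A(1) _ A(3) fin]) (rule A(2))
    show "AE \<omega> in ?P. \<exists>G\<in>{G. is_grouping N A G}. grouping_of_outcome N A \<omega> = Some G"
      by (rule AE_grouping_of_outcome[OF \<alpha> A(1) _ A(3)]) (rule A(2) above; assumption)+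
  qed
  finally show ?thesis .
qed

subsection \<open>Total variation of perturbations\<close>


text \<open>Both orders of integration are provided: when factors are exchanged below, one order
  exposes the slices in the new coordinate, the other those in the old ones.\<close>

lemma emeasure_PiM_insert:
  assumes "product_sigma_finite M" and I: "finite I" "i \<notin> I" and S: "S \<in> sets (PiM (insert i I) M)"
  shows "emeasure (PiM (insert i I) M) S
      = (\<integral>\<^sup>+ \<omega>. emeasure (M i) {y \<in> space (M i). fun_upd \<omega> i y \<in> S} \<partial>PiM I M)"
    and "emeasure (PiM (insert i I) M) S
      = (\<integral>\<^sup>+ y. emeasure (PiM I M) {\<omega> \<in> space (PiM I M). fun_upd \<omega> i y \<in> S} \<partial>M i)"
    and "\<omega> \<in> space (PiM I M) \<Longrightarrow> {y \<in> space (M i). fun_upd \<omega> i y \<in> S} \<in> sets (M i)"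
    and "y \<in> space (M i) \<Longrightarrow> {\<omega> \<in> space (PiM I M). fun_upd \<omega> i y \<in> S} \<in> sets (PiM I M)"
proof -
  interpret product_sigma_finite M by fact
  have 1: "{y \<in> space (M i). fun_upd \<omega> i y \<in> S} \<in> sets (M i)" if "\<omega> \<in> space (PiM I M)" for \<omega>
  proof -
    have "(\<lambda>y. fun_upd \<omega> i y) \<in> M i \<rightarrow>\<^sub>M PiM (insert i I) M"
      by (rule measurable_fun_upd[where J = I]) (use that in auto)
    from measurable_sets[OF this S] show ?thesis by (simp add: vimage_def Int_def conj_commute)
  qed
  have 2: "{\<omega> \<in> space (PiM I M). fun_upd \<omega> i y \<in> S} \<in> sets (PiM I M)" if "y \<in> space (M i)" for y
  proof -
    have "(\<lambda>\<omega>. fun_upd \<omega> i y) \<in> PiM I M \<rightarrow>\<^sub>M PiM (insert i I) M"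
      by (rule measurable_fun_upd[where J = I]) (use that in auto)
    from measurable_sets[OF this S] show ?thesis by (simp add: vimage_def Int_def conj_commute)
  qed
  show "\<omega> \<in> space (PiM I M) \<Longrightarrow> {y \<in> space (M i). fun_upd \<omega> i y \<in> S} \<in> sets (M i)"
    and "y \<in> space (M i) \<Longrightarrow> {\<omega> \<in> space (PiM I M). fun_upd \<omega> i y \<in> S} \<in> sets (PiM I M)"
    by (fact 1, fact 2)
  have e: "emeasure (PiM (insert i I) M) S = (\<integral>\<^sup>+ \<omega>. indicator S \<omega> \<partial>PiM (insert i I) M)"
    using S by simp
  also have "\<dots> = (\<integral>\<^sup>+ \<omega>. (\<integral>\<^sup>+ y. indicator S (fun_upd \<omega> i y) \<partial>M i) \<partial>PiM I M)"
    using S by (intro product_nn_integral_insert I) simp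
  also have "\<dots> = (\<integral>\<^sup>+ \<omega>. emeasure (M i) {y \<in> space (M i). fun_upd \<omega> i y \<in> S} \<partial>PiM I M)"
  proof (rule nn_integral_cong)
    fix \<omega> assume "\<omega> \<in> space (PiM I M)"
    have "(\<integral>\<^sup>+ y. indicator S (fun_upd \<omega> i y) \<partial>M i)
      = (\<integral>\<^sup>+ y. indicator {y \<in> space (M i). fun_upd \<omega> i y \<in> S} y \<partial>M i)"
      by (intro nn_integral_cong) (simp add: indicator_def)
    then show "(\<integral>\<^sup>+ y. indicator S (fun_upd \<omega> i y) \<partial>M i)
      = emeasure (M i) {y \<in> space (M i). fun_upd \<omega> i y \<in> S}"
      using 1[OF \<open>\<omega> \<in> space (PiM I M)\<close>] by simp
  qed
  finally show "emeasure (PiM (insert i I) M) S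
      = (\<integral>\<^sup>+ \<omega>. emeasure (M i) {y \<in> space (M i). fun_upd \<omega> i y \<in> S} \<partial>PiM I M)" .
  note e
  also have "(\<integral>\<^sup>+ \<omega>. indicator S \<omega> \<partial>PiM (insert i I) M)
      = (\<integral>\<^sup>+ y. (\<integral>\<^sup>+ \<omega>. indicator S (fun_upd \<omega> i y) \<partial>PiM I M) \<partial>M i)"
    using S by (intro product_nn_integral_insert_rev I) simp
  also have "\<dots> = (\<integral>\<^sup>+ y. emeasure (PiM I M) {\<omega> \<in> space (PiM I M). fun_upd \<omega> i y \<in> S} \<partial>M i)"
  proof (rule nn_integral_cong)
    fix y assume "y \<in> space (M i)"
    have "(\<integral>\<^sup>+ \<omega>. indicator S (fun_upd \<omega> i y) \<partial>PiM I M)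
      = (\<integral>\<^sup>+ \<omega>. indicator {\<omega> \<in> space (PiM I M). fun_upd \<omega> i y \<in> S} \<omega> \<partial>PiM I M)"
      by (intro nn_integral_cong) (simp add: indicator_def)
    then show "(\<integral>\<^sup>+ \<omega>. indicator S (fun_upd \<omega> i y) \<partial>PiM I M)
      = emeasure (PiM I M) {\<omega> \<in> space (PiM I M). fun_upd \<omega> i y \<in> S}"
      using 2[OF \<open>y \<in> space (M i)\<close>] by simp
  qed
  finally show "emeasure (PiM (insert i I) M) S
      = (\<integral>\<^sup>+ y. emeasure (PiM I M) {\<omega> \<in> space (PiM I M). fun_upd \<omega> i y \<in> S} \<partial>M i)" .
qed

text \<open>Changing the factors one at a time, the total variation errors add up.\<close>

lemma emeasure_PiM_le_add:
  fixes M M' :: "'i \<Rightarrow> 'a measure"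
  assumes M: "\<And>i. prob_space (M i)" "\<And>i. prob_space (M' i)" "\<And>i. sets (M i) = sets (M' i)"
    and I: "finite I" and \<epsilon>: "\<And>i. i \<in> I \<Longrightarrow> 0 \<le> \<epsilon> i"
    and le: "\<And>i B. i \<in> I \<Longrightarrow> B \<in> sets (M i) \<Longrightarrow> emeasure (M i) B \<le> emeasure (M' i) B + ennreal (\<epsilon> i)"
    and S: "S \<in> sets (PiM I M)"
  shows "emeasure (PiM I M) S \<le> emeasure (PiM I M') S + ennreal (\<Sum>i\<in>I. \<epsilon> i)"
  using I \<epsilon> le S
proof (induction I arbitrary: S rule: finite_induct)
  case empty
  then show ?case by (simp add: PiM_empty)
next
  case (insert i I)
  have sp: "space (M j) = space (M' j)" for j using M(3) by (rule sets_eq_imp_space_eq)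
  \<comment> \<open>The hybrid family, with the new factor at \<open>i\<close> and the old ones
    elsewhere, links the two halves of the induction step.\<close>
  define K where "K = (\<lambda>j. if j = i then M' j else M j)"
  have K: "prob_space (K j)" "sets (M j) = sets (K j)" for j using M by (auto simp: K_def)
  have psf: "product_sigma_finite M" "product_sigma_finite M'" "product_sigma_finite K"
    using M K by (auto simp: product_sigma_finite_def intro!: prob_space_imp_sigma_finite)
  have KM: "PiM I K = PiM I M" using insert.hyps by (intro PiM_cong) (auto simp: K_def)
  have SK: "S \<in> sets (PiM (insert i I) K)" "S \<in> sets (PiM (insert i I) M')"
    using insert.prems(3) sets_PiM_cong[of "insert i I" "insert i I" M K] K(2)
      sets_PiM_cong[of "insert i I" "insert i I" M M'] M(3) by auto
  interpret PI: prob_space "PiM I M" by (rule prob_space_PiM) (rule M)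
  interpret Mi': prob_space "M' i" by (rule M)
  have sIM: "sets (PiM I M) = sets (PiM I M')" using M(3) by (intro sets_PiM_cong) auto
  have spI: "space (PiM I M) = space (PiM I M')" using sIM by (rule sets_eq_imp_space_eq)
  have Ki: "K i = M' i" by (simp add: K_def)
  have "emeasure (PiM (insert i I) M) S
      = (\<integral>\<^sup>+ \<omega>. emeasure (M i) {y \<in> space (M i). fun_upd \<omega> i y \<in> S} \<partial>PiM I M)"
    by (rule emeasure_PiM_insert(1)[OF psf(1) insert.hyps insert.prems(3)])
  also have "\<dots> \<le> (\<integral>\<^sup>+ \<omega>. emeasure (M' i) {y \<in> space (M' i). fun_upd \<omega> i y \<in> S} + ennreal (\<epsilon> i) \<partial>PiM I M)"
  proof (rule nn_integral_mono)
    fix \<omega> assume \<omega>: "\<omega> \<in> space (PiM I M)"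
    show "emeasure (M i) {y \<in> space (M i). fun_upd \<omega> i y \<in> S}
      \<le> emeasure (M' i) {y \<in> space (M' i). fun_upd \<omega> i y \<in> S} + ennreal (\<epsilon> i)"
      unfolding sp[symmetric]
      by (rule insert.prems(2)[OF _ emeasure_PiM_insert(3)[OF psf(1) insert.hyps insert.prems(3) \<omega>]]) simp
  qed
  also have "\<dots> \<le> (\<integral>\<^sup>+ \<omega>. emeasure (M' i) {y \<in> space (M' i). fun_upd \<omega> i y \<in> S} \<partial>PiM I M) + ennreal (\<epsilon> i)"
  proof -
    have "(\<lambda>\<omega>. emeasure (M' i) {y \<in> space (M' i). fun_upd \<omega> i y \<in> S}) \<in> borel_measurable (PiM I M)"
    proof -
      have m: "(\<lambda>(\<omega>, y). fun_upd \<omega> i y) \<in> PiM I K \<Otimes>\<^sub>M K i \<rightarrow>\<^sub>M PiM (insert i I) K"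
        by (rule measurable_add_dim)
      have "{z \<in> space (PiM I M \<Otimes>\<^sub>M M' i). fun_upd (fst z) i (snd z) \<in> S} \<in> sets (PiM I M \<Otimes>\<^sub>M M' i)"
        using measurable_sets[OF m SK(1)] unfolding KM Ki
        by (simp add: vimage_def Int_def case_prod_beta conj_commute)
      then have "(\<lambda>\<omega>. emeasure (M' i) (Pair \<omega> -` {z \<in> space (PiM I M \<Otimes>\<^sub>M M' i). fun_upd (fst z) i (snd z) \<in> S}))
          \<in> borel_measurable (PiM I M)"
        by (rule Mi'.measurable_emeasure_Pair)
      then show ?thesis
        by (rule measurable_cong[THEN iffD1, rotated])
          (auto simp: space_pair_measure intro!: arg_cong[where f = "emeasure (M' i)"])
    qed
    then show ?thesis using insert.prems(1)[of i]
      by (subst nn_integral_add) (auto simp: PI.emeasure_space_1)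
  qed
  \<comment> \<open>Exchanging the order of integration in the hybrid product exposes the old
    factors to the induction hypothesis.\<close>
  also have "(\<integral>\<^sup>+ \<omega>. emeasure (M' i) {y \<in> space (M' i). fun_upd \<omega> i y \<in> S} \<partial>PiM I M)
      = (\<integral>\<^sup>+ y. emeasure (PiM I M) {\<omega> \<in> space (PiM I M). fun_upd \<omega> i y \<in> S} \<partial>M' i)"
    using emeasure_PiM_insert(1,2)[OF psf(3) insert.hyps SK(1)] unfolding KM Ki by simp
  also have "\<dots> \<le> (\<integral>\<^sup>+ y. emeasure (PiM I M') {\<omega> \<in> space (PiM I M'). fun_upd \<omega> i y \<in> S}
      + ennreal (\<Sum>i\<in>I. \<epsilon> i) \<partial>M' i)"
  proof (rule nn_integral_mono)
    fix y assume "y \<in> space (M' i)"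
    then have y: "y \<in> space (M i)" by (simp add: sp)
    show "emeasure (PiM I M) {\<omega> \<in> space (PiM I M). fun_upd \<omega> i y \<in> S}
      \<le> emeasure (PiM I M') {\<omega> \<in> space (PiM I M'). fun_upd \<omega> i y \<in> S} + ennreal (\<Sum>i\<in>I. \<epsilon> i)"
      unfolding spI[symmetric]
      by (rule insert.IH) (use insert.prems emeasure_PiM_insert(4)[OF psf(1) insert.hyps insert.prems(3) y] in auto)
  qed
  also have "\<dots> = emeasure (PiM (insert i I) M') S + ennreal (\<Sum>i\<in>I. \<epsilon> i)"
  proof -
    have "(\<lambda>y. emeasure (PiM I M') {\<omega> \<in> space (PiM I M'). fun_upd \<omega> i y \<in> S}) \<in> borel_measurable (M' i)"
    proof -
      interpret PI': prob_space "PiM I M'" by (rule prob_space_PiM) (rule M)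
      have m: "(\<lambda>(\<omega>, y). fun_upd \<omega> i y) \<in> PiM I M' \<Otimes>\<^sub>M M' i \<rightarrow>\<^sub>M PiM (insert i I) M'"
        by (rule measurable_add_dim)
      have m2: "(\<lambda>z. fun_upd (snd z) i (fst z)) \<in> M' i \<Otimes>\<^sub>M PiM I M' \<rightarrow>\<^sub>M PiM (insert i I) M'"
        using measurable_compose[OF measurable_pair_swap' m] by (simp add: case_prod_beta)
      have "{z \<in> space (M' i \<Otimes>\<^sub>M PiM I M'). fun_upd (snd z) i (fst z) \<in> S} \<in> sets (M' i \<Otimes>\<^sub>M PiM I M')"
        using measurable_sets[OF m2 SK(2)] by (simp add: vimage_def Int_def conj_commute)
      then have "(\<lambda>y. emeasure (PiM I M') (Pair y -` {z \<in> space (M' i \<Otimes>\<^sub>M PiM I M'). fun_upd (snd z) i (fst z) \<in> S}))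
          \<in> borel_measurable (M' i)"
        by (rule PI'.measurable_emeasure_Pair)
      then show ?thesis
        by (rule measurable_cong[THEN iffD1, rotated])
          (auto simp: space_pair_measure intro!: arg_cong[where f = "emeasure (PiM I M')"])
    qed
    then show ?thesis
      using emeasure_PiM_insert(2)[OF psf(2) insert.hyps SK(2)]
      by (subst nn_integral_add) (auto simp: Mi'.emeasure_space_1)
  qed
  finally have "emeasure (PiM (insert i I) M) S
    \<le> emeasure (PiM (insert i I) M') S + ennreal (\<Sum>i\<in>I. \<epsilon> i) + ennreal (\<epsilon> i)"
    by (simp add: add_right_mono)
  also have "\<dots> = emeasure (PiM (insert i I) M') S + ennreal (\<Sum>i\<in>insert i I. \<epsilon> i)"
    using insert.hyps insert.prems(1)
    by (simp add: add.assoc ennreal_plus[symmetric] sum_nonneg add.commute del: ennreal_plus)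
  finally show ?case .
qed

text \<open>With \<open>t = dist x y\<close>, the triangle inequality puts the ball of radius
  \<open>r - 2 * t\<close> around \<open>x\<close> inside \<open>ball y s\<close>, leaving an
  annulus of area at most \<open>4 * pi * r * t\<close>. If \<open>r < 2 * t\<close>, the whole ball
  is small enough.\<close>

lemma emeasure_ball_diff_le:
  fixes x y :: point
  assumes "0 \<le> r" "r \<le> \<alpha>" "r \<le> s + dist x y"
  shows "emeasure lborel (ball x r - ball y s) \<le> ennreal (4 * pi * \<alpha> * dist x y)"
proof (cases "2 * dist x y \<le> r")
  case True
  define t where "t = dist x y"
  have t: "0 \<le> t" "2 * t \<le> r" using True by (auto simp: t_def)
  have "ball x (r - 2 * t) \<subseteq> ball y s"
  proof
    fix p assume "p \<in> ball x (r - 2 * t)"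
    then show "p \<in> ball y s" using assms(3) dist_triangle[of y p x] by (simp add: t_def dist_commute)
  qed
  then have "emeasure lborel (ball x r - ball y s) \<le> emeasure lborel (ball x r - ball x (r - 2 * t))"
    by (intro emeasure_mono) auto
  also have "\<dots> = emeasure lborel (ball x r) - emeasure lborel (ball x (r - 2 * t))"
    using t by (intro emeasure_Diff) (auto simp: emeasure_lborel_ball)
  also have "\<dots> = ennreal (pi * r\<^sup>2 - pi * (r - 2 * t)\<^sup>2)"
    using t assms by (simp add: emeasure_lborel_ball ennreal_minus)
  also have "\<dots> \<le> ennreal (4 * pi * \<alpha> * t)"
  proof (rule ennreal_leI)
    have "pi * r\<^sup>2 - pi * (r - 2 * t)\<^sup>2 = pi * (4 * r * t) - pi * (4 * t\<^sup>2)"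
      by (simp add: power2_eq_square algebra_simps)
    also have "\<dots> \<le> pi * (4 * r * t)" by simp
    also have "\<dots> \<le> pi * (4 * \<alpha> * t)" using t assms by (intro mult_left_mono mult_right_mono) auto
    finally show "pi * r\<^sup>2 - pi * (r - 2 * t)\<^sup>2 \<le> 4 * pi * \<alpha> * t" by (simp add: mult_ac)
  qed
  finally show ?thesis by (simp add: t_def)
next
  case False
  have "emeasure lborel (ball x r - ball y s) \<le> emeasure lborel (ball x r)"
    by (intro emeasure_mono) auto
  also have "\<dots> = ennreal (pi * (r * r))" using assms by (simp add: emeasure_lborel_ball power2_eq_square)
  also have "\<dots> \<le> ennreal (pi * (\<alpha> * (4 * dist x y)))"
    using False assms by (intro ennreal_leI mult_left_mono mult_mono) (auto simp: not_le intro: order_trans[of r "2 * dist x y"])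
  finally show ?thesis by (simp add: mult_ac)
qed

text \<open>For sets without \<Delta> only the balls matter, and the area bound times the density
  gives \<open>4 * dist x y / \<alpha>\<close>. For sets with \<Delta>, pass to the complement and
  exchange \<open>x\<close> and \<open>y\<close>.\<close>

lemma emeasure_perturb_close:
  assumes \<alpha>: "\<alpha> > 0" and B: "B \<in> sets (perturb \<alpha> x)"
  shows "emeasure (perturb \<alpha> x) B \<le> emeasure (perturb \<alpha> y) B + ennreal (4 * dist x y / \<alpha>)"
proof -
  have *: "emeasure (perturb \<alpha> x) B \<le> emeasure (perturb \<alpha> y) B + ennreal (4 * dist x y / \<alpha>)"
    if B: "Some -` B \<in> sets borel" and None: "None \<notin> B" for B and x y :: point
  proof -
    let ?r = "min \<alpha> (infdist x diagonal)" and ?s = "min \<alpha> (infdist y diagonal)"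
    let ?c = "ennreal (1 / (pi * \<alpha>\<^sup>2))"
    have r: "0 \<le> ?r" "?r \<le> \<alpha>" using \<alpha> by (auto simp: infdist_nonneg)
    \<comment> \<open>The radius of the ball is 1-Lipschitz in its centre.\<close>
    have "min \<alpha> u \<le> min \<alpha> v + d" if "u \<le> v + d" "0 \<le> d" for u v d :: real
      using that by simp
    from this[OF infdist_triangle zero_le_dist]
    have r': "?r \<le> ?s + dist x y" .
    have "emeasure lborel (Some -` B \<inter> ball x ?r)
      \<le> emeasure lborel ((Some -` B \<inter> ball y ?s) \<union> (ball x ?r - ball y ?s))"
      using B by (intro emeasure_mono) auto
    also have "\<dots> \<le> emeasure lborel (Some -` B \<inter> ball y ?s) + emeasure lborel (ball x ?r - ball y ?s)"
      using B by (intro emeasure_subadditive) auto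
    also have "\<dots> \<le> emeasure lborel (Some -` B \<inter> ball y ?s) + ennreal (4 * pi * \<alpha> * dist x y)"
      by (intro add_left_mono emeasure_ball_diff_le r r')
    finally have "?c * emeasure lborel (Some -` B \<inter> ball x ?r)
      \<le> ?c * (emeasure lborel (Some -` B \<inter> ball y ?s) + ennreal (4 * pi * \<alpha> * dist x y))"
      by (rule mult_left_mono) simp
    also have "\<dots> = ?c * emeasure lborel (Some -` B \<inter> ball y ?s) + ennreal (4 * dist x y / \<alpha>)"
      using \<alpha> by (simp add: distrib_left ennreal_mult[symmetric] power2_eq_square)
    finally show ?thesis
      using None by (simp add: emeasure_perturb[OF B refl])
  qed
  have Bb: "Some -` B \<in> sets borel" using B by (simp add: sets_perturb)
  show ?thesis
  proof (cases "None \<in> B")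
    case False
    then show ?thesis by (rule *[OF Bb])
  next
    case True
    interpret X: prob_space "perturb \<alpha> x" by (rule prob_space_perturb[OF \<alpha>])
    interpret Y: prob_space "perturb \<alpha> y" by (rule prob_space_perturb[OF \<alpha>])
    have By: "B \<in> sets (perturb \<alpha> y)" using B by (simp add: sets_perturb)
    have "Some -` (UNIV - B) = UNIV - Some -` B" by auto
    then have "emeasure (perturb \<alpha> y) (UNIV - B) \<le> emeasure (perturb \<alpha> x) (UNIV - B) + ennreal (4 * dist y x / \<alpha>)"
      using True Bb by (intro *) auto
    then have "ennreal (1 - measure (perturb \<alpha> y) B) \<le> ennreal (1 - measure (perturb \<alpha> x) B + 4 * dist x y / \<alpha>)"
      using X.prob_compl[OF B] Y.prob_compl[OF By] \<alpha>
      by (simp add: X.emeasure_eq_measure Y.emeasure_eq_measure dist_commute flip: ennreal_plus)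
    then have "1 - measure (perturb \<alpha> y) B \<le> 1 - measure (perturb \<alpha> x) B + 4 * dist x y / \<alpha>"
      using X.prob_le_1[of B] \<alpha> by (subst (asm) ennreal_le_iff) auto
    then show ?thesis
      using \<alpha> by (simp add: X.emeasure_eq_measure Y.emeasure_eq_measure flip: ennreal_plus)
  qed
qed

text \<open>The ball has area \<open>pi * r^2\<close> with \<open>r\<close> at most the distance to
  the diagonal, and the density is \<open>1 / (pi * \<alpha>^2)\<close>.\<close>

lemma measure_perturb_Some_le:
  assumes \<alpha>: "\<alpha> > 0"
  shows "measure (perturb \<alpha> x) {y. y \<noteq> None} \<le> (pers x)\<^sup>2 / 2 / \<alpha>\<^sup>2"
proof -
  let ?r = "min \<alpha> (infdist x diagonal)"
  interpret X: prob_space "perturb \<alpha> x" by (rule prob_space_perturb[OF \<alpha>])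
  have r: "0 \<le> ?r" using \<alpha> by (simp add: infdist_nonneg)
  have v: "Some -` {y. y \<noteq> None} = UNIV" by auto
  have "emeasure (perturb \<alpha> x) {y. y \<noteq> None} = ennreal (1 / (pi * \<alpha>\<^sup>2)) * ennreal (pi * ?r\<^sup>2)"
    by (subst emeasure_perturb[OF _ refl]) (simp_all only: v Int_UNIV_left emeasure_lborel_ball[OF r], simp_all)
  also have "\<dots> = ennreal (?r\<^sup>2 / \<alpha>\<^sup>2)" by (simp flip: ennreal_mult)
  finally have "measure (perturb \<alpha> x) {y. y \<noteq> None} = ?r\<^sup>2 / \<alpha>\<^sup>2"
    by (simp add: measure_def)
  also have "\<dots> \<le> (infdist x diagonal)\<^sup>2 / \<alpha>\<^sup>2"
    using r by (intro divide_right_mono power_mono) auto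
  finally show ?thesis by (simp only: infdist_diagonal_power2)
qed

subsection \<open>Couplings\<close>


lemma measure_perturbations_close:
  assumes \<alpha>: "\<alpha> > 0" and J: "finite J" and T: "T \<in> sets (perturbations \<alpha> J x)"
  shows "measure (perturbations \<alpha> J x) T
    \<le> measure (perturbations \<alpha> J y) T + (\<Sum>l\<in>J. 4 * dist (x l) (y l) / \<alpha>)"
proof -
  interpret X: prob_space "perturbations \<alpha> J x" by (rule perturbations_product(2)[OF \<alpha>])
  interpret Y: prob_space "perturbations \<alpha> J y" by (rule perturbations_product(2)[OF \<alpha>])
  have s0: "0 \<le> (\<Sum>l\<in>J. 4 * dist (x l) (y l) / \<alpha>)" using \<alpha> by (intro sum_nonneg) simp
  have "emeasure (perturbations \<alpha> J x) T
    \<le> emeasure (perturbations \<alpha> J y) T + ennreal (\<Sum>l\<in>J. 4 * dist (x l) (y l) / \<alpha>)"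
    unfolding perturbations_def
    by (rule emeasure_PiM_le_add)
      (use \<alpha> J T emeasure_perturb_close[OF \<alpha>] in
        \<open>auto simp: sets_perturb perturbations_def intro: prob_space_perturb\<close>)
  then have "ennreal (measure (perturbations \<alpha> J x) T)
    \<le> ennreal (measure (perturbations \<alpha> J y) T + (\<Sum>l\<in>J. 4 * dist (x l) (y l) / \<alpha>))"
    unfolding X.emeasure_eq_measure Y.emeasure_eq_measure using s0 by (simp add: ennreal_plus)
  then show ?thesis using s0 by (subst (asm) ennreal_le_iff) auto
qed

text \<open>Unless a point outside \<open>f ` J\<close> survives the perturbation, the random grouping of \<open>L\<close> is the
  relabelled random grouping of \<open>J\<close>.\<close>

lemma measure_relabel_le:
  assumes \<alpha>: "\<alpha> > 0" and N: "N > 0" and L: "finite L" "\<And>l. l \<in> L \<Longrightarrow> fst l < N"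
    and f: "inj_on f J" "f ` J \<subseteq> L" "\<And>l. l \<in> J \<Longrightarrow> fst (f l) = fst l" and S: "finite S"
  shows "measure (perturbations \<alpha> J (\<lambda>l. x (f l)))
      {\<omega> \<in> space (perturbations \<alpha> J (\<lambda>l. x (f l))). \<exists>g\<in>S. grouping_of_outcome N J \<omega> = Some g}
    \<le> (\<Sum>g\<in>S. grouping_law N \<alpha> L x (relabel f ` g \<union> trivial_selection ` (L - f ` J)))
      + (\<Sum>l\<in>L - f ` J. (pers (x l))\<^sup>2 / 2) / \<alpha>\<^sup>2"
proof -
  let ?P = "perturbations \<alpha> L x" and ?Q = "perturbations \<alpha> J (\<lambda>l. x (f l))"
  let ?E = "\<lambda>g. relabel f ` g \<union> trivial_selection ` (L - f ` J)"
  let ?r = "\<lambda>\<omega>. \<lambda>n\<in>J. \<omega> (f n)"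
  interpret P: prob_space ?P by (rule perturbations_product(2)[OF \<alpha>])
  have J: "finite J" "\<And>l. l \<in> J \<Longrightarrow> fst l < N"
  proof -
    show "finite J" using finite_subset[OF f(2) L(1)] f(1) by (rule finite_imageD)
    show "fst l < N" if "l \<in> J" for l using L(2)[of "f l"] f(2,3) that by auto
  qed
  define T where "T = {\<omega> \<in> space ?Q. \<exists>g\<in>S. grouping_of_outcome N J \<omega> = Some g}"
  have T: "T \<in> sets ?Q"
    unfolding T_def pred_def[symmetric] by (rule pred_grouping_of_outcome_in[OF J(1) _ N S]) (rule J(2))
  \<comment> \<open>Reading off the coordinates in the image of \<open>J\<close> turns independent
    perturbations of \<open>L\<close> into independent perturbations of \<open>J\<close> around the
    same centres.\<close>
  have D: "distr ?P ?Q ?r = ?Q"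
    unfolding perturbations_def
    by (rule distr_PiM_reindex[of L "\<lambda>l. perturb \<alpha> (x l)" f J]) (use f \<alpha> in \<open>auto intro: prob_space_perturb\<close>)
  have r: "?r \<in> ?P \<rightarrow>\<^sub>M ?Q"
    unfolding perturbations_def
  proof (rule measurable_restrict)
    fix n assume "n \<in> J"
    then have "f n \<in> L" using f(2) by blast
    then show "(\<lambda>\<omega>. \<omega> (f n)) \<in> (\<Pi>\<^sub>M l\<in>L. perturb \<alpha> (x l)) \<rightarrow>\<^sub>M perturb \<alpha> (x (f n))"
      by (rule measurable_component_singleton)
  qed
  define H where "H g = {\<omega> \<in> space ?P. grouping_of_outcome N L \<omega> = Some (?E g)}" for g
  define U where "U l = {\<omega> \<in> space ?P. \<not> \<omega> l = None}" for l
  have H: "H g \<in> sets ?P" for g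
    unfolding H_def pred_def[symmetric] by (rule pred_grouping_of_outcome[OF L(1) _ N]) (rule L(2))
  have U: "U l \<in> sets ?P" if "l \<in> L" for l
    unfolding U_def pred_def[symmetric] by (intro pred_intros_logic pred_None that)
  have mU: "measure ?P (U l) \<le> (pers (x l))\<^sup>2 / 2 / \<alpha>\<^sup>2" if l: "l \<in> L" for l
  proof -
    have D: "distr ?P (perturb \<alpha> (x l)) (\<lambda>\<omega>. \<omega> l) = perturb \<alpha> (x l)"
      unfolding perturbations_def
      by (rule distr_PiM_component[OF _ l]) (rule prob_space_perturb[OF \<alpha>])
    have v: "Some -` {y. y \<noteq> None} = UNIV" by auto
    have "measure (perturb \<alpha> (x l)) {y. y \<noteq> None} = measure (distr ?P (perturb \<alpha> (x l)) (\<lambda>\<omega>. \<omega> l)) {y. y \<noteq> None}"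
      by (simp only: D)
    also have "\<dots> = measure ?P ((\<lambda>\<omega>. \<omega> l) -` {y. y \<noteq> None} \<inter> space ?P)"
      by (rule measure_distr[OF measurable_coordinate[OF l]]) (simp only: sets_perturb mem_Collect_eq v, simp)
    also have "(\<lambda>\<omega>. \<omega> l) -` {y. y \<noteq> None} \<inter> space ?P = U l" by (auto simp: U_def)
    finally show ?thesis using measure_perturb_Some_le[OF \<alpha>, of "x l"] by simp
  qed
  have "measure ?Q T = measure (distr ?P ?Q ?r) T" by (simp only: D)
  also have "\<dots> = measure ?P (?r -` T \<inter> space ?P)" by (rule measure_distr[OF r T])
  also have "\<dots> \<le> measure ?P ((\<Union>g\<in>S. H g) \<union> (\<Union>l\<in>L - f ` J. U l))"
  proof (rule P.finite_measure_mono)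
    \<comment> \<open>If no point outside the image survives, the outcome of \<open>L\<close> is the
      relabelled outcome of \<open>J\<close>; otherwise it lies in some \<open>U l\<close>.\<close>
    show "?r -` T \<inter> space ?P \<subseteq> (\<Union>g\<in>S. H g) \<union> (\<Union>l\<in>L - f ` J. U l)"
    proof
      fix \<omega> assume "\<omega> \<in> ?r -` T \<inter> space ?P"
      then obtain g where g: "g \<in> S" "grouping_of_outcome N J (?r \<omega>) = Some g" "\<omega> \<in> space ?P"
        unfolding T_def by blast
      show "\<omega> \<in> (\<Union>g\<in>S. H g) \<union> (\<Union>l\<in>L - f ` J. U l)"
      proof (cases "\<exists>l\<in>L - f ` J. \<not> \<omega> l = None")
        case True
        then show ?thesis using g(3) by (auto simp: U_def simp del: not_None_eq)
      next
        case False
        have "grouping_of_outcome N L \<omega> = Some (?E g)"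
        proof (rule grouping_of_outcome_relabel[OF f(1,2)])
          show "grouping_of_outcome N J (?r \<omega>) = Some g" by (rule g(2))
          show "?r \<omega> l = \<omega> (f l)" if "l \<in> J" for l using that by simp
          show "\<omega> l = None" if "l \<in> L - f ` J" for l using False that by blast
        qed (rule f(3))
        then show ?thesis using g by (auto simp: H_def)
      qed
    qed
    show "(\<Union>g\<in>S. H g) \<union> (\<Union>l\<in>L - f ` J. U l) \<in> P.events"
      using S L H U by (intro sets.Un sets.finite_UN) auto
  qed
  also have "\<dots> \<le> measure ?P (\<Union>g\<in>S. H g) + measure ?P (\<Union>l\<in>L - f ` J. U l)"
    using S L H U by (intro measure_Un_le sets.finite_UN) auto
  also have "\<dots> \<le> (\<Sum>g\<in>S. measure ?P (H g)) + (\<Sum>l\<in>L - f ` J. measure ?P (U l))"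
    using S L H U by (intro add_mono P.finite_measure_subadditive_finite) auto
  also have "\<dots> \<le> (\<Sum>g\<in>S. measure ?P (H g)) + (\<Sum>l\<in>L - f ` J. (pers (x l))\<^sup>2 / 2 / \<alpha>\<^sup>2)"
    using mU by (intro add_left_mono sum_mono) auto
  finally show ?thesis by (simp add: T_def H_def grouping_law_def sum_divide_distrib)
qed

text \<open>The coupling keeps the common part \<open>m\<close> on the matched pairs and takes the product of the
  remainders; if no mass remains then both remainders vanish, in agreement with division by \<open>0\<close>.\<close>

lemma finite_coupling:
  fixes p :: "'a \<Rightarrow> real" and q :: "'b \<Rightarrow> real" and m :: "'t \<Rightarrow> real"
  assumes A: "finite A" "(\<Sum>u\<in>A. p u) = 1" and B: "finite B" "(\<Sum>v\<in>B. q v) = 1"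
    and pq: "\<And>u. u \<in> A \<Longrightarrow> 0 \<le> p u" "\<And>v. v \<in> B \<Longrightarrow> 0 \<le> q v"
    and T: "finite T" "a ` T \<subseteq> A" "b ` T \<subseteq> B" "inj_on a T" "inj_on b T"
    and m: "\<And>t. t \<in> T \<Longrightarrow> 0 \<le> m t" "\<And>t. t \<in> T \<Longrightarrow> m t \<le> p (a t)" "\<And>t. t \<in> T \<Longrightarrow> m t \<le> q (b t)"
  shows "\<exists>w. (\<forall>u\<in>A. \<forall>v\<in>B. 0 \<le> w u v) \<and> (\<forall>u\<in>A. (\<Sum>v\<in>B. w u v) = p u) \<and>
    (\<forall>v\<in>B. (\<Sum>u\<in>A. w u v) = q v) \<and> (\<Sum>t\<in>T. m t) \<le> (\<Sum>t\<in>T. w (a t) (b t))"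
proof -
  define \<theta> where "\<theta> = (\<Sum>t\<in>T. m t)"
  \<comment> \<open>\<open>d\<close> is the common part placed on the matched pairs; \<mu> and \<nu>
    are its marginals and \<theta> is its mass.\<close>
  define d where "d u v = (\<Sum>t\<in>T. if a t = u \<and> b t = v then m t else 0)" for u v
  define \<mu> where "\<mu> u = (\<Sum>t\<in>T. if a t = u then m t else 0)" for u
  define \<nu> where "\<nu> v = (\<Sum>t\<in>T. if b t = v then m t else 0)" for v
  \<comment> \<open>By injectivity at most one index contributes, so the marginals stay below
    \<open>p\<close> and \<open>q\<close>.\<close>
  have single: "(\<Sum>t\<in>T. if c t = u then m t else 0) \<le> z"
    if "inj_on c T" "\<And>t. t \<in> T \<Longrightarrow> c t = u \<Longrightarrow> m t \<le> z" "0 \<le> z" for c :: "'t \<Rightarrow> 'c" and u z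
  proof (cases "\<exists>t\<in>T. c t = u")
    case True
    then obtain t where t: "t \<in> T" "c t = u" by blast
    have "(\<Sum>t'\<in>T. if c t' = u then m t' else 0) = (\<Sum>t'\<in>T. if t' = t then m t else 0)"
      using t inj_onD[OF that(1)] by (intro sum.cong) auto
    then show ?thesis using t that(2) T(1) by simp
  next
    case False
    then have "(\<Sum>t\<in>T. if c t = u then m t else 0) = 0" by (intro sum.neutral) auto
    then show ?thesis using that(3) by simp
  qed
  have \<mu>: "\<mu> u \<le> p u" if "u \<in> A" for u
    unfolding \<mu>_def using T m pq that by (intro single) auto
  have \<nu>: "\<nu> v \<le> q v" if "v \<in> B" for v
    unfolding \<nu>_def using T m pq that by (intro single) auto
  have s\<mu>: "(\<Sum>u\<in>A. \<mu> u) = \<theta>"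
    unfolding \<mu>_def \<theta>_def using T A by (subst sum.swap) (auto intro!: sum.cong)
  have s\<nu>: "(\<Sum>v\<in>B. \<nu> v) = \<theta>"
    unfolding \<nu>_def \<theta>_def using T B by (subst sum.swap) (auto intro!: sum.cong)
  have dv: "(\<Sum>v\<in>B. d u v) = \<mu> u" for u
    unfolding d_def \<mu>_def using T B by (subst sum.swap) (auto intro!: sum.cong simp: sum.delta' if_distrib cong: if_cong)
  have du: "(\<Sum>u\<in>A. d u v) = \<nu> v" for v
    unfolding d_def \<nu>_def using T A by (subst sum.swap) (auto intro!: sum.cong simp: sum.delta' if_distrib cong: if_cong)
  have d0: "0 \<le> d u v" for u v unfolding d_def using m(1) by (intro sum_nonneg) auto
  have \<theta>1: "\<theta> \<le> 1" using sum_mono[of A \<mu> p, OF \<mu>] by (simp add: s\<mu> A)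
  have rp: "(\<Sum>u\<in>A. p u - \<mu> u) = 1 - \<theta>" "(\<Sum>v\<in>B. q v - \<nu> v) = 1 - \<theta>"
    by (simp_all add: sum_subtractf s\<mu> s\<nu> A B)
  have zero: "p u - \<mu> u = 0" if "\<theta> = 1" "u \<in> A" for u
    using sum_nonneg_eq_0_iff[OF A(1), of "\<lambda>u. p u - \<mu> u"] rp(1) that \<mu> by auto
  have zero': "q v - \<nu> v = 0" if "\<theta> = 1" "v \<in> B" for v
    using sum_nonneg_eq_0_iff[OF B(1), of "\<lambda>v. q v - \<nu> v"] rp(2) that \<nu> by auto
  define w where "w u v = d u v + (p u - \<mu> u) * (q v - \<nu> v) / (1 - \<theta>)" for u v
  show ?thesis
  proof (intro exI[of _ w] conjI ballI)
    show "0 \<le> w u v" if "u \<in> A" "v \<in> B" for u v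
      unfolding w_def using that d0 \<mu> \<nu> \<theta>1 by (intro add_nonneg_nonneg divide_nonneg_nonneg mult_nonneg_nonneg) auto
    show "(\<Sum>v\<in>B. w u v) = p u" if "u \<in> A" for u
    proof -
      have "(\<Sum>v\<in>B. w u v) = \<mu> u + (p u - \<mu> u) * (1 - \<theta>) / (1 - \<theta>)"
        unfolding w_def by (simp add: sum.distrib dv rp flip: sum_divide_distrib sum_distrib_left)
      then show ?thesis using zero[OF _ that] by (cases "\<theta> = 1") auto
    qed
    show "(\<Sum>u\<in>A. w u v) = q v" if "v \<in> B" for v
    proof -
      have "(\<Sum>u\<in>A. w u v) = \<nu> v + (1 - \<theta>) * (q v - \<nu> v) / (1 - \<theta>)"
        unfolding w_def by (simp add: sum.distrib du rp flip: sum_divide_distrib sum_distrib_right)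
      then show ?thesis using zero'[OF _ that] by (cases "\<theta> = 1") auto
    qed
    show "(\<Sum>t\<in>T. m t) \<le> (\<Sum>t\<in>T. w (a t) (b t))"
    proof (rule sum_mono)
      fix t assume t: "t \<in> T"
      have "m t = (\<Sum>t'\<in>{t}. if a t' = a t \<and> b t' = b t then m t' else 0)" by simp
      also have "\<dots> \<le> d (a t) (b t)"
        unfolding d_def using T(1) t m(1) by (intro sum_mono2) auto
      also have "\<dots> \<le> w (a t) (b t)"
        unfolding w_def using T t \<mu> \<nu> \<theta>1 by (simp add: image_subset_iff)
      finally show "m t \<le> w (a t) (b t)" .
    qed
  qed
qed

text \<open>The integral of a non-measurable \<open>f\<close> is the supremum over the simple functions below \<open>f\<close>, hence only
  an inequality.\<close>

lemma nn_integral_distr_le: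
  assumes T: "T \<in> M \<rightarrow>\<^sub>M M'"
  shows "integral\<^sup>N (distr M M' T) f \<le> (\<integral>\<^sup>+ x. f (T x) \<partial>M)"
  unfolding nn_integral_def[of "distr M M' T"]
proof (rule SUP_least)
  fix g assume "g \<in> {g. simple_function (distr M M' T) g \<and> g \<le> f}"
  then have g: "simple_function (distr M M' T) g" "g \<le> f" by auto
  then have "g \<in> borel_measurable M'" using borel_measurable_simple_function[OF g(1)] by simp
  then have "integral\<^sup>S (distr M M' T) g = (\<integral>\<^sup>+ x. g (T x) \<partial>M)"
    using nn_integral_eq_simple_integral[OF g(1)] nn_integral_distr[OF T] by simp
  also have "\<dots> \<le> (\<integral>\<^sup>+ x. f (T x) \<partial>M)" using g(2) by (intro nn_integral_mono) (auto simp: le_fun_def)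
  finally show "integral\<^sup>S (distr M M' T) g \<le> (\<integral>\<^sup>+ x. f (T x) \<partial>M)" .
qed

subsection \<open>The probabilistic Frechet mean as a measure\<close>


lemma dgm_spaceD:
  assumes "X \<in> dgm_space M n"
  shows "finite (offdiag X)" "card (offdiag X) \<le> n"
    "z \<in> offdiag X \<Longrightarrow> 0 \<le> fst (fst z) \<and> snd (fst z) \<le> M"
    "z \<in> offdiag X \<Longrightarrow> 0 < pers (fst z) \<and> pers (fst z) \<le> M"
proof -
  show "finite (offdiag X)" "card (offdiag X) \<le> n" using assms by (simp_all add: dgm_space_def)
  have *: "0 \<le> fst (fst z) \<and> snd (fst z) \<le> M" if "z \<in> offdiag X" for z
    using assms that by (auto simp: dgm_space_def)
  show "z \<in> offdiag X \<Longrightarrow> 0 \<le> fst (fst z) \<and> snd (fst z) \<le> M" by (rule *)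
  show "z \<in> offdiag X \<Longrightarrow> 0 < pers (fst z) \<and> pers (fst z) \<le> M"
    using *[of z] by (auto simp: mem_offdiag_iff pers_def)
qed

text \<open>Sending everything to the diagonal costs at most \<open>M^2 / 2\<close> per point, with
  at most \<open>n\<close> points on each side. The bound serves to show that the diameter is
  finite.\<close>

lemma W2_dgm_space_le:
  assumes "U \<in> dgm_space M n" "V \<in> dgm_space M n"
  shows "W2 U V \<le> ennreal (sqrt (n * M\<^sup>2))"
proof -
  have half: "(\<Sum>z\<in>offdiag Z. (pers (fst z))\<^sup>2 / 2) \<le> n * M\<^sup>2 / 2" if "Z \<in> dgm_space M n" for Z
  proof -
    have "(\<Sum>z\<in>offdiag Z. (pers (fst z))\<^sup>2 / 2) \<le> (\<Sum>z\<in>offdiag Z. M\<^sup>2 / 2)"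
      using dgm_spaceD(4)[OF that] by (intro sum_mono divide_right_mono power_mono) (auto simp: less_imp_le)
    also have "\<dots> \<le> n * (M\<^sup>2 / 2)"
      using dgm_spaceD(2)[OF that] by (simp add: mult_right_mono)
    finally show ?thesis by simp
  qed
  have "(W2 U V)\<^sup>2 \<le> ennreal (partial_cost fst (offdiag U) fst (offdiag V) {})"
    unfolding W2_partial[OF dgm_spaceD(1)[OF assms(1)] dgm_spaceD(1)[OF assms(2)]]
    by (rule INF_lower) (rule empty_partial_matching)
  also have "\<dots> \<le> ennreal (n * M\<^sup>2)"
  proof (rule ennreal_leI)
    have "partial_cost fst (offdiag U) fst (offdiag V) {} \<le> n * M\<^sup>2 / 2 + n * M\<^sup>2 / 2"
      unfolding partial_cost_def image_empty Diff_empty sum.empty add_0_left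
      by (rule add_mono[OF half[OF assms(1)] half[OF assms(2)]])
    then show "partial_cost fst (offdiag U) fst (offdiag V) {} \<le> n * M\<^sup>2"
      by (simp only: field_sum_of_halves)
  qed
  also have "\<dots> = (ennreal (sqrt (n * M\<^sup>2)))\<^sup>2"
    by (subst ennreal_power) (simp_all only: real_sqrt_ge_0_iff real_sqrt_pow2 zero_le_mult_iff zero_le_power2 of_nat_0_le_iff simp_thms)
  finally show ?thesis unfolding ennreal_le_power2_iff[of "W2 U V"] .
qed

lemma W2_le_max_W2:
  assumes "U \<in> dgm_space M n" "V \<in> dgm_space M n"
  shows "W2 U V \<le> ennreal (max_W2 M n)"
proof -
  let ?S = "SUP U\<in>dgm_space M n. SUP V\<in>dgm_space M n. W2 U V"
  have "?S \<le> ennreal (sqrt (n * M\<^sup>2))"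
    by (intro SUP_least W2_dgm_space_le)
  \<comment> \<open>\<open>enn2real\<close> would turn an infinite supremum into 0, so finiteness
    has to come first.\<close>
  then have "?S < \<top>" by (rule le_less_trans) simp
  then have "ennreal (max_W2 M n) = ?S" by (simp add: max_W2_def)
  moreover have "W2 U V \<le> ?S"
    by (rule SUP_upper2[OF assms(1)]) (rule SUP_upper[OF assms(2)])
  ultimately show ?thesis by simp
qed

lemma labels_dgm_space:
  assumes X: "X \<in> {..<N} \<rightarrow> dgm_space M K"
  shows "finite (labels N X)" "card (labels N X) \<le> N * K"
    "l \<in> labels N X \<Longrightarrow> fst l < N" "l \<in> labels N X \<Longrightarrow> 0 < pers (loc l)"
    "l \<in> labels N X \<Longrightarrow> 0 \<le> fst (loc l) \<and> snd (loc l) \<le> M"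
proof -
  have Xi: "X i \<in> dgm_space M K" if "i < N" for i using X that by auto
  show "finite (labels N X)" unfolding labels_def using dgm_spaceD(1)[OF Xi] by auto
  have "card (labels N X) = (\<Sum>i<N. card (offdiag (X i)))"
    unfolding labels_def using dgm_spaceD(1)[OF Xi] by (subst card_SigmaI) auto
  also have "\<dots> \<le> (\<Sum>i<N. K)" using dgm_spaceD(2)[OF Xi] by (intro sum_mono) auto
  finally show "card (labels N X) \<le> N * K" by simp
  assume "l \<in> labels N X"
  then have "fst l < N" "snd l \<in> offdiag (X (fst l))" by (auto simp: labels_def)
  then show "fst l < N" "0 < pers (loc l)" "0 \<le> fst (loc l) \<and> snd (loc l) \<le> M"
    using dgm_spaceD(3,4)[OF Xi] by (auto simp: loc_def)
qed

text \<open>The mean averages \<open>csum\<close> over \<open>card (ran s)\<close> entries but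
  \<open>pers\<close> over \<open>N\<close>. As persistences are positive, the larger denominator
  only moves the mean towards the diagonal, so it stays in the square.\<close>

lemma mean_diagram_dgm_space:
  assumes X: "X \<in> {..<N} \<rightarrow> dgm_space M K" and G: "is_grouping N (labels N X) G"
  shows "mean_diagram N loc G \<in> dgm_space M (N * K)"
proof -
  note L = labels_dgm_space[OF X]
  note finG = finite_groupings(2)[OF L(1) G]
  have mean: "0 < pers (mean N loc s)" "0 \<le> fst (mean N loc s)" "snd (mean N loc s) \<le> M" if s: "s \<in> G" for s
  proof -
    note sel = is_groupingD[OF G s]
    have ran: "l \<in> labels N X" if "l \<in> ran s" for l using selection_ran(2)[OF sel(1)] that by blast
    let ?c = "\<Sum>l\<in>ran s. csum (loc l)" and ?p = "\<Sum>l\<in>ran s. pers (loc l)" and ?k = "real (card (ran s))"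
    have k: "0 < ?k" "?k \<le> N" using selection_ran[OF sel(1)] sel(2) by (auto simp: card_gt_0_iff)
    show "0 < pers (mean N loc s)" by (rule pers_mean_pos[OF sel]) (rule L(4))
    have p0: "0 \<le> ?p" using L(4) ran by (intro sum_nonneg) (auto intro: less_imp_le)
    have "?p \<le> ?c" using L(5) ran by (intro sum_mono) (auto simp: pers_def csum_def)
    then have "?p / ?k \<le> ?c / ?k" using k by (simp add: divide_right_mono)
    moreover have pk: "?p / N \<le> ?p / ?k" using p0 k by (intro divide_left_mono) auto
    ultimately have "pers (mean N loc s) \<le> csum (mean N loc s)" unfolding mean_coords[OF sel] by simp
    then show "0 \<le> fst (mean N loc s)" by (simp add: pers_def csum_def)
    have "?c + ?p = (\<Sum>l\<in>ran s. 2 * snd (loc l))"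
      by (simp add: pers_def csum_def flip: sum.distrib)
    also have "\<dots> \<le> (\<Sum>l\<in>ran s. 2 * M)" using L(5) ran by (intro sum_mono) auto
    finally have "(?c + ?p) / ?k \<le> 2 * M" using k by (simp add: divide_le_eq mult.commute)
    then have "?c / ?k + ?p / N \<le> 2 * M" using pk by (simp add: add_divide_distrib)
    then have "csum (mean N loc s) + pers (mean N loc s) \<le> 2 * M" unfolding mean_coords[OF sel] .
    then show "snd (mean N loc s) \<le> M" by (simp add: pers_def csum_def)
  qed
  have "\<exists>e. bij_betw e G (offdiag (mean_diagram N loc G)) \<and> (\<forall>s. fst (e s) = mean N loc s)"
    unfolding mean_diagram_def by (rule labelled_offdiag[OF finG mean(1)])
  then obtain e where e: "bij_betw e G (offdiag (mean_diagram N loc G))" "\<And>s. fst (e s) = mean N loc s" by auto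
  have im: "offdiag (mean_diagram N loc G) = e ` G" using e(1) by (simp add: bij_betw_def)
  have "card (e ` G) \<le> N * K"
    using card_image_le[OF finG, of e] card_grouping_le[OF G L(1)] L(2) by linarith
  moreover have "\<forall>(p, k)\<in>e ` G. 0 \<le> fst p \<and> fst p \<le> M \<and> 0 \<le> snd p \<and> snd p \<le> M"
  proof (intro ballI, clarify)
    fix p k s assume s: "(p, k) = e s" "s \<in> G"
    then have "p = mean N loc s" using e(2)[of s] by (metis fst_conv)
    then show "0 \<le> fst p \<and> fst p \<le> M \<and> 0 \<le> snd p \<and> snd p \<le> M"
      using mean[OF s(2)] by (simp add: pers_def)
  qed
  ultimately show ?thesis unfolding dgm_space_def mem_Collect_eq im using finG by blast
qed

lemma space_dgm_borel: "space (dgm_borel M n) = dgm_space M n"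
  by (auto simp: dgm_borel_def dgm_open_def space_measure_of_conv)

lemma space_pfm: "space (pfm N K M \<alpha> X) = dgm_space M (N * K)"
  using sets_eq_imp_space_eq[OF sets_pfm[of N K M \<alpha> X]] by (simp add: space_dgm_borel)

lemma prob_grouping_eq_law: "prob_grouping N \<alpha> X = grouping_law N \<alpha> (labels N X) loc"
  by (rule ext) (simp add: prob_grouping_def Let_def grouping_law_def perturbations_def)

lemma pfm_in_dgm_prob:
  assumes "N \<ge> 1" "\<alpha> > 0" and X: "X \<in> {..<N} \<rightarrow> dgm_space M K"
  shows "pfm N K M \<alpha> X \<in> dgm_prob M (N * K)"
proof -
  note L = labels_dgm_space[OF X]
  let ?\<nu> = "pfm N K M \<alpha> X"
  have "emeasure ?\<nu> (space ?\<nu>) = (\<Sum>G\<in>{G. is_grouping N (labels N X) G}. ennreal (prob_grouping N \<alpha> X G))"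
  proof -
    have sp: "space ?\<nu> \<in> sets (dgm_borel M (N * K))" by (simp add: space_pfm flip: space_dgm_borel)
    show ?thesis
      unfolding emeasure_pfm[OF sp] using mean_diagram_dgm_space[OF X]
      by (intro sum.cong) (auto simp: space_pfm)
  qed
  also have "\<dots> = ennreal (\<Sum>G\<in>{G. is_grouping N (labels N X) G}. prob_grouping N \<alpha> X G)"
    by (rule sum_ennreal) (simp add: prob_grouping_def Let_def)
  also have "(\<Sum>G\<in>{G. is_grouping N (labels N X) G}. prob_grouping N \<alpha> X G) = 1"
    unfolding prob_grouping_eq_law
    by (rule sum_grouping_law_eq_1[OF assms(2) L(1) L(3) _ L(4)]) (use assms in simp_all)
  finally interpret prob_space ?\<nu> by (intro prob_spaceI) simp
  have "(\<integral>\<^sup>+ V. (W2 U V)\<^sup>2 \<partial>?\<nu>) < \<infinity>" if "U \<in> dgm_space M (N * K)" for U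
  proof -
    have "(\<integral>\<^sup>+ V. (W2 U V)\<^sup>2 \<partial>?\<nu>) \<le> (\<integral>\<^sup>+ V. (ennreal (max_W2 M (N * K)))\<^sup>2 \<partial>?\<nu>)"
      using W2_le_max_W2[OF that] by (intro nn_integral_mono power_mono) (auto simp: space_pfm)
    also have "\<dots> < \<infinity>" by (simp add: emeasure_space_1 power_less_top_ennreal)
    finally show ?thesis .
  qed
  then show ?thesis
    unfolding dgm_prob_def using prob_space_axioms sets_pfm by blast
qed

text \<open>One statement for both marginals of the coupling: \<open>h\<close> will be the first or
  the second projection from pairs of groupings, and summing over its fibres recovers the
  probabilities of the groupings.\<close>

lemma distr_point_measure_pfm:
  assumes X: "X \<in> {..<N} \<rightarrow> dgm_space M K" and A: "A = {G. is_grouping N (labels N X) G}"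
    and I: "finite I" "h ` I \<subseteq> A" and v: "\<And>i. i \<in> I \<Longrightarrow> 0 \<le> v i"
    and sum_v: "\<And>u. u \<in> A \<Longrightarrow> (\<Sum>i\<in>{i \<in> I. h i = u}. v i) = prob_grouping N \<alpha> X u"
  shows "distr (point_measure I (\<lambda>i. ennreal (v i))) (pfm N K M \<alpha> X) (\<lambda>i. mean_diagram N loc (h i))
    = pfm N K M \<alpha> X" (is "distr ?W ?\<nu> ?T = _")
proof (rule measure_eqI)
  fix S assume "S \<in> sets (distr ?W ?\<nu> ?T)"
  then have S: "S \<in> sets ?\<nu>" "S \<in> sets (dgm_borel M (N * K))" by (simp_all add: sets_pfm)
  have finA: "finite A" unfolding A by (rule finite_groupings(1)[OF labels_dgm_space(1)[OF X]])
  have "?T i \<in> space ?\<nu>" if "i \<in> I" for i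
    using mean_diagram_dgm_space[OF X, of "h i"] I(2) that by (auto simp: A space_pfm)
  then have T: "?T \<in> ?W \<rightarrow>\<^sub>M ?\<nu>"
    by (auto simp: measurable_def sets_point_measure space_point_measure)
  let ?A = "{u \<in> A. mean_diagram N loc u \<in> S}"
  have "emeasure (distr ?W ?\<nu> ?T) S = emeasure ?W {i \<in> I. ?T i \<in> S}"
    unfolding emeasure_distr[OF T S(1)] by (rule arg_cong[where f = "emeasure ?W"]) (auto simp: space_point_measure)
  also have "\<dots> = (\<Sum>i\<in>{i \<in> I. ?T i \<in> S}. ennreal (v i))"
    by (rule emeasure_point_measure_finite[OF I(1)]) simp
  also have "\<dots> = (\<Sum>u\<in>?A. \<Sum>i\<in>{i \<in> {i \<in> I. ?T i \<in> S}. h i = u}. ennreal (v i))"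
    using I finA by (intro sum.group[symmetric]) auto
  also have "\<dots> = (\<Sum>u\<in>?A. ennreal (prob_grouping N \<alpha> X u))"
  proof (rule sum.cong[OF refl])
    fix u assume u: "u \<in> ?A"
    then have "{i \<in> {i \<in> I. ?T i \<in> S}. h i = u} = {i \<in> I. h i = u}" by auto
    then show "(\<Sum>i\<in>{i \<in> {i \<in> I. ?T i \<in> S}. h i = u}. ennreal (v i)) = ennreal (prob_grouping N \<alpha> X u)"
      using sum_v[of u] u sum_ennreal[of "{i \<in> I. h i = u}" v] v by simp
  qed
  also have "\<dots> = (\<Sum>u\<in>A. ennreal (prob_grouping N \<alpha> X u) * indicator S (mean_diagram N loc u))"
    using finA by (intro sum.mono_neutral_cong_left) (auto simp: indicator_def)
  also have "\<dots> = emeasure ?\<nu> S" by (simp only: emeasure_pfm[OF S(2)] A)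
  finally show "emeasure (distr ?W ?\<nu> ?T) S = emeasure ?\<nu> S" .
qed simp

text \<open>Couplings are built on the finite set of pairs of groupings and pushed forward to pairs
  of diagrams by taking means.\<close>

lemma WW2_pfm_le:
  assumes "N \<ge> 1" "\<alpha> > 0" and X: "X \<in> {..<N} \<rightarrow> dgm_space M K" and Y: "Y \<in> {..<N} \<rightarrow> dgm_space M K"
    and A: "A = {G. is_grouping N (labels N X) G}" and B: "B = {G. is_grouping N (labels N Y) G}"
    and w: "\<And>u v. u \<in> A \<Longrightarrow> v \<in> B \<Longrightarrow> 0 \<le> w u v"
      "\<And>u. u \<in> A \<Longrightarrow> (\<Sum>v\<in>B. w u v) = prob_grouping N \<alpha> X u"
      "\<And>v. v \<in> B \<Longrightarrow> (\<Sum>u\<in>A. w u v) = prob_grouping N \<alpha> Y v"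
  shows "(WW2 (pfm N K M \<alpha> X) (pfm N K M \<alpha> Y))\<^sup>2
    \<le> (\<Sum>(u, v)\<in>A \<times> B. ennreal (w u v) * (W2 (mean_diagram N loc u) (mean_diagram N loc v))\<^sup>2)"
proof -
  let ?\<nu> = "pfm N K M \<alpha> X" and ?\<eta> = "pfm N K M \<alpha> Y"
  let ?W = "point_measure (A \<times> B) (\<lambda>(u, v). ennreal (w u v))"
  let ?T = "\<lambda>(u, v). (mean_diagram N loc u, mean_diagram N loc v)"
  define \<gamma> where "\<gamma> = distr ?W (?\<nu> \<Otimes>\<^sub>M ?\<eta>) ?T"
  have fin: "finite A" "finite B" "finite (A \<times> B)"
    using finite_groupings(1) labels_dgm_space(1) X Y unfolding A B by blast+
  have mX: "mean_diagram N loc u \<in> space ?\<nu>" if "u \<in> A" for u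
    using mean_diagram_dgm_space[OF X] that by (simp add: A space_pfm)
  have mY: "mean_diagram N loc v \<in> space ?\<eta>" if "v \<in> B" for v
    using mean_diagram_dgm_space[OF Y] that by (simp add: B space_pfm)
  have T: "?T \<in> ?W \<rightarrow>\<^sub>M ?\<nu> \<Otimes>\<^sub>M ?\<eta>"
    using mX mY by (auto simp: measurable_def space_pair_measure sets_point_measure space_point_measure)
  have W: "?W = point_measure (A \<times> B) (\<lambda>i. ennreal (w (fst i) (snd i)))"
    by (simp only: case_prod_beta')
  have "distr \<gamma> ?\<nu> fst = distr ?W ?\<nu> (fst \<circ> ?T)"
    unfolding \<gamma>_def by (rule distr_distr[OF measurable_fst T])
  also have "\<dots> = distr ?W ?\<nu> (\<lambda>i. mean_diagram N loc (fst i))"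
    by (simp add: comp_def case_prod_beta)
  also have "\<dots> = ?\<nu>"
    unfolding W
  proof (rule distr_point_measure_pfm[OF X A fin(3)])
    fix u assume u: "u \<in> A"
    have "{i \<in> A \<times> B. fst i = u} = Pair u ` B" using u by auto
    then show "(\<Sum>i\<in>{i \<in> A \<times> B. fst i = u}. w (fst i) (snd i)) = prob_grouping N \<alpha> X u"
      using w(2)[OF u] by (simp add: sum.reindex inj_on_def)
  qed (use w(1) in auto)
  finally have fst: "distr \<gamma> ?\<nu> fst = ?\<nu>" .
  have "distr \<gamma> ?\<eta> snd = distr ?W ?\<eta> (snd \<circ> ?T)"
    unfolding \<gamma>_def by (rule distr_distr[OF measurable_snd T])
  also have "\<dots> = distr ?W ?\<eta> (\<lambda>i. mean_diagram N loc (snd i))"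
    by (simp add: comp_def case_prod_beta)
  also have "\<dots> = ?\<eta>"
    unfolding W
  proof (rule distr_point_measure_pfm[OF Y B fin(3)])
    fix v assume v: "v \<in> B"
    have "{i \<in> A \<times> B. snd i = v} = (\<lambda>u. (u, v)) ` A" using v by auto
    then show "(\<Sum>i\<in>{i \<in> A \<times> B. snd i = v}. w (fst i) (snd i)) = prob_grouping N \<alpha> Y v"
      using w(3)[OF v] by (simp add: sum.reindex inj_on_def)
  qed (use w(1) in auto)
  finally have snd: "distr \<gamma> ?\<eta> snd = ?\<eta>" .
  have "\<gamma> \<in> couplings ?\<nu> ?\<eta>" using fst snd by (simp add: couplings_def \<gamma>_def)
  then have "(WW2 ?\<nu> ?\<eta>)\<^sup>2 \<le> (\<integral>\<^sup>+ (U, V). (W2 U V)\<^sup>2 \<partial>\<gamma>)"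
    unfolding WW2_def ennsqrt_power2 by (rule INF_lower)
  also have "\<dots> \<le> (\<integral>\<^sup>+ z. (case ?T z of (U, V) \<Rightarrow> (W2 U V)\<^sup>2) \<partial>?W)"
    unfolding \<gamma>_def by (rule nn_integral_distr_le[OF T])
  also have "\<dots> = (\<Sum>z\<in>A \<times> B. (case z of (u, v) \<Rightarrow> ennreal (w u v)) * (case ?T z of (U, V) \<Rightarrow> (W2 U V)\<^sup>2))"
    by (subst nn_integral_point_measure_finite[OF fin(3)]) (simp add: mult.commute)
  also have "\<dots> = (\<Sum>(u, v)\<in>A \<times> B. ennreal (w u v) * (W2 (mean_diagram N loc u) (mean_diagram N loc v))\<^sup>2)"
    by (intro sum.cong) auto
  finally show ?thesis .
qed

subsection \<open>The coupling of two probabilistic Frechet means\<close>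


text \<open>Optimal partial matchings of the \<open>N\<close> coordinates are glued to one injection
  on labels that keeps the coordinate; its total cost is the squared tuple distance.\<close>

lemma tuple_matching:
  assumes X: "X \<in> {..<N} \<rightarrow> dgm_space M K" and Y: "Y \<in> {..<N} \<rightarrow> dgm_space M K"
  shows "\<exists>J f. J \<subseteq> labels N X \<and> inj_on f J \<and> f ` J \<subseteq> labels N Y \<and> (\<forall>l\<in>J. fst (f l) = fst l) \<and>
    (\<Sum>i<N. (W2 (X i) (Y i))\<^sup>2) = ennreal ((\<Sum>l\<in>J. (norm (loc l - loc (f l)))\<^sup>2)
      + (\<Sum>l\<in>labels N X - J. (pers (loc l))\<^sup>2 / 2) + (\<Sum>l\<in>labels N Y - f ` J. (pers (loc l))\<^sup>2 / 2))"
proof -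
  have XY: "X i \<in> dgm_space M K" "Y i \<in> dgm_space M K" if "i < N" for i using X Y that by auto
  note fin = dgm_spaceD(1)[OF XY(1)] dgm_spaceD(1)[OF XY(2)]
  let ?pm = "\<lambda>i. partial_matchings (offdiag (X i)) (offdiag (Y i))"
  let ?pc = "\<lambda>i. partial_cost fst (offdiag (X i)) fst (offdiag (Y i))"
  have "\<forall>i. \<exists>R. i < N \<longrightarrow> R \<in> ?pm i \<and> (W2 (X i) (Y i))\<^sup>2 = ennreal (?pc i R)"
    using W2_partial_attained[OF fin] by metis
  from choice[OF this] obtain R where R: "\<And>i. i < N \<Longrightarrow> R i \<in> ?pm i"
    "\<And>i. i < N \<Longrightarrow> (W2 (X i) (Y i))\<^sup>2 = ennreal (?pc i (R i))" by blast
  have sub: "R i \<subseteq> offdiag (X i) \<times> offdiag (Y i)" and inj: "inj_on fst (R i)" "inj_on snd (R i)" if "i < N" for i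
    using R(1)[OF that] by (auto simp: partial_matchings_def)
  have finR: "finite (R i)" if "i < N" for i
    using finite_subset[OF sub[OF that]] fin[OF that] by simp
  define J where "J = (SIGMA i:{..<N}. fst ` R i)"
  define f :: "label \<Rightarrow> label" where "f l = (fst l, snd (the_inv_into (R (fst l)) fst (snd l)))" for l
  have f: "f (i, fst r) = (i, snd r)" if "i < N" "r \<in> R i" for i r
    using the_inv_into_f_f[OF inj(1)[OF that(1)] that(2)] by (simp add: f_def)
  have fst_mem: "fst r \<in> offdiag (X i)" and snd_mem: "snd r \<in> offdiag (Y i)" if "i < N" "r \<in> R i" for i r
    using subsetD[OF sub[OF that(1)] that(2)] by (simp_all add: mem_Times_iff)
  have JX: "J \<subseteq> labels N X" using fst_mem by (auto simp: J_def labels_def)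
  have fJ: "f ` J = (SIGMA i:{..<N}. snd ` R i)"
  proof (intro set_eqI iffI)
    fix l assume "l \<in> f ` J"
    then obtain i r where "i < N" "r \<in> R i" "l = f (i, fst r)" unfolding J_def by blast
    then show "l \<in> (SIGMA i:{..<N}. snd ` R i)" using f by simp
  next
    fix l assume "l \<in> (SIGMA i:{..<N}. snd ` R i)"
    then obtain i r where ir: "i < N" "r \<in> R i" "l = (i, snd r)" by blast
    then have "(i, fst r) \<in> J" by (simp add: J_def)
    then show "l \<in> f ` J" using f[OF ir(1,2)] ir(3) by (metis image_eqI)
  qed
  have fJY: "f ` J \<subseteq> labels N Y" unfolding fJ using snd_mem by (auto simp: labels_def)
  have inj_f: "inj_on f J"
  proof (rule inj_onI)
    fix l l' assume ll: "l \<in> J" "l' \<in> J" "f l = f l'"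
    then obtain i r i' r' where ir: "i < N" "r \<in> R i" "l = (i, fst r)" and ir': "i' < N" "r' \<in> R i'" "l' = (i', fst r')"
      unfolding J_def by blast
    then have "i = i'" "snd r = snd r'" using ll(3) f by simp_all
    then have "r = r'" using inj_onD[OF inj(2)[OF ir(1)]] ir ir' by simp
    then show "l = l'" using ir ir' \<open>i = i'\<close> by simp
  qed
  have LXJ: "labels N X - J = (SIGMA i:{..<N}. offdiag (X i) - fst ` R i)"
    by (auto simp: labels_def J_def)
  have LYJ: "labels N Y - f ` J = (SIGMA i:{..<N}. offdiag (Y i) - snd ` R i)"
    unfolding fJ by (auto simp: labels_def)
  have s1: "(\<Sum>l\<in>J. (norm (loc l - loc (f l)))\<^sup>2) = (\<Sum>i<N. \<Sum>(a, b)\<in>R i. (norm (fst a - fst b))\<^sup>2)"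
  proof -
    have "(\<Sum>l\<in>J. (norm (loc l - loc (f l)))\<^sup>2)
        = (\<Sum>i<N. \<Sum>z\<in>fst ` R i. (norm (loc (i, z) - loc (f (i, z))))\<^sup>2)"
      unfolding J_def using finR by (subst sum.Sigma) auto
    also have "\<dots> = (\<Sum>i<N. \<Sum>(a, b)\<in>R i. (norm (fst a - fst b))\<^sup>2)"
    proof (intro sum.cong refl)
      fix i assume "i \<in> {..<N}"
      then have i: "i < N" by simp
      show "(\<Sum>z\<in>fst ` R i. (norm (loc (i, z) - loc (f (i, z))))\<^sup>2) = (\<Sum>(a, b)\<in>R i. (norm (fst a - fst b))\<^sup>2)"
        unfolding sum.reindex[OF inj(1)[OF i]]
        by (intro sum.cong refl) (simp add: f[OF i] loc_def case_prod_beta)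
    qed
    finally show ?thesis .
  qed
  have s2: "(\<Sum>l\<in>labels N X - J. (pers (loc l))\<^sup>2 / 2)
      = (\<Sum>i<N. \<Sum>z\<in>offdiag (X i) - fst ` R i. (pers (fst z))\<^sup>2 / 2)"
    unfolding LXJ using fin by (subst sum.Sigma) (auto simp: loc_def case_prod_beta)
  have s3: "(\<Sum>l\<in>labels N Y - f ` J. (pers (loc l))\<^sup>2 / 2)
      = (\<Sum>i<N. \<Sum>z\<in>offdiag (Y i) - snd ` R i. (pers (fst z))\<^sup>2 / 2)"
    unfolding LYJ using fin by (subst sum.Sigma) (auto simp: loc_def case_prod_beta)
  have "(\<Sum>i<N. (W2 (X i) (Y i))\<^sup>2) = (\<Sum>i<N. ennreal (?pc i (R i)))"
    using R(2) by (intro sum.cong) auto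
  also have "\<dots> = ennreal (\<Sum>i<N. ?pc i (R i))" by (rule sum_ennreal) (rule partial_cost_nonneg)
  also have "(\<Sum>i<N. ?pc i (R i)) = (\<Sum>l\<in>J. (norm (loc l - loc (f l)))\<^sup>2)
      + (\<Sum>l\<in>labels N X - J. (pers (loc l))\<^sup>2 / 2) + (\<Sum>l\<in>labels N Y - f ` J. (pers (loc l))\<^sup>2 / 2)"
    unfolding partial_cost_def s1 s2 s3 by (simp only: sum.distrib)
  finally have eq: "(\<Sum>i<N. (W2 (X i) (Y i))\<^sup>2) = ennreal ((\<Sum>l\<in>J. (norm (loc l - loc (f l)))\<^sup>2)
      + (\<Sum>l\<in>labels N X - J. (pers (loc l))\<^sup>2 / 2) + (\<Sum>l\<in>labels N Y - f ` J. (pers (loc l))\<^sup>2 / 2))" .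
  have "\<forall>l\<in>J. fst (f l) = fst l" by (simp add: f_def)
  then show ?thesis using JX inj_f fJY eq by (intro exI[of _ J] exI[of _ f]) simp
qed

text \<open>Cauchy-Schwarz gives the factor \<open>1 / k\<close> along the diagonal and
  \<open>k / N^2\<close> across it, where \<open>k = card (ran s)\<close>. Both are at most 1, so
  taking means does not increase the cost.\<close>

lemma norm_mean_diff_le:
  assumes "is_selection N A s" "s \<noteq> Map.empty"
  shows "(norm (mean N x s - mean N y s))\<^sup>2 \<le> (\<Sum>l\<in>ran s. (norm (x l - y l))\<^sup>2)"
proof -
  let ?k = "real (card (ran s))"
  have k: "1 \<le> ?k" "?k \<le> N"
    using selection_ran[OF assms(1)] assms(2) by (auto simp: Suc_le_eq card_gt_0_iff)
  let ?c = "\<lambda>l. csum (x l) - csum (y l)" and ?p = "\<lambda>l. pers (x l) - pers (y l)"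
  have cs: "(sum h (ran s))\<^sup>2 \<le> (\<Sum>l\<in>ran s. (h l)\<^sup>2) * ?k" for h :: "label \<Rightarrow> real"
    by (rule sum_squared_le_sum_of_squares)
  have "csum (mean N x s) - csum (mean N y s) = sum ?c (ran s) / ?k"
    by (simp add: mean_coords[OF assms] sum_subtractf diff_divide_distrib)
  then have "(csum (mean N x s) - csum (mean N y s))\<^sup>2 = (sum ?c (ran s))\<^sup>2 / ?k\<^sup>2"
    by (simp add: power_divide)
  also have "\<dots> \<le> (\<Sum>l\<in>ran s. (?c l)\<^sup>2) * ?k / ?k\<^sup>2" by (intro divide_right_mono cs) simp
  also have "\<dots> = (\<Sum>l\<in>ran s. (?c l)\<^sup>2) * (1 / ?k)" using k by (simp add: power2_eq_square)
  also have "\<dots> \<le> (\<Sum>l\<in>ran s. (?c l)\<^sup>2) * 1" using k by (intro mult_left_mono sum_nonneg) auto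
  finally have c: "(csum (mean N x s) - csum (mean N y s))\<^sup>2 \<le> (\<Sum>l\<in>ran s. (?c l)\<^sup>2)" by simp
  have "pers (mean N x s) - pers (mean N y s) = sum ?p (ran s) / N"
    by (simp add: mean_coords[OF assms] sum_subtractf diff_divide_distrib)
  then have "(pers (mean N x s) - pers (mean N y s))\<^sup>2 = (sum ?p (ran s))\<^sup>2 / (real N)\<^sup>2"
    by (simp add: power_divide)
  also have "\<dots> \<le> (\<Sum>l\<in>ran s. (?p l)\<^sup>2) * ?k / (real N)\<^sup>2" by (intro divide_right_mono cs) simp
  also have "\<dots> = (\<Sum>l\<in>ran s. (?p l)\<^sup>2) * (?k / (real N)\<^sup>2)" by simp
  also have "\<dots> \<le> (\<Sum>l\<in>ran s. (?p l)\<^sup>2) * 1"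
  proof (intro mult_left_mono sum_nonneg)
    have "?k \<le> real N * real N" using k mult_mono[of 1 "real N" "?k" "real N"] by simp
    then show "?k / (real N)\<^sup>2 \<le> 1" using k by (simp add: power2_eq_square divide_le_eq)
  qed simp
  finally have p: "(pers (mean N x s) - pers (mean N y s))\<^sup>2 \<le> (\<Sum>l\<in>ran s. (?p l)\<^sup>2)" by simp
  have "(norm (mean N x s - mean N y s))\<^sup>2 \<le> ((\<Sum>l\<in>ran s. (?c l)\<^sup>2) + (\<Sum>l\<in>ran s. (?p l)\<^sup>2)) / 2"
    unfolding norm_diff_power2 by (intro divide_right_mono add_mono c p) simp
  also have "\<dots> = (\<Sum>l\<in>ran s. (norm (x l - y l))\<^sup>2)"
    unfolding norm_diff_power2 sum_divide_distrib[symmetric] by (simp add: sum.distrib)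
  finally show ?thesis .
qed

text \<open>The mean of a trivial selection keeps the fraction \<open>1 / N\<close> of the
  persistence, so it is no farther from the diagonal than the point itself.\<close>

lemma sum_trivial_selection_le:
  assumes "finite L" "\<And>l. l \<in> L \<Longrightarrow> fst l < N"
  shows "(\<Sum>t\<in>trivial_selection ` L. (pers (mean N x t))\<^sup>2 / 2) \<le> (\<Sum>l\<in>L. (pers (x l))\<^sup>2 / 2)"
proof -
  have inj: "inj_on trivial_selection L"
    by (rule inj_onI) (metis trivial_selection(1) singleton_inject)
  have "(\<Sum>t\<in>trivial_selection ` L. (pers (mean N x t))\<^sup>2 / 2)
      = (\<Sum>l\<in>L. (pers (mean N x (trivial_selection l)))\<^sup>2 / 2)"
    by (simp add: sum.reindex[OF inj])
  also have "\<dots> \<le> (\<Sum>l\<in>L. (pers (x l))\<^sup>2 / 2)"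
  proof (intro sum_mono divide_right_mono)
    fix l assume l: "l \<in> L"
    then have N: "1 \<le> real N" using assms(2)[OF l] by simp
    have "pers (mean N x (trivial_selection l)) = pers (x l) / N"
      using mean_coords(2)[where q = x, OF trivial_selection(3)[OF l assms(2)[OF l]] trivial_selection(2)]
      by (simp add: trivial_selection(1))
    then have "(pers (mean N x (trivial_selection l)))\<^sup>2 = (pers (x l))\<^sup>2 / (real N)\<^sup>2"
      by (simp add: power_divide)
    also have "\<dots> \<le> (pers (x l))\<^sup>2 / 1" using N by (intro divide_left_mono) (auto simp: one_le_power)
    finally show "(pers (mean N x (trivial_selection l)))\<^sup>2 \<le> (pers (x l))\<^sup>2" by simp
  qed simp
  finally show ?thesis .
qed

text \<open>Match \<open>s\<close> with \<open>relabel f s\<close> and leave the trivial selections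
  of unmatched points to the diagonal. As the ranges partition \<open>J\<close>, the means cost no
  more than the data.\<close>

lemma W2_means_le:
  assumes L: "finite L" "finite L'" "\<And>l. l \<in> L \<Longrightarrow> fst l < N" "\<And>l. l \<in> L' \<Longrightarrow> fst l < N"
    and above: "\<And>l. l \<in> L \<Longrightarrow> 0 < pers (x l)" "\<And>l. l \<in> L' \<Longrightarrow> 0 < pers (y l)"
    and f: "J \<subseteq> L" "inj_on f J" "f ` J \<subseteq> L'" "\<And>l. l \<in> J \<Longrightarrow> fst (f l) = fst l"
    and g: "is_grouping N J g"
  shows "(W2 (mean_diagram N x (g \<union> trivial_selection ` (L - J)))
      (mean_diagram N y (relabel f ` g \<union> trivial_selection ` (L' - f ` J))))\<^sup>2
    \<le> ennreal ((\<Sum>l\<in>J. (norm (x l - y (f l)))\<^sup>2) + (\<Sum>l\<in>L - J. (pers (x l))\<^sup>2 / 2)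
      + (\<Sum>l\<in>L' - f ` J. (pers (y l))\<^sup>2 / 2))"
proof -
  let ?G = "g \<union> trivial_selection ` (L - J)" and ?G' = "relabel f ` g \<union> trivial_selection ` (L' - f ` J)"
  have bij: "bij_betw f J (f ` J)" using f(2) by (rule inj_on_imp_bij_betw)
  have finJ: "finite J" using f(1) L(1) by (rule finite_subset)
  note fing = finite_groupings(2)[OF finJ g]
  have g': "is_grouping N (f ` J) (relabel f ` g)"
    by (rule is_grouping_relabel[where q = "\<lambda>l. y (f l)" and q' = y, OF bij _ _ g]) (simp_all add: f(4))
  have G: "is_grouping N L ?G" by (rule is_grouping_Un_trivial[OF g f(1) L(3)])
  have G': "is_grouping N L' ?G'" by (rule is_grouping_Un_trivial[OF g' f(3) L(4)])
  have inj: "inj_on (relabel f) g"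
    by (rule inj_on_subset[OF inj_on_relabel[where q = "\<lambda>l. y (f l)" and q' = y and A = J and N = N, OF bij]])
      (use f(4) is_groupingD(1)[OF g] in auto)
  have mean: "mean N y (relabel f s) = mean N (\<lambda>l. y (f l)) s" if "s \<in> g" for s
  proof -
    have "selection_cost N y (relabel f s) = selection_cost N (\<lambda>l. y (f l)) s"
      by (rule selection_cost_relabel[OF bij _ _ is_groupingD(1)[OF g that]]) (simp_all add: f(4))
    then show ?thesis by (simp add: mean_def)
  qed
  define R where "R = (\<lambda>s. (s, relabel f s)) ` g"
  have fstR: "fst ` R = g" and sndR: "snd ` R = relabel f ` g" by (force simp: R_def)+
  have R: "R \<in> partial_matchings ?G ?G'"
    using inj by (auto simp: partial_matchings_def R_def inj_on_def)
  have "(W2 (mean_diagram N x ?G) (mean_diagram N y ?G'))\<^sup>2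
      \<le> ennreal (partial_cost (mean N x) ?G (mean N y) ?G' R)"
    unfolding mean_diagram_def
  proof (rule W2_labelled_le[OF _ _ _ _ R])
    show "finite ?G" by (rule finite_groupings(2)[OF L(1) G])
    show "finite ?G'" by (rule finite_groupings(2)[OF L(2) G'])
    show "0 < pers (mean N x s)" if "s \<in> ?G" for s by (rule pers_mean_pos[OF is_groupingD[OF G that] above(1)])
    show "0 < pers (mean N y s)" if "s \<in> ?G'" for s by (rule pers_mean_pos[OF is_groupingD[OF G' that] above(2)])
  qed
  also have "\<dots> \<le> ennreal ((\<Sum>l\<in>J. (norm (x l - y (f l)))\<^sup>2) + (\<Sum>l\<in>L - J. (pers (x l))\<^sup>2 / 2)
      + (\<Sum>l\<in>L' - f ` J. (pers (y l))\<^sup>2 / 2))"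
    unfolding partial_cost_def fstR sndR
  proof (intro ennreal_leI add_mono)
    have "(\<Sum>(a, b)\<in>R. (norm (mean N x a - mean N y b))\<^sup>2)
        = (\<Sum>s\<in>g. (norm (mean N x s - mean N (\<lambda>l. y (f l)) s))\<^sup>2)"
      unfolding R_def by (subst sum.reindex) (auto simp: inj_on_def mean intro!: sum.cong)
    also have "\<dots> \<le> (\<Sum>s\<in>g. \<Sum>l\<in>ran s. (norm (x l - y (f l)))\<^sup>2)"
      by (intro sum_mono norm_mean_diff_le[OF is_groupingD[OF g]])
    also have "\<dots> = (\<Sum>l\<in>J. (norm (x l - y (f l)))\<^sup>2)" by (rule sum_grouping[OF g finJ])
    finally show "(\<Sum>(a, b)\<in>R. (norm (mean N x a - mean N y b))\<^sup>2) \<le> (\<Sum>l\<in>J. (norm (x l - y (f l)))\<^sup>2)" .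
    have "(\<Sum>a\<in>?G - g. (pers (mean N x a))\<^sup>2 / 2) \<le> (\<Sum>a\<in>trivial_selection ` (L - J). (pers (mean N x a))\<^sup>2 / 2)"
      using L(1) by (intro sum_mono2) auto
    also have "\<dots> \<le> (\<Sum>l\<in>L - J. (pers (x l))\<^sup>2 / 2)"
      by (rule sum_trivial_selection_le) (use L in auto)
    finally show "(\<Sum>a\<in>?G - g. (pers (mean N x a))\<^sup>2 / 2) \<le> (\<Sum>l\<in>L - J. (pers (x l))\<^sup>2 / 2)" .
    have "(\<Sum>a\<in>?G' - relabel f ` g. (pers (mean N y a))\<^sup>2 / 2)
        \<le> (\<Sum>a\<in>trivial_selection ` (L' - f ` J). (pers (mean N y a))\<^sup>2 / 2)"
      using L(2) by (intro sum_mono2) auto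
    also have "\<dots> \<le> (\<Sum>l\<in>L' - f ` J. (pers (y l))\<^sup>2 / 2)"
      by (rule sum_trivial_selection_le) (use L in auto)
    finally show "(\<Sum>a\<in>?G' - relabel f ` g. (pers (mean N y a))\<^sup>2 / 2) \<le> (\<Sum>l\<in>L' - f ` J. (pers (y l))\<^sup>2 / 2)" .
  qed
  finally show ?thesis .
qed

text \<open>The grouping can be read off from the union: its relabelled selections are those with
  range in the image of \<open>J\<close>, while the added ones use labels outside it.\<close>

lemma inj_on_relabel_Un_trivial:
  assumes f: "inj_on f J" "\<And>l. l \<in> J \<Longrightarrow> fst (f l) = fst l"
  shows "inj_on (\<lambda>g. relabel f ` g \<union> trivial_selection ` (L - f ` J)) {g. is_grouping N J g}"
proof (rule inj_onI)
  have bij: "bij_betw f J (f ` J)" using f(1) by (rule inj_on_imp_bij_betw)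
  have inj: "inj_on (relabel f) {s. is_selection N J s}"
    by (rule inj_on_relabel[where q = "\<lambda>_. undefined" and q' = "\<lambda>_. undefined", OF bij]) (simp_all add: f(2))
  have part: "{s \<in> relabel f ` g \<union> trivial_selection ` (L - f ` J). ran s \<subseteq> f ` J} = relabel f ` g"
    if g: "is_grouping N J g" for g
  proof -
    have "ran (relabel f s) \<subseteq> f ` J" if "s \<in> g" for s
      using relabel_selection(2)[OF is_groupingD(1)[OF g that], of f "f ` J"] f(2)
        selection_ran(2)[OF is_groupingD(1)[OF g that]] by auto
    then show ?thesis by (auto simp: trivial_selection(1))
  qed
  fix g h assume gh: "g \<in> {g. is_grouping N J g}" "h \<in> {g. is_grouping N J g}"
    "relabel f ` g \<union> trivial_selection ` (L - f ` J) = relabel f ` h \<union> trivial_selection ` (L - f ` J)"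
  then have g: "is_grouping N J g" and h: "is_grouping N J h" by auto
  have "relabel f ` g = relabel f ` h" using part[OF g] part[OF h] gh(3) by simp
  moreover have "g \<subseteq> {s. is_selection N J s}" "h \<subseteq> {s. is_selection N J s}"
    using is_groupingD(1)[OF g] is_groupingD(1)[OF h] by auto
  ultimately show "g = h" by (simp add: inj_on_image_eq_iff[OF inj])
qed

text \<open>\<open>T\<close> indexes corresponding groupings of the two sides. Their pairs carry at
  least the mass \<open>m\<close> at cost at most \<open>c\<close>; all other mass is charged the
  squared diameter.\<close>

lemma WW2_coupling_le:
  fixes a b :: "'t \<Rightarrow> selection set"
  assumes N: "N \<ge> 1" and \<alpha>: "\<alpha> > 0"
    and X: "X \<in> {..<N} \<rightarrow> dgm_space M K" and Y: "Y \<in> {..<N} \<rightarrow> dgm_space M K"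
    and T: "finite T" "a ` T \<subseteq> {G. is_grouping N (labels N X) G}" "b ` T \<subseteq> {G. is_grouping N (labels N Y) G}"
      "inj_on a T" "inj_on b T"
    and m: "\<And>t. t \<in> T \<Longrightarrow> 0 \<le> m t" "\<And>t. t \<in> T \<Longrightarrow> m t \<le> prob_grouping N \<alpha> X (a t)"
      "\<And>t. t \<in> T \<Longrightarrow> m t \<le> prob_grouping N \<alpha> Y (b t)"
    and c: "0 \<le> c" "\<And>t. t \<in> T \<Longrightarrow> (W2 (mean_diagram N loc (a t)) (mean_diagram N loc (b t)))\<^sup>2 \<le> ennreal c"
  shows "(WW2 (pfm N K M \<alpha> X) (pfm N K M \<alpha> Y))\<^sup>2
    \<le> ennreal (c + (max_W2 M (N * K))\<^sup>2 * (1 - (\<Sum>t\<in>T. m t)))"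
proof -
  let ?M = "max_W2 M (N * K)"
  let ?d = "\<lambda>u v. (W2 (mean_diagram N loc u) (mean_diagram N loc v))\<^sup>2"
  define A where "A = {G. is_grouping N (labels N X) G}"
  define B where "B = {G. is_grouping N (labels N Y) G}"
  note LX = labels_dgm_space[OF X] and LY = labels_dgm_space[OF Y]
  have fin: "finite A" "finite B"
    using finite_groupings(1) LX(1) LY(1) unfolding A_def B_def by blast+
  have sums: "(\<Sum>u\<in>A. prob_grouping N \<alpha> X u) = 1" "(\<Sum>v\<in>B. prob_grouping N \<alpha> Y v) = 1"
    unfolding A_def B_def prob_grouping_eq_law
    by (rule sum_grouping_law_eq_1[OF \<alpha> LX(1) LX(3) _ LX(4)], use N in simp_all)
      (rule sum_grouping_law_eq_1[OF \<alpha> LY(1) LY(3) _ LY(4)], use N in simp_all)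
  have pq: "0 \<le> prob_grouping N \<alpha> Z u" for Z u by (simp add: prob_grouping_def Let_def)
  obtain w where *: "(\<forall>u\<in>A. \<forall>v\<in>B. 0 \<le> w u v) \<and> (\<forall>u\<in>A. (\<Sum>v\<in>B. w u v) = prob_grouping N \<alpha> X u) \<and>
    (\<forall>v\<in>B. (\<Sum>u\<in>A. w u v) = prob_grouping N \<alpha> Y v) \<and> (\<Sum>t\<in>T. m t) \<le> (\<Sum>t\<in>T. w (a t) (b t))"
    using finite_coupling[where p = "prob_grouping N \<alpha> X" and q = "prob_grouping N \<alpha> Y" and m = m
          and a = a and b = b, OF fin(1) sums(1) fin(2) sums(2) pq pq T(1) T(2,3)[folded A_def B_def] T(4,5) m]
    by auto
  have w: "\<And>u v. u \<in> A \<Longrightarrow> v \<in> B \<Longrightarrow> 0 \<le> w u v"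
    "\<And>u. u \<in> A \<Longrightarrow> (\<Sum>v\<in>B. w u v) = prob_grouping N \<alpha> X u"
    "\<And>v. v \<in> B \<Longrightarrow> (\<Sum>u\<in>A. w u v) = prob_grouping N \<alpha> Y v"
    "(\<Sum>t\<in>T. m t) \<le> (\<Sum>t\<in>T. w (a t) (b t))"
    using * by auto
  define \<theta> where "\<theta> = (\<Sum>t\<in>T. w (a t) (b t))"
  define D where "D = (\<lambda>t. (a t, b t)) ` T"
  have D: "D \<subseteq> A \<times> B" using T(2,3) by (auto simp: D_def A_def B_def)
  have injD: "inj_on (\<lambda>t. (a t, b t)) T" using T(4) by (auto simp: inj_on_def)
  have \<theta>: "(\<Sum>(u, v)\<in>D. w u v) = \<theta>"
    unfolding D_def \<theta>_def by (simp add: sum.reindex[OF injD])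
  have total: "(\<Sum>(u, v)\<in>A \<times> B. w u v) = 1"
    using w(2) sums(1) by (simp flip: sum.cartesian_product)
  have rest: "(\<Sum>(u, v)\<in>A \<times> B - D. w u v) = 1 - \<theta>"
    using sum_diff[OF finite_cartesian_product[OF fin] D, of "\<lambda>(u, v). w u v"] \<theta> total by simp
  have \<theta>1: "\<theta> \<le> 1"
  proof -
    have "0 \<le> (\<Sum>(u, v)\<in>A \<times> B - D. w u v)" using w(1) by (intro sum_nonneg) auto
    then show ?thesis using rest by simp
  qed
  have \<theta>0: "0 \<le> \<theta>" unfolding \<theta>[symmetric] using w(1) D by (intro sum_nonneg) auto
  have dM: "?d u v \<le> ennreal (?M\<^sup>2)" if "u \<in> A" "v \<in> B" for u v
  proof -
    have "W2 (mean_diagram N loc u) (mean_diagram N loc v) \<le> ennreal ?M"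
      using that unfolding A_def B_def
      by (intro W2_le_max_W2[OF mean_diagram_dgm_space[OF X] mean_diagram_dgm_space[OF Y]]) simp_all
    then have "?d u v \<le> (ennreal ?M)\<^sup>2" by (rule power_mono) simp
    also have "\<dots> = ennreal (?M\<^sup>2)" by (simp add: ennreal_power max_W2_def)
    finally show ?thesis .
  qed
  have "(WW2 (pfm N K M \<alpha> X) (pfm N K M \<alpha> Y))\<^sup>2 \<le> (\<Sum>(u, v)\<in>A \<times> B. ennreal (w u v) * ?d u v)"
    by (rule WW2_pfm_le[OF N \<alpha> X Y A_def B_def w(1-3)])
  also have "\<dots> = (\<Sum>(u, v)\<in>A \<times> B - D. ennreal (w u v) * ?d u v) + (\<Sum>(u, v)\<in>D. ennreal (w u v) * ?d u v)"
    by (rule sum.subset_diff[OF D finite_cartesian_product[OF fin]])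
  also have "\<dots> \<le> (\<Sum>z\<in>A \<times> B - D. ennreal ((case z of (u, v) \<Rightarrow> w u v) * ?M\<^sup>2))
      + (\<Sum>z\<in>D. ennreal ((case z of (u, v) \<Rightarrow> w u v) * c))"
  proof (intro add_mono sum_mono)
    fix z assume "z \<in> A \<times> B - D"
    then obtain u v where z: "z = (u, v)" "u \<in> A" "v \<in> B" by blast
    have "ennreal (w u v) * ?d u v \<le> ennreal (w u v) * ennreal (?M\<^sup>2)"
      by (rule mult_left_mono[OF dM[OF z(2,3)]]) simp
    then show "(case z of (u, v) \<Rightarrow> ennreal (w u v) * ?d u v) \<le> ennreal ((case z of (u, v) \<Rightarrow> w u v) * ?M\<^sup>2)"
      using w(1)[OF z(2,3)] by (simp add: z(1) ennreal_mult)
  next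
    fix z assume zD: "z \<in> D"
    then obtain t where t: "t \<in> T" "z = (a t, b t)" by (auto simp: D_def)
    have "ennreal (w (a t) (b t)) * ?d (a t) (b t) \<le> ennreal (w (a t) (b t)) * ennreal c"
      by (rule mult_left_mono[OF c(2)[OF t(1)]]) simp
    then show "(case z of (u, v) \<Rightarrow> ennreal (w u v) * ?d u v) \<le> ennreal ((case z of (u, v) \<Rightarrow> w u v) * c)"
      using w(1)[of "a t" "b t"] D zD c(1) by (auto simp: t(2) ennreal_mult)
  qed
  also have "\<dots> = ennreal ((\<Sum>(u, v)\<in>A \<times> B - D. w u v) * ?M\<^sup>2) + ennreal ((\<Sum>(u, v)\<in>D. w u v) * c)"
    unfolding sum_distrib_right using w(1) D c(1) by (intro arg_cong2[where f = "(+)"] sum_ennreal) auto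
  also have "\<dots> = ennreal ((1 - \<theta>) * ?M\<^sup>2 + \<theta> * c)"
    unfolding rest \<theta> using \<theta>0 \<theta>1 c(1) by (simp add: ennreal_plus)
  \<comment> \<open>The matched mass \<theta> is bounded below by the sum of \<open>m\<close> in the
    diameter term and above by 1 in the other.\<close>
  also have "\<dots> \<le> ennreal (c + ?M\<^sup>2 * (1 - (\<Sum>t\<in>T. m t)))"
  proof (intro ennreal_leI)
    have "(1 - \<theta>) * ?M\<^sup>2 \<le> (1 - (\<Sum>t\<in>T. m t)) * ?M\<^sup>2"
      using w(4) by (intro mult_right_mono) (auto simp: \<theta>_def)
    moreover have "\<theta> * c \<le> c" using \<theta>0 \<theta>1 c(1) by (simp add: mult_left_le_one_le)
    ultimately show "(1 - \<theta>) * ?M\<^sup>2 + \<theta> * c \<le> c + ?M\<^sup>2 * (1 - (\<Sum>t\<in>T. m t))"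
      by (simp add: mult.commute)
  qed
  finally show ?thesis .
qed

subsection \<open>Hoelder continuity\<close>


text \<open>Cauchy-Schwarz gives the factor sqrt n; the inequality of arithmetic and geometric mean
  replaces it by (n + 1) / 2, which produces the \<open>N * K + 1\<close> of the final
  constant.\<close>

lemma sum_norm_le:
  fixes t :: "'a \<Rightarrow> real"
  assumes "(\<Sum>l\<in>J. (t l)\<^sup>2) \<le> \<delta>\<^sup>2" "0 \<le> \<delta>" "card J \<le> n"
  shows "(\<Sum>l\<in>J. t l) \<le> (real n + 1) / 2 * \<delta>"
proof (rule power2_le_imp_le)
  have "(\<Sum>l\<in>J. t l)\<^sup>2 \<le> (\<Sum>l\<in>J. (t l)\<^sup>2) * card J" by (rule sum_squared_le_sum_of_squares)
  also have "\<dots> \<le> \<delta>\<^sup>2 * n" using assms by (intro mult_mono) auto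
  also have "\<dots> \<le> \<delta>\<^sup>2 * ((real n + 1) / 2)\<^sup>2"
  proof (rule mult_left_mono)
    have "0 \<le> ((real n - 1) / 2)\<^sup>2" by simp
    then show "real n \<le> ((real n + 1) / 2)\<^sup>2" by (simp add: power2_eq_square field_simps)
  qed simp
  finally show "(\<Sum>l\<in>J. t l)\<^sup>2 \<le> ((real n + 1) / 2 * \<delta>)\<^sup>2" unfolding power_mult_distrib by (simp only: mult.commute)
  show "0 \<le> (real n + 1) / 2 * \<delta>" using assms by simp
qed

lemma relabel_id: "relabel (\<lambda>l. l) ` g = g"
proof -
  have "relabel (\<lambda>l. l) s = s" for s by (simp add: relabel_def option.map_ident)
  then show ?thesis by simp
qed

text \<open>Both sides are compared with the random grouping of the matched labels \<open>J\<close>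
  around the points of \<open>X\<close>. Groupings with \<open>p \<le> q\<close> are estimated by
  \<open>p\<close> directly, the others by \<open>q\<close> after moving the centres to
  \<open>Y\<close>; thus each error enters just once.\<close>

lemma common_mass_ge:
  assumes N: "N \<ge> 1" and \<alpha>: "\<alpha> > 0"
    and X: "X \<in> {..<N} \<rightarrow> dgm_space M K" and Y: "Y \<in> {..<N} \<rightarrow> dgm_space M K"
    and J: "J \<subseteq> labels N X" and f: "inj_on f J" "f ` J \<subseteq> labels N Y" "\<And>l. l \<in> J \<Longrightarrow> fst (f l) = fst l"
  shows "1 - ((\<Sum>l\<in>J. 4 * norm (loc l - loc (f l)) / \<alpha>)
      + ((\<Sum>l\<in>labels N X - J. (pers (loc l))\<^sup>2 / 2) + (\<Sum>l\<in>labels N Y - f ` J. (pers (loc l))\<^sup>2 / 2)) / \<alpha>\<^sup>2)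
    \<le> (\<Sum>g\<in>{g. is_grouping N J g}.
        min (prob_grouping N \<alpha> X (g \<union> trivial_selection ` (labels N X - J)))
          (prob_grouping N \<alpha> Y (relabel f ` g \<union> trivial_selection ` (labels N Y - f ` J))))"
proof -
  note LX = labels_dgm_space[OF X] and LY = labels_dgm_space[OF Y]
  have N0: "N > 0" using N by simp
  let ?T = "{g. is_grouping N J g}"
  define p where "p g = prob_grouping N \<alpha> X (g \<union> trivial_selection ` (labels N X - J))" for g
  define q where "q g = prob_grouping N \<alpha> Y (relabel f ` g \<union> trivial_selection ` (labels N Y - f ` J))" for g
  define dX where "dX = (\<Sum>l\<in>labels N X - J. (pers (loc l))\<^sup>2 / 2)"
  define dY where "dY = (\<Sum>l\<in>labels N Y - f ` J. (pers (loc l))\<^sup>2 / 2)"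
  have finJ: "finite J" using J LX(1) by (rule finite_subset)
  have idxJ: "\<And>l. l \<in> J \<Longrightarrow> fst l < N" using J LX(3) by blast
  note finT = finite_groupings(1)[OF finJ, of N]
  define E where "E x S = {\<omega> \<in> space (perturbations \<alpha> J x). \<exists>g\<in>S. grouping_of_outcome N J \<omega> = Some g}" for x S
  \<comment> \<open>The relabelling is the identity here; passing from \<open>J\<close> to all
    labels of \<open>X\<close> costs the chance that an unmatched point survives.\<close>
  have leX: "measure (perturbations \<alpha> J loc) (E loc S) \<le> (\<Sum>g\<in>S. p g) + dX / \<alpha>\<^sup>2" if "S \<subseteq> ?T" for S
  proof -
    have "measure (perturbations \<alpha> J (\<lambda>l. loc l)) {\<omega> \<in> space (perturbations \<alpha> J (\<lambda>l. loc l)).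
        \<exists>g\<in>S. grouping_of_outcome N J \<omega> = Some g}
      \<le> (\<Sum>g\<in>S. grouping_law N \<alpha> (labels N X) loc (relabel (\<lambda>l. l) ` g \<union> trivial_selection ` (labels N X - (\<lambda>l. l) ` J)))
        + (\<Sum>l\<in>labels N X - (\<lambda>l. l) ` J. (pers (loc l))\<^sup>2 / 2) / \<alpha>\<^sup>2"
      by (rule measure_relabel_le[OF \<alpha> N0 LX(1,3)]) (use J finite_subset[OF that finT] in auto)
    then show ?thesis by (simp add: E_def p_def dX_def prob_grouping_eq_law relabel_id)
  qed
  have leY: "measure (perturbations \<alpha> J (\<lambda>l. loc (f l))) (E (\<lambda>l. loc (f l)) S) \<le> (\<Sum>g\<in>S. q g) + dY / \<alpha>\<^sup>2" if "S \<subseteq> ?T" for S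
    unfolding E_def q_def dY_def prob_grouping_eq_law
    by (rule measure_relabel_le[OF \<alpha> N0 LY(1) _ f(1,2)]) (use LY(3) f(3) finite_subset[OF that finT] in auto)
  have meas: "E loc S \<in> sets (perturbations \<alpha> J loc)" if "S \<subseteq> ?T" for S
    unfolding E_def pred_def[symmetric]
    by (rule pred_grouping_of_outcome_in[OF finJ idxJ N0 finite_subset[OF that finT]])
  have leXY: "measure (perturbations \<alpha> J loc) (E loc S) \<le> measure (perturbations \<alpha> J (\<lambda>l. loc (f l))) (E (\<lambda>l. loc (f l)) S)
      + (\<Sum>l\<in>J. 4 * norm (loc l - loc (f l)) / \<alpha>)" if "S \<subseteq> ?T" for S
  proof -
    have "E loc S = E (\<lambda>l. loc (f l)) S" by (simp add: E_def space_perturbations)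
    then show ?thesis
      using measure_perturbations_close[OF \<alpha> finJ meas[OF that], of "\<lambda>l. loc (f l)"] by (simp add: dist_norm)
  qed
  define S where "S = {g \<in> ?T. p g \<le> q g}"
  have S: "S \<subseteq> ?T" "?T - S \<subseteq> ?T" by (auto simp: S_def)
  have E_law: "measure (perturbations \<alpha> J loc) (E loc R) = (\<Sum>g\<in>R. grouping_law N \<alpha> J loc g)" if "R \<subseteq> ?T" for R
    unfolding E_def by (rule sum_grouping_law[symmetric, OF \<alpha> finJ idxJ N0 finite_subset[OF that finT]])
  have "1 = (\<Sum>g\<in>?T. grouping_law N \<alpha> J loc g)"
    by (rule sum_grouping_law_eq_1[symmetric, OF \<alpha> finJ idxJ N0]) (use J LX(4) in auto)
  also have "\<dots> = measure (perturbations \<alpha> J loc) (E loc (?T - S)) + measure (perturbations \<alpha> J loc) (E loc S)"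
    unfolding E_law[OF S(1)] E_law[OF S(2)] by (rule sum.subset_diff[OF S(1) finT])
  also have "\<dots> \<le> ((\<Sum>g\<in>?T - S. q g) + dY / \<alpha>\<^sup>2 + (\<Sum>l\<in>J. 4 * norm (loc l - loc (f l)) / \<alpha>)) + ((\<Sum>g\<in>S. p g) + dX / \<alpha>\<^sup>2)"
    using leXY[OF S(2)] leY[OF S(2)] leX[OF S(1)] by linarith
  also have "(\<Sum>g\<in>?T - S. q g) = (\<Sum>g\<in>?T - S. min (p g) (q g))"
    by (intro sum.cong) (auto simp: S_def min_def)
  also have "(\<Sum>g\<in>S. p g) = (\<Sum>g\<in>S. min (p g) (q g))"
    by (intro sum.cong) (auto simp: S_def min_def)
  finally have "1 \<le> ((\<Sum>g\<in>?T - S. min (p g) (q g)) + dY / \<alpha>\<^sup>2 + (\<Sum>l\<in>J. 4 * norm (loc l - loc (f l)) / \<alpha>))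
      + ((\<Sum>g\<in>S. min (p g) (q g)) + dX / \<alpha>\<^sup>2)" .
  moreover have "(\<Sum>g\<in>?T. min (p g) (q g)) = (\<Sum>g\<in>?T - S. min (p g) (q g)) + (\<Sum>g\<in>S. min (p g) (q g))"
    by (rule sum.subset_diff[OF S(1) finT])
  ultimately have "1 - ((\<Sum>l\<in>J. 4 * norm (loc l - loc (f l)) / \<alpha>) + (dX + dY) / \<alpha>\<^sup>2) \<le> (\<Sum>g\<in>?T. min (p g) (q g))"
    unfolding add_divide_distrib by linarith
  then show ?thesis by (simp only: p_def q_def dX_def dY_def)
qed

text \<open>The matched pairs are indexed by the groupings of \<open>J\<close>, completed by trivial
  selections on both sides; the common mass is the smaller of the two probabilities.\<close>

lemma WW2_pfm_power2_le:
  assumes N: "N \<ge> 1" and \<alpha>: "\<alpha> > 0"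
    and X: "X \<in> {..<N} \<rightarrow> dgm_space M K" and Y: "Y \<in> {..<N} \<rightarrow> dgm_space M K"
    and J: "J \<subseteq> labels N X" and f: "inj_on f J" "f ` J \<subseteq> labels N Y" "\<forall>l\<in>J. fst (f l) = fst l"
    and \<delta>: "0 \<le> \<delta>" "\<delta>\<^sup>2 = (\<Sum>l\<in>J. (norm (loc l - loc (f l)))\<^sup>2)
      + (\<Sum>l\<in>labels N X - J. (pers (loc l))\<^sup>2 / 2) + (\<Sum>l\<in>labels N Y - f ` J. (pers (loc l))\<^sup>2 / 2)"
  shows "(WW2 (pfm N K M \<alpha> X) (pfm N K M \<alpha> Y))\<^sup>2
    \<le> ennreal (\<delta>\<^sup>2 + (max_W2 M (N * K))\<^sup>2 * (2 * (real N * real K + 1) * \<delta> / \<alpha> + \<delta>\<^sup>2 / \<alpha>\<^sup>2))"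
proof -
  note LX = labels_dgm_space[OF X] and LY = labels_dgm_space[OF Y]
  let ?T = "{g. is_grouping N J g}"
  let ?a = "\<lambda>g. g \<union> trivial_selection ` (labels N X - J)"
  let ?b = "\<lambda>g. relabel f ` g \<union> trivial_selection ` (labels N Y - f ` J)"
  let ?m = "\<lambda>g. min (prob_grouping N \<alpha> X (?a g)) (prob_grouping N \<alpha> Y (?b g))"
  have f3: "\<And>l. l \<in> J \<Longrightarrow> fst (f l) = fst l" using f(3) by simp
  have finJ: "finite J" using J LX(1) by (rule finite_subset)
  have bij: "bij_betw f J (f ` J)" using f(1) by (rule inj_on_imp_bij_betw)
  have "(WW2 (pfm N K M \<alpha> X) (pfm N K M \<alpha> Y))\<^sup>2
    \<le> ennreal (\<delta>\<^sup>2 + (max_W2 M (N * K))\<^sup>2 * (1 - (\<Sum>g\<in>?T. ?m g)))"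
  proof (rule WW2_coupling_le[OF N \<alpha> X Y finite_groupings(1)[OF finJ], where a = ?a and b = ?b])
    show "?a ` ?T \<subseteq> {G. is_grouping N (labels N X) G}"
      using is_grouping_Un_trivial[OF _ J LX(3)] by auto
    show "?b ` ?T \<subseteq> {G. is_grouping N (labels N Y) G}"
    proof
      fix G assume "G \<in> ?b ` ?T"
      then obtain g where g: "is_grouping N J g" "G = ?b g" by blast
      have "is_grouping N (f ` J) (relabel f ` g)"
        by (rule is_grouping_relabel[where q = "\<lambda>_. undefined" and q' = "\<lambda>_. undefined", OF bij _ _ g(1)])
          (simp_all add: f3)
      from is_grouping_Un_trivial[OF this f(2) LY(3)] show "G \<in> {G. is_grouping N (labels N Y) G}"
        unfolding g(2) by simp
    qed
    show "inj_on ?a ?T"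
      using inj_on_relabel_Un_trivial[where f = "\<lambda>l. l" and J = J and L = "labels N X" and N = N]
      by (simp add: relabel_id)
    show "inj_on ?b ?T" by (rule inj_on_relabel_Un_trivial[OF f(1) f3])
    show "0 \<le> ?m g" for g by (simp add: prob_grouping_def Let_def)
    show "(W2 (mean_diagram N loc (?a g)) (mean_diagram N loc (?b g)))\<^sup>2 \<le> ennreal (\<delta>\<^sup>2)" if "g \<in> ?T" for g
      unfolding \<delta>(2)
      by (rule W2_means_le[OF LX(1) LY(1) LX(3) LY(3) LX(4) LY(4) J f(1,2) f3]) (use that in auto)
  qed simp_all
  also have "\<dots> \<le> ennreal (\<delta>\<^sup>2 + (max_W2 M (N * K))\<^sup>2 * (2 * (real N * real K + 1) * \<delta> / \<alpha> + \<delta>\<^sup>2 / \<alpha>\<^sup>2))"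
  proof (intro ennreal_leI add_left_mono mult_left_mono)
    let ?d = "(\<Sum>l\<in>labels N X - J. (pers (loc l))\<^sup>2 / 2) + (\<Sum>l\<in>labels N Y - f ` J. (pers (loc l))\<^sup>2 / 2)"
    have d0: "0 \<le> ?d" by (intro add_nonneg_nonneg sum_nonneg) simp_all
    have s0: "0 \<le> (\<Sum>l\<in>J. (norm (loc l - loc (f l)))\<^sup>2)" by (intro sum_nonneg) simp
    have d: "?d / \<alpha>\<^sup>2 \<le> \<delta>\<^sup>2 / \<alpha>\<^sup>2" unfolding \<delta>(2) using s0 by (intro divide_right_mono) simp_all
    have "card J \<le> N * K" using card_mono[OF LX(1) J] LX(2) by simp
    moreover have "(\<Sum>l\<in>J. (norm (loc l - loc (f l)))\<^sup>2) \<le> \<delta>\<^sup>2" unfolding \<delta>(2) using d0 by simp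
    ultimately have "(\<Sum>l\<in>J. norm (loc l - loc (f l))) \<le> (real (N * K) + 1) / 2 * \<delta>"
      using \<delta>(1) by (intro sum_norm_le) auto
    then have "4 / \<alpha> * (\<Sum>l\<in>J. norm (loc l - loc (f l))) \<le> 4 / \<alpha> * ((real (N * K) + 1) / 2 * \<delta>)"
      using \<alpha> by (intro mult_left_mono) auto
    moreover have "4 / \<alpha> * (\<Sum>l\<in>J. norm (loc l - loc (f l))) = (\<Sum>l\<in>J. 4 * norm (loc l - loc (f l)) / \<alpha>)"
      by (simp add: sum_distrib_left)
    \<comment> \<open>The factor 2 is the 4 of the total variation bound times the 1/2 of
      \<open>sum_norm_le\<close>.\<close>
    moreover have "4 / \<alpha> * ((real (N * K) + 1) / 2 * \<delta>) = 2 * (real N * real K + 1) * \<delta> / \<alpha>" by simp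
    ultimately have t: "(\<Sum>l\<in>J. 4 * norm (loc l - loc (f l)) / \<alpha>) \<le> 2 * (real N * real K + 1) * \<delta> / \<alpha>"
      by (simp only:)
    show "1 - (\<Sum>g\<in>?T. ?m g) \<le> 2 * (real N * real K + 1) * \<delta> / \<alpha> + \<delta>\<^sup>2 / \<alpha>\<^sup>2"
      using common_mass_ge[OF N \<alpha> X Y J f(1,2) f3] add_mono[OF t d] by linarith
  qed simp
  finally show ?thesis .
qed

text \<open>With an empty set of matched pairs everything is charged the diameter.\<close>

lemma WW2_pfm_le_max:
  assumes N: "N \<ge> 1" and \<alpha>: "\<alpha> > 0"
    and X: "X \<in> {..<N} \<rightarrow> dgm_space M K" and Y: "Y \<in> {..<N} \<rightarrow> dgm_space M K"
  shows "(WW2 (pfm N K M \<alpha> X) (pfm N K M \<alpha> Y))\<^sup>2 \<le> ennreal ((max_W2 M (N * K))\<^sup>2)"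
  using WW2_coupling_le[OF N \<alpha> X Y, of "{} :: unit set" "\<lambda>_. {}" "\<lambda>_. {}" "\<lambda>_. 0" 0] by simp

theorem corollary5p4:
  fixes N K :: nat and M \<alpha> Mbar C C' :: real
  assumes "N \<ge> 1" and "K \<ge> 1" and "M > 0" and "\<alpha> > 0"
    and "Mbar = max_W2 M (N * K)"
    and "C = sqrt (2 * (1 / (real N)\<^sup>2 + Mbar\<^sup>2 / \<alpha>\<^sup>2) + 4 * Mbar\<^sup>2 / \<alpha> + 1)"
    and "C' = max (C * sqrt (real N * real K + 1)) Mbar"
  shows "pfm N K M \<alpha> \<in> ({..<N} \<rightarrow> dgm_space M K) \<rightarrow> dgm_prob M (N * K) \<and>
    (\<forall>X \<in> {..<N} \<rightarrow> dgm_space M K. \<forall>Y \<in> {..<N} \<rightarrow> dgm_space M K.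
       WW2 (pfm N K M \<alpha> X) (pfm N K M \<alpha> Y) \<le> ennreal C' * ennsqrt (tuple_dist N X Y))"
proof (intro conjI ballI)
  show "pfm N K M \<alpha> \<in> ({..<N} \<rightarrow> dgm_space M K) \<rightarrow> dgm_prob M (N * K)"
    by (rule funcsetI) (rule pfm_in_dgm_prob[OF assms(1,4)])
  fix X Y assume X: "X \<in> {..<N} \<rightarrow> dgm_space M K" and Y: "Y \<in> {..<N} \<rightarrow> dgm_space M K"
  obtain J f where J: "J \<subseteq> labels N X" and f: "inj_on f J" "f ` J \<subseteq> labels N Y" "\<forall>l\<in>J. fst (f l) = fst l"
    and sum: "(\<Sum>i<N. (W2 (X i) (Y i))\<^sup>2) = ennreal ((\<Sum>l\<in>J. (norm (loc l - loc (f l)))\<^sup>2)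
      + (\<Sum>l\<in>labels N X - J. (pers (loc l))\<^sup>2 / 2) + (\<Sum>l\<in>labels N Y - f ` J. (pers (loc l))\<^sup>2 / 2))"
    using tuple_matching[OF X Y] by auto
  let ?d = "(\<Sum>l\<in>J. (norm (loc l - loc (f l)))\<^sup>2)
      + (\<Sum>l\<in>labels N X - J. (pers (loc l))\<^sup>2 / 2) + (\<Sum>l\<in>labels N Y - f ` J. (pers (loc l))\<^sup>2 / 2)"
  have d0: "0 \<le> ?d" by (intro add_nonneg_nonneg sum_nonneg) simp_all
  \<comment> \<open>By the choice of \<open>f\<close> this is the tuple distance itself.\<close>
  define \<delta> where "\<delta> = sqrt ?d"
  have \<delta>: "0 \<le> \<delta>" "\<delta>\<^sup>2 = ?d" using d0 by (simp_all add: \<delta>_def)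
  have tuple: "ennsqrt (tuple_dist N X Y) = ennreal (sqrt \<delta>)"
    unfolding tuple_dist_def sum ennsqrt_ennreal[OF d0] \<delta>_def[symmetric] using \<delta>(1) by (rule ennsqrt_ennreal)
  have Mbar0: "0 \<le> Mbar" by (simp add: assms(5) max_W2_def)
  have C'0: "0 \<le> C'" using Mbar0 by (simp add: assms(7))
  define n where "n = real N * real K + 1"
  have n: "1 \<le> n" by (simp add: n_def)
  have C2: "C\<^sup>2 = 2 * (1 / (real N)\<^sup>2 + Mbar\<^sup>2 / \<alpha>\<^sup>2) + 4 * Mbar\<^sup>2 / \<alpha> + 1"
    unfolding assms(6) using assms(4) by (intro real_sqrt_pow2 add_nonneg_nonneg mult_nonneg_nonneg divide_nonneg_nonneg) simp_all
  have C0: "0 \<le> C" unfolding assms(6) using assms(4)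
    by (intro real_sqrt_ge_zero add_nonneg_nonneg mult_nonneg_nonneg divide_nonneg_nonneg) simp_all
  \<comment> \<open>For \<delta> > 1 the diameter is absorbed by \<open>C'\<close>, which is at
    least \<open>Mbar\<close>; for \<delta> \<le> 1 quadratic terms are bounded by linear
    ones.\<close>
  have "(WW2 (pfm N K M \<alpha> X) (pfm N K M \<alpha> Y))\<^sup>2 \<le> ennreal (C'\<^sup>2 * \<delta>)"
  proof (cases "\<delta> \<le> 1")
    case False
    have "(WW2 (pfm N K M \<alpha> X) (pfm N K M \<alpha> Y))\<^sup>2 \<le> ennreal (Mbar\<^sup>2)"
      unfolding assms(5) by (rule WW2_pfm_le_max[OF assms(1,4) X Y])
    also have "\<dots> \<le> ennreal (C'\<^sup>2 * \<delta>)"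
    proof (rule ennreal_leI)
      have "Mbar\<^sup>2 \<le> C'\<^sup>2" using Mbar0 by (intro power_mono) (simp_all add: assms(7))
      also have "\<dots> = C'\<^sup>2 * 1" by simp
      also have "\<dots> \<le> C'\<^sup>2 * \<delta>" using False by (intro mult_left_mono) simp_all
      finally show "Mbar\<^sup>2 \<le> C'\<^sup>2 * \<delta>" .
    qed
    finally show ?thesis .
  next
    case True
    have sq: "\<delta>\<^sup>2 \<le> \<delta>" using True \<delta>(1) by (simp add: power2_eq_square mult_left_le_one_le)
    have "(WW2 (pfm N K M \<alpha> X) (pfm N K M \<alpha> Y))\<^sup>2
      \<le> ennreal (\<delta>\<^sup>2 + Mbar\<^sup>2 * (2 * n * \<delta> / \<alpha> + \<delta>\<^sup>2 / \<alpha>\<^sup>2))"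
      unfolding assms(5) n_def by (rule WW2_pfm_power2_le[OF assms(1,4) X Y J f \<delta>])
    also have "\<dots> \<le> ennreal (C'\<^sup>2 * \<delta>)"
    proof (rule ennreal_leI)
      \<comment> \<open>As \<open>n\<close> is at least 1, it can be inserted into the terms lacking
        it, and then \<open>n * \<delta>\<close> factors out.\<close>
      have n\<delta>: "\<delta>\<^sup>2 \<le> n * \<delta>" using sq n \<delta>(1) mult_right_mono[of 1 n \<delta>] by simp
      have "\<delta>\<^sup>2 + Mbar\<^sup>2 * (2 * n * \<delta> / \<alpha> + \<delta>\<^sup>2 / \<alpha>\<^sup>2)
        \<le> n * \<delta> + Mbar\<^sup>2 * (2 * n * \<delta> / \<alpha> + n * \<delta> / \<alpha>\<^sup>2)"
        using assms(4) by (intro add_mono mult_left_mono divide_right_mono[OF n\<delta>] n\<delta> order_refl) simp_all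
      also have "\<dots> = (1 + (2 * Mbar\<^sup>2 / \<alpha> + Mbar\<^sup>2 / \<alpha>\<^sup>2)) * (n * \<delta>)"
        by (simp add: algebra_simps)
      also have "\<dots> \<le> C\<^sup>2 * (n * \<delta>)"
      proof (rule mult_right_mono)
        \<comment> \<open>The coefficients obtained against those in the square of \<open>C\<close>,
          with \<open>a\<close>, \<open>b\<close>, \<open>c\<close> standing for
          \<open>1 / N^2\<close>, \<open>Mbar^2 / \<alpha>\<close> and
          \<open>Mbar^2 / \<alpha>^2\<close>.\<close>
        have "1 + (2 * b + c) \<le> 2 * (a + c) + 4 * b + 1" if "0 \<le> a" "0 \<le> b" "0 \<le> c" for a b c :: real
          using that by (simp add: algebra_simps)
        from this[of "1 / (real N)\<^sup>2" "Mbar\<^sup>2 / \<alpha>" "Mbar\<^sup>2 / \<alpha>\<^sup>2"] assms(4) show "1 + (2 * Mbar\<^sup>2 / \<alpha> + Mbar\<^sup>2 / \<alpha>\<^sup>2) \<le> C\<^sup>2" unfolding C2 by simp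
        show "0 \<le> n * \<delta>" using n \<delta>(1) by simp
      qed
      also have "\<dots> = (C * sqrt n)\<^sup>2 * \<delta>" using n by (simp add: power_mult_distrib)
      also have "\<dots> \<le> C'\<^sup>2 * \<delta>"
        using C0 n \<delta>(1) by (intro mult_right_mono power_mono) (simp_all add: assms(7) n_def)
      finally show "\<delta>\<^sup>2 + Mbar\<^sup>2 * (2 * n * \<delta> / \<alpha> + \<delta>\<^sup>2 / \<alpha>\<^sup>2) \<le> C'\<^sup>2 * \<delta>" .
    qed
    finally show ?thesis .
  qed
  also have "ennreal (C'\<^sup>2 * \<delta>) = (ennreal C' * ennsqrt (tuple_dist N X Y))\<^sup>2"
    unfolding tuple power_mult_distrib using C'0 \<delta>(1) by (simp add: ennreal_power ennreal_mult)
  finally show "WW2 (pfm N K M \<alpha> X) (pfm N K M \<alpha> Y) \<le> ennreal C' * ennsqrt (tuple_dist N X Y)"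
    by (subst ennreal_le_power2_iff)
qed

end
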